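(* Let $A$ be any finite group of odd order acting $\mathbf F_2$-linearly on $V=\mathbf F_2^n$ with $C_V(A)=0$ and $n\le 6$. Then $(A,V)$ is not balanced, i.e. $V$ has no $A$-stable subset of size $|V|/2$. Consequently $7$ is the least value of $\dim V$, over all finite groups $A$ of odd order acting $\mathbf F_2$-linearly on a finite $\mathbf F_2$-space $V$ with $C_V(A)=0$, for which the associated coprime action of $A$ on $G=B\rtimes V$ satisfies $|N_A(G)|\neq|C_G(A)/C_G(A)'|$.
   Context: $C_V(A)$ is the subspace of vectors fixed by all of $A$. $B$ is the additive group of all functions $V\to\mathbf F_2$; $(\tau_tf)(x)=f(x+t)$; $G=B\rtimes V$ has multiplication $(f,t)(g,s)=(f+\tau_tg,\,t+s)$; $A$ acts on $G$ by $a\cdot(f,t)=(f\circ a^{-1},a\cdot t)$. $C_G(A)$ is the subgroup of $A$-fixed elements of $G$, and $C_G(A)'$ its derived subgroup. $\operatorname{Irr}_A(G)$ is the set of $A$-invariant irreducible complex characters of $G$ and $N_A(G)=\{\chi\in\operatorname{Irr}_A(G):\chi(c)\ne0\ \forall c\in C_G(A)\}$. *)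

theory Defs
  imports
    "Jordan_Normal_Form.VS_Connect"
    "HOL-Library.Z2"
    "HOL-Library.FuncSet"
    "HOL-Algebra.Generated_Groups"
    "HOL-Algebra.Group_Action"
begin

text \<open>
  The vector space \<open>V = F_2^n\<close> is \<open>carrier_vec n\<close> over the two-element field \<^typ>\<open>bit\<close>.
  An action of \<open>A\<close> is a homomorphism \<open>\<phi>\<close> into the bijections of \<open>V\<close> (\<^locale>\<open>group_action\<close>);
  it need not be faithful.
\<close>

definition linear_action ::
  "('a, 'm) monoid_scheme \<Rightarrow> nat \<Rightarrow> ('a \<Rightarrow> bit vec \<Rightarrow> bit vec) \<Rightarrow> bool" where
  "linear_action A n \<phi> \<longleftrightarrow>
     group_action A (carrier_vec n) \<phi> \<and>
     (\<forall>a \<in> carrier A. \<forall>x \<in> carrier_vec n. \<forall>y \<in> carrier_vec n. \<phi> a (x + y) = \<phi> a x + \<phi> a y) \<and>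
     (\<forall>a \<in> carrier A. \<forall>c. \<forall>x \<in> carrier_vec n. \<phi> a (c \<cdot>\<^sub>v x) = c \<cdot>\<^sub>v \<phi> a x)"

definition fixed_points ::
  "('a, 'm) monoid_scheme \<Rightarrow> 'x set \<Rightarrow> ('a \<Rightarrow> 'x \<Rightarrow> 'x) \<Rightarrow> 'x set" where
  "fixed_points A X \<alpha> = {x \<in> X. \<forall>a \<in> carrier A. \<alpha> a x = x}"

text \<open>The standing hypotheses: \<open>|A|\<close> is finite and odd, and \<open>C_V(A) = 0\<close>.\<close>

definition odd_action ::
  "('a, 'm) monoid_scheme \<Rightarrow> nat \<Rightarrow> ('a \<Rightarrow> bit vec \<Rightarrow> bit vec) \<Rightarrow> bool" where
  "odd_action A n \<phi> \<longleftrightarrow>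
     finite (carrier A) \<and> odd (Coset.order A) \<and> linear_action A n \<phi> \<and>
     fixed_points A (carrier_vec n) \<phi> = {0\<^sub>v n}"

text \<open>
  The condition \<open>|S| = |V|/2\<close> is written multiplicatively, since natural-number
  division would round when \<open>n = 0\<close>.
\<close>

definition balanced ::
  "('a, 'm) monoid_scheme \<Rightarrow> nat \<Rightarrow> ('a \<Rightarrow> bit vec \<Rightarrow> bit vec) \<Rightarrow> bool" where
  "balanced A n \<phi> \<longleftrightarrow>
     (\<exists>S \<subseteq> carrier_vec n. (\<forall>a \<in> carrier A. \<phi> a ` S \<subseteq> S) \<and>
        2 * card S = card (carrier_vec n :: bit vec set))"

text \<open>
  The group \<open>G = B \<rtimes> V\<close>. Functions \<open>V \<rightarrow> F_2\<close> are extensional, i.e. they take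
  the value \<^const>\<open>undefined\<close> outside \<open>V\<close>, so that each is represented exactly once.
\<close>

definition transl :: "nat \<Rightarrow> bit vec \<Rightarrow> (bit vec \<Rightarrow> bit) \<Rightarrow> bit vec \<Rightarrow> bit" where
  "transl n t f = (\<lambda>x \<in> carrier_vec n. f (x + t))"

definition wreath :: "nat \<Rightarrow> ((bit vec \<Rightarrow> bit) \<times> bit vec) monoid" where
  "wreath n = \<lparr>
     carrier = (carrier_vec n \<rightarrow>\<^sub>E UNIV) \<times> carrier_vec n,
     monoid.mult = (\<lambda>(f, t) (g, s). (\<lambda>x \<in> carrier_vec n. f x + transl n t g x, t + s)),
     monoid.one = (\<lambda>x \<in> carrier_vec n. 0, 0\<^sub>v n) \<rparr>"

definition wreath_act ::
  "('a, 'm) monoid_scheme \<Rightarrow> nat \<Rightarrow> ('a \<Rightarrow> bit vec \<Rightarrow> bit vec) \<Rightarrow>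
    'a \<Rightarrow> (bit vec \<Rightarrow> bit) \<times> bit vec \<Rightarrow> (bit vec \<Rightarrow> bit) \<times> bit vec" where
  "wreath_act A n \<phi> a = (\<lambda>(f, t). (\<lambda>x \<in> carrier_vec n. f (\<phi> (inv\<^bsub>A\<^esub> a) x), \<phi> a t))"

text \<open>Irreducible complex characters, as extensional functions on the carrier.\<close>

definition irreducible_rep ::
  "('g, 'm) monoid_scheme \<Rightarrow> nat \<Rightarrow> ('g \<Rightarrow> complex mat) \<Rightarrow> bool" where
  "irreducible_rep G d \<rho> \<longleftrightarrow>
     \<rho> \<in> hom G (units_of (ring_mat TYPE(complex) d ())) \<and> d > 0 \<and>
     (\<forall>W. VectorSpace.subspace class_ring W (module_vec TYPE(complex) d) \<and>
          (\<forall>g \<in> carrier G. \<forall>w \<in> W. \<rho> g *\<^sub>v w \<in> W) \<longrightarrow>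
          W = {0\<^sub>v d} \<or> W = carrier_vec d)"

definition rep_character ::
  "('g, 'm) monoid_scheme \<Rightarrow> nat \<Rightarrow> ('g \<Rightarrow> complex mat) \<Rightarrow> 'g \<Rightarrow> complex" where
  "rep_character G d \<rho> = (\<lambda>g \<in> carrier G. \<Sum>i<d. \<rho> g $$ (i, i))"

definition Irr :: "('g, 'm) monoid_scheme \<Rightarrow> ('g \<Rightarrow> complex) set" where
  "Irr G = {rep_character G d \<rho> | d \<rho>. irreducible_rep G d \<rho>}"

definition Irr_inv ::
  "('a, 'm) monoid_scheme \<Rightarrow> ('g, 'k) monoid_scheme \<Rightarrow> ('a \<Rightarrow> 'g \<Rightarrow> 'g) \<Rightarrow> ('g \<Rightarrow> complex) set" where
  "Irr_inv A G \<alpha> = {\<chi> \<in> Irr G. \<forall>a \<in> carrier A. \<forall>g \<in> carrier G. \<chi> (\<alpha> a g) = \<chi> g}"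

text \<open>The set \<open>N_A(G)\<close>:\<close>

definition nonvanishing_Irr_inv ::
  "('a, 'm) monoid_scheme \<Rightarrow> ('g, 'k) monoid_scheme \<Rightarrow> ('a \<Rightarrow> 'g \<Rightarrow> 'g) \<Rightarrow> ('g \<Rightarrow> complex) set" where
  "nonvanishing_Irr_inv A G \<alpha> =
     {\<chi> \<in> Irr_inv A G \<alpha>. \<forall>c \<in> fixed_points A (carrier G) \<alpha>. \<chi> c \<noteq> 0}"

definition fixed_subgroup ::
  "('a, 'm) monoid_scheme \<Rightarrow> ('g, 'k) monoid_scheme \<Rightarrow> ('a \<Rightarrow> 'g \<Rightarrow> 'g) \<Rightarrow> ('g, 'k) monoid_scheme" where
  "fixed_subgroup A G \<alpha> = G\<lparr>carrier := fixed_points A (carrier G) \<alpha>\<rparr>"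

definition abelianization :: "('g, 'm) monoid_scheme \<Rightarrow> 'g set monoid" where
  "abelianization H = H Mod derived H (carrier H)"

text \<open>\<open>|N_A(G)| \<noteq> |C_G(A) / C_G(A)'|\<close> for the associated action of \<open>A\<close> on \<open>G = B \<rtimes> V\<close>.\<close>

definition counts_differ ::
  "('a, 'm) monoid_scheme \<Rightarrow> nat \<Rightarrow> ('a \<Rightarrow> bit vec \<Rightarrow> bit vec) \<Rightarrow> bool" where
  "counts_differ A n \<phi> \<longleftrightarrow>
     card (nonvanishing_Irr_inv A (wreath n) (wreath_act A n \<phi>)) \<noteq>
     Coset.order (abelianization (fixed_subgroup A (wreath n) (wreath_act A n \<phi>)))"

end

theory Submission
  imports Defs "HOL-Algebra.Sylow" "HOL-Number_Theory.Cong"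
begin

text \<open>
  By Clifford theory the irreducible characters of \<open>G = B \<rtimes> V\<close> are induced from
  \<open>\<lambda>\<^sub>S \<psi>\<close>, where \<open>\<lambda>\<^sub>S(f) = (-1)^(\<Sum>x\<in>S. f x)\<close> for a subset \<open>S\<close> of \<open>V\<close> and \<open>\<psi>\<close> is a character of the
  stabilizer of \<open>S\<close> under translations. Since \<open>|A|\<close> is odd and \<open>C_V(A) = 0\<close>, averaging over \<open>A\<close> shows
  that the \<open>A\<close>-invariant ones correspond to the \<open>A\<close>-stable sets \<open>S\<close>, with \<open>\<psi> = 1\<close>. The group \<open>C_G(A)\<close> is the
  elementary abelian group of \<open>A\<close>-invariant functions, hence has equally many elements. At an
  \<open>A\<close>-invariant \<open>f\<close> the character of \<open>S\<close> is a multiple of \<open>\<Sum>x\<in>V. \<lambda>\<^sub>S\<^sub>+\<^sub>x(f)\<close>, which vanishes iff the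
  \<open>A\<close>-stable set of all \<open>x\<close> with \<open>\<lambda>\<^sub>S\<^sub>+\<^sub>x(f) = -1\<close> is half of \<open>V\<close>; every stable half arises, with \<open>f\<close> the indicator
  of \<open>0\<close>. So the two counts differ iff the action is balanced.

  In dimension at most six, let \<open>P\<close> be a Sylow \<open>p\<close>-subgroup of \<open>A\<close>. A stable set is congruent modulo
  \<open>p\<close> to its intersection with the subspace \<open>C_V(P)\<close>, and an orbit has size prime to \<open>p\<close> iff it meets
  \<open>C_V(P)\<close>. As orbits have odd size, comparing these congruences for \<open>p = 3, 5, 7, 31\<close> leaves no room
  for a stable half, once an orbit of size 9 with exactly two points in \<open>C_V(P)\<close>, \<open>p = 7\<close>, is excluded. In dimension seven the group of order 21 acting on \<open>F_4 \<oplus> F_4 \<oplus> F_8\<close> is balanced.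
\<close>

section \<open>Orbits and fixed points of p-subgroups\<close>

text \<open>The group A is arbitrary of odd order and its action need not be faithful, so the
  low-dimensional part is pure arithmetic with orbit sizes. What makes it finite: if p divides some
  orbit size and C_V(P) has dimension k, then p divides 2^n - 2^k, hence 2^(n-k) - 1, and k = 0 is
  impossible because p would then divide the power of two |S|. As n - k is at most 5, only the
  primes 3, 5, 7, 31 remain. Passing to the complement, 0 may be assumed outside S, so every orbit
  in S has odd size at least 3. The last case is n = 6, p = 7, k = 3. The 4 points of S in C_V(P)
  must be shared among orbits of sizes 3, 9, 27, which contain 3, 2, 6 of them modulo 7. Only 2 + 2
  survives the count, which is why orbits of size 9 need an argument of their own. On the character
  side the induced representations are explicit monomial matrices. An arbitrary irreducible
  representation is compared with one of them through a nonzero intertwiner built from a joint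
  eigenvector of B and of the stabilizer of S.\<close>

declare add_bit_eq_xor [simp del] mult_bit_eq_and [simp del]

lemma UNIV_bit: "(UNIV :: bit set) = {0, 1}"
  by (auto simp del: bit_not_one_iff bit_not_zero_iff) (metis bit.exhaust)

lemma bit_vec_space:
  shows finite_bit_vec [simp]: "finite (carrier_vec n :: bit vec set)"
    and card_bit_vec: "card (carrier_vec n :: bit vec set) = 2 ^ n"
proof -
  let ?L = "{xs :: bit list. set xs \<subseteq> UNIV \<and> length xs = n}"
  have f: "finite (UNIV :: bit set)" and c: "card (UNIV :: bit set) = 2"
    unfolding UNIV_bit by simp_all
  have b: "bij_betw vec_of_list ?L (carrier_vec n)"
  proof (rule bij_betw_byWitness[where f' = list_of_vec])
    show "vec_of_list ` ?L \<subseteq> carrier_vec n"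
      by (auto intro: carrier_vecI)
    show "list_of_vec ` carrier_vec n \<subseteq> ?L" by fastforce
  qed (simp_all add: list_vec vec_list)
  show "finite (carrier_vec n :: bit vec set)"
    using finite_lists_length_eq[OF f] bij_betw_finite[OF b] by blast
  show "card (carrier_vec n :: bit vec set) = 2 ^ n"
    using card_lists_length_eq[OF f, of n] bij_betw_same_card[OF b] c by simp
qed

lemma bit_double [simp]: "(a::bit) + a = 0"
  by (cases a) (simp_all add: plus_bit_def zero_bit_def)

lemma bit_vec_add_self: "x \<in> carrier_vec n \<Longrightarrow> (x :: bit vec) + x = 0\<^sub>v n"
  by (rule eq_vecI) simp_all

lemma bit_vec_add_cancel:
  assumes "x \<in> carrier_vec n" "(t :: bit vec) \<in> carrier_vec n"
  shows "x + t + t = x" and "t + (t + x) = x" and "t + (x + t) = x"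
proof -
  have *: "a + b + b = a" "b + (b + a) = a" "b + (a + b) = a" for a b :: bit
    by (metis bit_double add.assoc add.commute add_0_right)+
  show "x + t + t = x" "t + (t + x) = x" "t + (x + t) = x"
    by (rule eq_vecI; use assms in \<open>simp add: *\<close>)+
qed

section \<open>Orbits and stable sets of a group action\<close>

context group_action
begin

abbreviation stable :: "'c set \<Rightarrow> bool" where
  "stable X \<equiv> X \<subseteq> E \<and> (\<forall>g \<in> carrier G. \<forall>x \<in> X. \<phi> g x \<in> X)"

lemma group_G: "group G"
  using group_hom group_hom.axioms(1) by blast

lemma orbit_eqI:
  assumes "x \<in> E" "y \<in> orbit G \<phi> x"
  shows "orbit G \<phi> y = orbit G \<phi> x"
proof -
  have o: "orbit G \<phi> z \<subseteq> E" if "z \<in> E" for z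
    using that element_image unfolding orbit_def by blast
  have "y \<in> E" using o assms by blast
  then show ?thesis
    using assms o orbit_trans[of x y] orbit_trans[of y x] orbit_sym[of x y]
    by (meson subset_antisym subset_iff)
qed

lemma orbit_subset_stable: "stable X \<Longrightarrow> x \<in> X \<Longrightarrow> orbit G \<phi> x \<subseteq> X"
  unfolding orbit_def by blast

lemma stable_orbit:
  assumes "x \<in> E"
  shows "stable (orbit G \<phi> x)"
proof (intro conjI ballI)
  show s: "orbit G \<phi> x \<subseteq> E"
    using assms element_image unfolding orbit_def by blast
  fix g y assume g: "g \<in> carrier G" and y: "y \<in> orbit G \<phi> x"
  then have "\<phi> g y \<in> orbit G \<phi> y" unfolding orbit_def by blast
  then show "\<phi> g y \<in> orbit G \<phi> x" using orbit_eqI[OF assms y] by simp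
qed

text \<open>If g x were in Y, then x, the image of g x under the inverse of g, would be in Y
  too.\<close>

lemma stable_Diff: 
  assumes "stable X" "stable Y"
  shows "stable (X - Y)"
proof -
  interpret G: group G by (rule group_G)
  have "\<phi> g x \<notin> Y" if "g \<in> carrier G" "x \<in> X - Y" for g x
  proof
    assume "\<phi> g x \<in> Y"
    then have "\<phi> (inv g) (\<phi> g x) \<in> Y" using assms that by blast
    then show False using orbit_sym_aux[OF that(1) _ refl, of x] that assms by auto
  qed
  then show ?thesis using assms by blast
qed

lemma dvd_card_stable:
  assumes "stable X" "finite X" "\<And>x. x \<in> X \<Longrightarrow> d dvd card (orbit G \<phi> x)"
  shows "d dvd card X"
proof -
  let ?C = "orbit G \<phi> ` X"
  have "\<Union>?C = X"
  proof
    show "\<Union>?C \<subseteq> X" using orbit_subset_stable[OF assms(1)] by blast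
    show "X \<subseteq> \<Union>?C" using orbit_refl assms(1) by blast
  qed
  moreover have "pairwise disjnt ?C"
  proof (rule pairwiseI)
    fix a b assume ab: "a \<in> ?C" "b \<in> ?C" "a \<noteq> b"
    then have "a \<in> orbits G E \<phi>" "b \<in> orbits G E \<phi>"
      using assms(1) unfolding orbits_def by blast+
    then show "disjnt a b" using disjoint_union ab(3) unfolding disjnt_def by blast
  qed
  moreover have "finite a" if "a \<in> ?C" for a
    using that finite_subset[OF orbit_subset_stable[OF assms(1)] assms(2)] by blast
  ultimately have "card X = sum card ?C"
    using card_Union_disjoint[of ?C] by simp
  moreover have "d dvd sum card ?C" using assms(3) by (intro dvd_sum) auto
  ultimately show ?thesis by simp
qed

lemma card_orbit_dvd_order: "x \<in> E \<Longrightarrow> card (orbit G \<phi> x) dvd Coset.order G"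
  using orbit_stabilizer_theorem by (metis dvd_triv_left)

lemma fixed_iff_orbit_trivial:
  assumes "x \<in> E" "card (orbit G \<phi> x) = 1"
  shows "\<forall>g \<in> carrier G. \<phi> g x = x"
proof
  fix g assume g: "g \<in> carrier G"
  have "x \<in> orbit G \<phi> x" using orbit_refl assms by blast
  moreover have "\<phi> g x \<in> orbit G \<phi> x" using g unfolding orbit_def by blast
  ultimately show "\<phi> g x = x" using assms(2) by (metis card_1_singletonE singletonD)
qed

text \<open>Orbit sizes divide a power of p, so every orbit that is not a single fixed point
  contributes a multiple of p.\<close>

lemma p_group_fixed_points:
  assumes "prime p" "Coset.order G = p ^ a" "stable X" "finite X"
  shows "[card X = card {x \<in> X. \<forall>g \<in> carrier G. \<phi> g x = x}] (mod p)"
proof -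
  let ?F = "{x \<in> X. \<forall>g \<in> carrier G. \<phi> g x = x}"
  have F: "stable ?F" using assms(3) by auto
  have D: "p dvd card (X - ?F)"
  proof (rule dvd_card_stable)
    show "stable (X - ?F)" by (rule stable_Diff[OF assms(3) F])
    fix x assume x: "x \<in> X - ?F"
    then have xE: "x \<in> E" using assms(3) by blast
    then obtain i where i: "card (orbit G \<phi> x) = p ^ i"
      using card_orbit_dvd_order[OF xE] assms(1,2) divides_primepow_nat by metis
    have "i \<noteq> 0"
    proof
      assume "i = 0"
      then have "x \<in> ?F" using fixed_iff_orbit_trivial[OF xE] i x by auto
      then show False using x by blast
    qed
    then show "p dvd card (orbit G \<phi> x)" using i by simp
  qed (use assms in simp)
  have "card X = card (X - ?F) + card ?F"
    using card_Int_Diff[OF assms(4), of ?F] by (simp add: Int_def)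
  then show ?thesis using D by (simp add: cong_add_rcancel_0_nat cong_0_iff)
qed

end

text \<open>X has to be stable only under P. This matters in \<open>not_two_fixed_points\<close>,
  where X is an orbit of a point stabilizer and not of the whole group.\<close>

lemma group_action_subgroup_fixed_points:
  assumes "group_action G E \<phi>" "subgroup P G" "prime p" "card P = p ^ a"
    "X \<subseteq> E" "\<And>g x. g \<in> P \<Longrightarrow> x \<in> X \<Longrightarrow> \<phi> g x \<in> X" "finite X"
  shows "[card X = card {x \<in> X. \<forall>g \<in> P. \<phi> g x = x}] (mod p)"
proof -
  interpret group_action "G\<lparr>carrier := P\<rparr>" E \<phi>
    using assms(1,2) group_action.induced_action by blast
  show ?thesis using p_group_fixed_points[of p a X] assms by (simp add: Coset.order_def)
qed

section \<open>Sylow subgroups in an odd linear action\<close>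

locale odd_linear_action =
  fixes A :: "('a, 'm) monoid_scheme" (structure) and n :: nat
    and \<phi> :: "'a \<Rightarrow> bit vec \<Rightarrow> bit vec"
  assumes odd_action: "odd_action A n \<phi>"
begin

abbreviation "V \<equiv> carrier_vec n :: bit vec set"

sublocale group_action A V \<phi>
  using odd_action unfolding odd_action_def linear_action_def by blast

sublocale A: group A by (rule group_G)

lemma finite_A [simp]: "finite (carrier A)"
  and odd_A: "odd (Coset.order A)"
  using odd_action unfolding odd_action_def by auto

lemma act_closed [simp]: "a \<in> carrier A \<Longrightarrow> x \<in> V \<Longrightarrow> \<phi> a x \<in> V"
  using element_image by blast

lemma act_add: "a \<in> carrier A \<Longrightarrow> x \<in> V \<Longrightarrow> y \<in> V \<Longrightarrow> \<phi> a (x + y) = \<phi> a x + \<phi> a y"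
  using odd_action unfolding odd_action_def linear_action_def by blast

lemma act_zero [simp]: 
  assumes "a \<in> carrier A"
  shows "\<phi> a (0\<^sub>v n) = 0\<^sub>v n"
proof -
  let ?z = "0\<^sub>v n :: bit vec"
  have z: "\<phi> a ?z \<in> V" using assms by simp
  have "\<phi> a ?z = \<phi> a (?z + ?z)" by simp
  also have "\<dots> = \<phi> a ?z + \<phi> a ?z" by (rule act_add[OF assms]) auto
  also have "\<dots> = ?z" by (rule bit_vec_add_self[OF z])
  finally show ?thesis .
qed

lemma act_fixed_imp_zero:
  assumes "x \<in> V" "\<And>a. a \<in> carrier A \<Longrightarrow> \<phi> a x = x"
  shows "x = 0\<^sub>v n"
proof -
  have "x \<in> fixed_points A V \<phi>" unfolding fixed_points_def using assms by blast
  then show ?thesis using odd_action unfolding odd_action_def by blast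
qed

lemma act_inv [simp]:
  assumes "a \<in> carrier A" "x \<in> V"
  shows "\<phi> (inv a) (\<phi> a x) = x" and "\<phi> a (\<phi> (inv a) x) = x"
  using orbit_sym_aux[OF assms refl] orbit_sym_aux[OF A.inv_closed[OF assms(1)] assms(2) refl] assms
  by simp_all

lemma odd_card_orbit: "x \<in> V \<Longrightarrow> odd (card (orbit A \<phi> x))"
  using card_orbit_dvd_order odd_A dvd_trans by blast

lemma card_orbit_neq_1: "x \<in> V \<Longrightarrow> x \<noteq> 0\<^sub>v n \<Longrightarrow> card (orbit A \<phi> x) \<noteq> 1"
  using fixed_iff_orbit_trivial act_fixed_imp_zero by blast

definition Fix :: "'a set \<Rightarrow> bit vec set" where
  "Fix P = {x \<in> V. \<forall>g \<in> P. \<phi> g x = x}"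

text \<open>The exponent a may be 0: a prime that does not divide |A| has the trivial group as its
  Sylow subgroup, so no case distinction on p is needed.\<close>

definition sylow_subgroup :: "nat \<Rightarrow> 'a set \<Rightarrow> bool" where
  "sylow_subgroup p P \<longleftrightarrow> prime p \<and> subgroup P A \<and>
     (\<exists>a m. card P = p ^ a \<and> Coset.order A = p ^ a * m \<and> \<not> p dvd m)"

lemma sylow_subgroup_exists:
  assumes "prime p"
  obtains P where "sylow_subgroup p P"
proof -
  have "Coset.order A \<noteq> 0" using odd_A by (intro notI) simp
  then obtain a m where m: "Coset.order A = p ^ a * m" "\<not> p dvd m"
    using multiplicity_decompose'[of "Coset.order A" p] not_prime_unit[of p] assms by blast
  obtain P where "subgroup P A" "card P = p ^ a"
    using sylow_thm[OF assms group_G m(1) finite_A] by blast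
  then have "sylow_subgroup p P" using m assms unfolding sylow_subgroup_def by blast
  then show ?thesis by (rule that)
qed

lemma Fix_cong:
  assumes "sylow_subgroup p P" "stable X"
  shows "[card X = card (X \<inter> Fix P)] (mod p)"
proof -
  obtain a where a: "prime p" "subgroup P A" "card P = p ^ a"
    using assms(1) unfolding sylow_subgroup_def by blast
  have P: "P \<subseteq> carrier A" using a(2) subgroup.subset by blast
  have "[card X = card {x \<in> X. \<forall>g \<in> P. \<phi> g x = x}] (mod p)"
    by (rule group_action_subgroup_fixed_points[OF group_action_axioms a(2,1,3)])
      (use assms(2) P finite_subset[OF _ finite_bit_vec] in auto)
  moreover have "{x \<in> X. \<forall>g \<in> P. \<phi> g x = x} = X \<inter> Fix P"
    using assms(2) unfolding Fix_def by blast
  ultimately show ?thesis by simp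
qed

text \<open>Lagrange's theorem in the additive group of V stands in for linear algebra; k is the
  dimension of C_V(P).\<close>

lemma card_Fix:
  assumes "subgroup P A"
  obtains k where "card (Fix P) = 2 ^ k" "k \<le> n"
proof -
  define M :: "bit vec monoid" where "M = \<lparr>carrier = V, monoid.mult = (+), one = 0\<^sub>v n\<rparr>"
  have P: "P \<subseteq> carrier A" using assms subgroup.subset by blast
  have M: "group M"
  proof (rule groupI)
    fix x assume "x \<in> carrier M"
    then show "\<exists>y\<in>carrier M. y \<otimes>\<^bsub>M\<^esub> x = \<one>\<^bsub>M\<^esub>"
      using bit_vec_add_self by (auto simp: M_def)
  qed (simp_all add: M_def assoc_add_vec[of _ n])
  have "subgroup (Fix P) M"
  proof -
    interpret M: group M by (rule M)
    show ?thesis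
    proof (rule M.subgroupI)
      show "Fix P \<subseteq> carrier M" by (auto simp: M_def Fix_def)
      have "0\<^sub>v n \<in> Fix P" using P by (auto simp: Fix_def)
      then show "Fix P \<noteq> {}" by blast
      fix x assume x: "x \<in> Fix P"
      then have "inv\<^bsub>M\<^esub> x = x"
        by (intro M.inv_equality) (auto simp: M_def Fix_def bit_vec_add_self)
      then show "inv\<^bsub>M\<^esub> x \<in> Fix P" using x by simp
      fix y assume "y \<in> Fix P"
      then show "x \<otimes>\<^bsub>M\<^esub> y \<in> Fix P"
        using x P act_add by (auto simp: M_def Fix_def subset_iff)
    qed
  qed
  from group.lagrange[OF M this] have "card (Fix P) dvd 2 ^ n"
    by (simp add: Coset.order_def M_def card_bit_vec) (metis dvd_triv_right)
  then obtain k where k: "card (Fix P) = 2 ^ k" "k \<le> n"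
    using divides_primepow_nat[OF two_is_prime_nat, of "card (Fix P)" n] by blast
  then show ?thesis using that by blast
qed

text \<open>If P fixes a point y of the orbit, the stabilizer of y contains a full Sylow subgroup,
  so its index, the orbit size, is prime to p. Without such a point \<open>Fix_cong\<close> makes
  the size 0 modulo p.\<close>

lemma p_dvd_card_orbit_iff:
  assumes "sylow_subgroup p P" "x \<in> V"
  shows "p dvd card (orbit A \<phi> x) \<longleftrightarrow> orbit A \<phi> x \<inter> Fix P = {}"
proof
  assume "orbit A \<phi> x \<inter> Fix P = {}"
  then show "p dvd card (orbit A \<phi> x)"
    using Fix_cong[OF assms(1) stable_orbit[OF assms(2)]] by (simp add: cong_0_iff)
next
  assume d: "p dvd card (orbit A \<phi> x)"
  obtain a m where a: "prime p" "subgroup P A" "card P = p ^ a"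
      "Coset.order A = p ^ a * m" "\<not> p dvd m"
    using assms(1) unfolding sylow_subgroup_def by blast
  show "orbit A \<phi> x \<inter> Fix P = {}"
  proof (rule ccontr)
    assume "orbit A \<phi> x \<inter> Fix P \<noteq> {}"
    then obtain y where y: "y \<in> orbit A \<phi> x" "y \<in> Fix P" by blast
    then have yV: "y \<in> V" and o: "orbit A \<phi> y = orbit A \<phi> x"
      using orbit_eqI[OF assms(2) y(1)] unfolding Fix_def by blast+
    have "P \<subseteq> stabilizer A \<phi> y"
      using y(2) subgroup.subset[OF a(2)] unfolding Fix_def stabilizer_def by blast
    then have "subgroup P (A\<lparr>carrier := stabilizer A \<phi> y\<rparr>)"
      by (rule A.subgroup_incl[OF a(2) stabilizer_subgroup[OF yV]])
    from group.lagrange[OF A.subgroup_imp_group[OF stabilizer_subgroup[OF yV]] this]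
    have "card P dvd card (stabilizer A \<phi> y)"
      by (simp add: Coset.order_def) (metis dvd_triv_right)
    then have "p ^ a dvd card (stabilizer A \<phi> y)" using a(3) by simp
    \<comment> \<open>Orbit size times stabilizer order is |A|, which p^(a+1) does not
      divide.\<close>
    then have "p * p ^ a dvd card (orbit A \<phi> y) * card (stabilizer A \<phi> y)"
      using d o by (intro mult_dvd_mono) simp_all
    then have "p * p ^ a dvd m * p ^ a"
      using orbit_stabilizer_theorem[OF yV] a(4) by (metis mult.commute)
    moreover have "p ^ a \<noteq> 0" using a(1) by (simp add: prime_gt_0_nat)
    ultimately show False using a(5) by simp
  qed
qed

end

section \<open>No invariant half in dimension at most six\<close>

context odd_linear_action
begin

text \<open>Conjugacy of point stabilizers, in an elementwise form that carries an equality of two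
  stabilizers along g.\<close>

lemma stabilizer_act_iff:
  assumes "g \<in> carrier A" "h \<in> carrier A" "w \<in> V"
  shows "h \<in> stabilizer A \<phi> (\<phi> g w) \<longleftrightarrow> inv g \<otimes> h \<otimes> g \<in> stabilizer A \<phi> w"
proof -
  have "\<phi> (inv g \<otimes> h \<otimes> g) w = \<phi> (inv g) (\<phi> h (\<phi> g w))"
    using assms by (simp add: composition_rule)
  moreover have "\<phi> (inv g) (\<phi> h (\<phi> g w)) = w \<longleftrightarrow> \<phi> h (\<phi> g w) = \<phi> g w"
    using assms act_inv act_closed by metis
  ultimately show ?thesis using assms by (simp add: stabilizer_def)
qed

text \<open>
  The stabilizer \<open>H\<close> of one of the two points moves the other in an odd orbit of size \<open>1\<close> modulo \<open>p\<close>,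
  hence fixes it, so the points of the orbit with equal stabilizers form blocks of size two.
\<close>

lemma not_two_fixed_points:
  assumes P: "sylow_subgroup p P" and "odd p" and u: "u \<in> V"
    and two: "card (orbit A \<phi> u \<inter> Fix P) = 2" and le: "card (orbit A \<phi> u) \<le> 2 * p + 1"
  shows False
proof -
  let ?O = "orbit A \<phi> u"
  obtain u1 u2 where u12: "?O \<inter> Fix P = {u1, u2}" "u1 \<noteq> u2"
    using two by (metis card_2_iff)
  have OV: "?O \<subseteq> V" using stable_orbit[OF u] by blast
  have fO: "finite ?O" using OV finite_bit_vec by (rule finite_subset)
  have uV: "u1 \<in> V" "u2 \<in> V" "u1 \<in> ?O" "u2 \<in> ?O" using u12 OV by blast+
  have o12: "orbit A \<phi> u1 = ?O" "orbit A \<phi> u2 = ?O" using orbit_eqI[OF u] uV by blast+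
  define H where "H = stabilizer A \<phi> u1"
  have H: "subgroup H A" unfolding H_def by (rule stabilizer_subgroup[OF uV(1)])
  have HA: "H \<subseteq> carrier A" using H subgroup.subset by blast
  obtain a where a: "prime p" "subgroup P A" "card P = p ^ a"
    using P unfolding sylow_subgroup_def by blast
  have PH: "P \<subseteq> H"
    using u12(1) subgroup.subset[OF a(2)] unfolding H_def stabilizer_def Fix_def by blast
  interpret H: group_action "A\<lparr>carrier := H\<rparr>" V \<phi> by (rule induced_action[OF H])
  let ?Q = "orbit (A\<lparr>carrier := H\<rparr>) \<phi> u2"
  have QO: "?Q \<subseteq> ?O"
  proof -
    have "?Q \<subseteq> orbit A \<phi> u2" unfolding orbit_def using HA by auto
    then show ?thesis using o12(2) by simp
  qed
  have u1Q: "u1 \<notin> ?Q"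
  proof
    assume "u1 \<in> ?Q"
    then obtain h where h: "h \<in> H" "\<phi> h u2 = u1" unfolding orbit_def by auto
    then have "\<phi> h u1 = u1" unfolding H_def stabilizer_def by blast
    then show False using h HA uV u12(2) inj_prop[of h] by (metis inj_onD subset_iff)
  qed
  have u2Q: "u2 \<in> ?Q" using H.orbit_refl uV by blast
  have "card H dvd Coset.order A" using A.lagrange[OF H] by (metis dvd_triv_right)
  moreover have "card ?Q dvd card H"
    using H.card_orbit_dvd_order[OF uV(2)] by (simp add: Coset.order_def)
  ultimately have oddQ: "odd (card ?Q)" using odd_A by (meson dvd_trans)
  have "[card ?Q = card {x \<in> ?Q. \<forall>g \<in> P. \<phi> g x = x}] (mod p)"
  proof (rule group_action_subgroup_fixed_points[OF group_action_axioms a(2,1,3)])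
    show "?Q \<subseteq> V" using QO OV by blast
    show "finite ?Q" using QO fO finite_subset by blast
    show "\<phi> g x \<in> ?Q" if "g \<in> P" "x \<in> ?Q" for g x
      using H.stable_orbit[OF uV(2)] that PH by auto
  qed
  moreover have "{x \<in> ?Q. \<forall>g \<in> P. \<phi> g x = x} = {u2}"
  proof
    show "{x \<in> ?Q. \<forall>g \<in> P. \<phi> g x = x} \<subseteq> {u2}"
    proof
      fix x assume x: "x \<in> {x \<in> ?Q. \<forall>g \<in> P. \<phi> g x = x}"
      then have "x \<in> ?O \<inter> Fix P" using QO OV unfolding Fix_def by auto
      moreover have "x \<noteq> u1" using x u1Q by auto
      ultimately show "x \<in> {u2}" using u12(1) by simp
    qed
    have "u2 \<in> Fix P" using u12(1) by blast
    then show "{u2} \<subseteq> {x \<in> ?Q. \<forall>g \<in> P. \<phi> g x = x}"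
      using u2Q unfolding Fix_def by simp
  qed
  ultimately have c: "[card ?Q = 1] (mod p)" by simp
  have "card ?Q < card ?O"
    by (rule psubset_card_mono[OF fO]) (use QO u1Q uV(3) in blast)
  then have "card ?Q \<le> 2 * p" using le by simp
  moreover have m: "card ?Q mod p = 1" using c prime_gt_1_nat[OF a(1)] by (simp add: cong_def)
  define q where "q = card ?Q div p"
  have q: "card ?Q = q * p + 1" using m div_mult_mod_eq[of "card ?Q" p] by (simp add: q_def)
  ultimately have "q * p < 2 * p" by linarith
  then have "q = 0 \<or> q = 1" by auto
  \<comment> \<open>The alternative \<open>q = 1\<close> gives size p + 1, which is even, while the
    orbit of u2 under H is odd.\<close>
  then have "card ?Q = 1" using q oddQ \<open>odd p\<close> by auto
  then have "\<forall>h \<in> H. \<phi> h u2 = u2" using H.fixed_iff_orbit_trivial[OF uV(2)] by simp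
  then have sub: "stabilizer A \<phi> u1 \<subseteq> stabilizer A \<phi> u2"
    unfolding H_def stabilizer_def by blast
  have "card (stabilizer A \<phi> u1) = card (stabilizer A \<phi> u2)"
    using orbit_stabilizer_theorem[OF uV(1)] orbit_stabilizer_theorem[OF uV(2)] o12 fO uV(3)
    by (metis card_0_eq empty_iff mult_cancel1)
  then have S12: "stabilizer A \<phi> u1 = stabilizer A \<phi> u2"
    using sub card_subset_eq finite_subset[OF stabilizer_subset finite_A] by blast
  define F where "F v = {w \<in> ?O. stabilizer A \<phi> w = stabilizer A \<phi> v}" for v
  \<comment> \<open>A point with the same stabilizer as u1 is fixed by P, hence is u1 or u2.\<close>
  have F1: "F u1 = {u1, u2}"
  proof
    show "F u1 \<subseteq> {u1, u2}"
      using u12(1) PH OV subgroup.subset[OF a(2)]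
      unfolding F_def H_def stabilizer_def Fix_def by blast
    show "{u1, u2} \<subseteq> F u1" using uV S12 unfolding F_def by simp
  qed
  have act: "\<phi> g w \<in> F (\<phi> g v)" if "g \<in> carrier A" "v \<in> ?O" "w \<in> F v" for g v w
  proof -
    have "stabilizer A \<phi> (\<phi> g w) = stabilizer A \<phi> (\<phi> g v)"
    proof -
      have wv: "w \<in> V" "v \<in> V" "stabilizer A \<phi> w = stabilizer A \<phi> v"
        using that OV unfolding F_def by auto
      have "h \<in> stabilizer A \<phi> (\<phi> g w) \<longleftrightarrow> h \<in> stabilizer A \<phi> (\<phi> g v)"
        if "h \<in> carrier A" for h
        using stabilizer_act_iff[OF \<open>g \<in> carrier A\<close> that] wv by simp
      then show ?thesis using stabilizer_subset by (intro equalityI subsetI) (metis subset_iff)+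
    qed
    then show ?thesis using stable_orbit[OF u] that unfolding F_def by blast
  qed
  have cF: "card (F v) = 2" if v: "v \<in> ?O" for v
  proof -
    obtain g where g: "g \<in> carrier A" "v = \<phi> g u1" using v o12(1) unfolding orbit_def by blast
    have "\<phi> (inv g) v = u1" using g uV by simp
    have "F v = \<phi> g ` F u1"
    proof
      show "\<phi> g ` F u1 \<subseteq> F v" using act[OF g(1) uV(3)] g(2) by blast
      show "F v \<subseteq> \<phi> g ` F u1"
      proof
        fix w assume w: "w \<in> F v"
        then have "\<phi> (inv g) w \<in> F u1"
          using act[OF A.inv_closed[OF g(1)] v w] \<open>\<phi> (inv g) v = u1\<close> by simp
        moreover have "w = \<phi> g (\<phi> (inv g) w)" using w OV g(1) unfolding F_def by auto
        ultimately show "w \<in> \<phi> g ` F u1" by blast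
      qed
    qed
    moreover have "inj_on (\<phi> g) (F u1)"
      using inj_prop[OF g(1)] by (rule inj_on_subset) (use uV F1 in simp)
    ultimately show ?thesis using F1 u12(2) by (simp add: card_image)
  qed
  \<comment> \<open>The classes of equal stabilizer partition the orbit into pairs, contradicting
    its odd size.\<close>
  have "2 * card (F ` ?O) = card (\<Union>(F ` ?O))"
  proof (rule card_partition)
    have "\<Union>(F ` ?O) \<subseteq> ?O" unfolding F_def by blast
    then show "finite (\<Union>(F ` ?O))" using fO finite_subset by blast
    show "card c = 2" if "c \<in> F ` ?O" for c using that cF by blast
    show "c1 \<inter> c2 = {}" if "c1 \<in> F ` ?O" "c2 \<in> F ` ?O" "c1 \<noteq> c2" for c1 c2
      using that unfolding F_def by auto
  qed (use fO in simp)
  moreover have "\<Union>(F ` ?O) = ?O" unfolding F_def by blast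
  ultimately show False using odd_card_orbit[OF u] by (metis dvd_triv_left)
qed

text \<open>The relevant primes are those dividing an orbit size, not those dividing |A|: a prime
  that enters |A| only through the kernel of the action says nothing about V.\<close>

definition active :: "nat \<Rightarrow> bool" where
  "active p \<longleftrightarrow> prime p \<and> (\<exists>x \<in> V. p dvd card (orbit A \<phi> x))"

lemma active_odd: "active p \<Longrightarrow> odd p"
  unfolding active_def using odd_card_orbit dvd_trans by blast

text \<open>P moves some point because p divides an orbit size, so k < n. If C_V(P) were 0, all
  orbits in S would have size divisible by the odd prime p, yet |S| is a power of two. The
  divisibility is \<open>Fix_cong\<close> for the whole of V.\<close>

lemma active_sylow:
  assumes "active p" and S: "stable S" "0\<^sub>v n \<notin> S" "card S = 2 ^ m"
  obtains P k where "sylow_subgroup p P" "card (Fix P) = 2 ^ k" "1 \<le> k" "k < n"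
    "p dvd 2 ^ n - 2 ^ k"
proof -
  obtain x where p: "prime p" and x: "x \<in> V" "p dvd card (orbit A \<phi> x)"
    using assms(1) unfolding active_def by blast
  obtain P where P: "sylow_subgroup p P" using sylow_subgroup_exists[OF p] .
  then have "subgroup P A" unfolding sylow_subgroup_def by blast
  then obtain k where k: "card (Fix P) = 2 ^ k" "k \<le> n" using card_Fix by blast
  have FV: "Fix P \<subseteq> V" unfolding Fix_def by blast
  have "k \<noteq> n"
  proof
    assume "k = n"
    then have "Fix P = V" using card_subset_eq[OF finite_bit_vec FV] k by (simp add: card_bit_vec)
    then have "orbit A \<phi> x \<inter> Fix P = orbit A \<phi> x" using stable_orbit[OF x(1)] by blast
    then show False using p_dvd_card_orbit_iff[OF P x(1)] x orbit_refl[OF x(1)] by auto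
  qed
  moreover have "k \<noteq> 0"
  proof
    assume "k = 0"
    moreover have "0\<^sub>v n \<in> Fix P"
      using \<open>subgroup P A\<close> subgroup.subset unfolding Fix_def by fastforce
    ultimately have F: "Fix P = {0\<^sub>v n}" using k by (metis card_1_singletonE power_0 singletonD)
    have "p dvd card S"
    proof (rule dvd_card_stable[OF S(1)])
      show "finite S" using S(1) finite_subset[OF _ finite_bit_vec] by blast
      fix y assume y: "y \<in> S"
      then have "orbit A \<phi> y \<inter> Fix P = {}" using orbit_subset_stable[OF S(1) y] S(2) F by auto
      then show "p dvd card (orbit A \<phi> y)" using p_dvd_card_orbit_iff[OF P] y S(1) by blast
    qed
    then have "p dvd 2" using S(3) p prime_dvd_power by metis
    then have "p = 2" using p by (metis primes_dvd_imp_eq two_is_prime_nat)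
    then show False using active_odd[OF assms(1)] by simp
  qed
  moreover have "p dvd 2 ^ n - 2 ^ k"
  proof -
    have "[card V = card (V \<inter> Fix P)] (mod p)" by (rule Fix_cong[OF P]) simp
    moreover have "V \<inter> Fix P = Fix P" using FV by blast
    ultimately have "[2 ^ n = 2 ^ k] (mod p)" using k by (simp add: card_bit_vec)
    moreover have "(2::nat) ^ k \<le> 2 ^ n" using k by simp
    ultimately show ?thesis by (metis cong_altdef_nat)
  qed
  ultimately show ?thesis using that[OF P k(1)] k(2) by simp
qed

text \<open>The orbit of the unique fixed point y contains no other one, so its size is 1 modulo p.
  It is not 1 itself, since only the zero vector forms an orbit alone.\<close>

lemma single_fixed_point:
  assumes P: "sylow_subgroup p P" and X: "stable X" "0\<^sub>v n \<notin> X" "card (X \<inter> Fix P) = 1"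
  obtains y where "y \<in> X" "X \<inter> Fix P \<subseteq> orbit A \<phi> y" "odd (card (orbit A \<phi> y))"
    "card (orbit A \<phi> y) \<noteq> 1" "card (orbit A \<phi> y) mod p = 1 mod p"
    "card (orbit A \<phi> y) \<le> card X"
proof -
  obtain y where y: "X \<inter> Fix P = {y}" using X(3) card_1_singletonE by blast
  then have yX: "y \<in> X" by blast
  then have yV: "y \<in> V" using X(1) by blast
  have fX: "finite X" using X(1) finite_subset[OF _ finite_bit_vec] by blast
  have s: "orbit A \<phi> y \<subseteq> X" using orbit_subset_stable[OF X(1) yX] .
  have "orbit A \<phi> y \<inter> Fix P = {y}" using s y orbit_refl[OF yV] by blast
  then have "card (orbit A \<phi> y) mod p = 1 mod p"
    using Fix_cong[OF P stable_orbit[OF yV]] by (simp add: cong_def)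
  then show ?thesis
    using that[OF yX] y orbit_refl[OF yV] odd_card_orbit[OF yV] card_orbit_neq_1[OF yV] X(2) yX
      card_mono[OF fX s] by auto
qed

end

lemma prime_dvd_2_mult:
  assumes "prime p" "odd p" "p dvd 2 ^ i * m"
  shows "(p :: nat) dvd m"
proof -
  have "\<not> p dvd 2 ^ i"
    using assms prime_dvd_power[of p 2 i] by (metis primes_dvd_imp_eq even_numeral two_is_prime_nat dvd_refl)
  then show ?thesis using assms prime_dvd_mult_iff by blast
qed

section \<open>The possible values of n, p and the dimension of C_V(P)\<close>

context odd_linear_action
begin

text \<open>The odd prime p divides 2^(n-k) - 1 with 1 <= n - k <= 5, that is 1, 3, 7, 15 or 31. The
  table lists the solutions with k >= 1 and n <= 6.\<close>

lemma active_cases: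
  assumes "active p" and S: "stable S" "0\<^sub>v n \<notin> S" "card S = 2 ^ m" and n: "n \<le> 6"
  obtains P k where "sylow_subgroup p P" "card (Fix P) = 2 ^ k"
    "(n, p, k) \<in> {(3, 3, 1), (4, 3, 2), (4, 7, 1), (5, 3, 1), (5, 5, 1), (5, 7, 2), (5, 3, 3),
      (6, 31, 1), (6, 3, 2), (6, 5, 2), (6, 7, 3), (6, 3, 4)}"
proof -
  obtain P k where P: "sylow_subgroup p P" "card (Fix P) = 2 ^ k" and k: "1 \<le> k" "k < n"
    "p dvd 2 ^ n - 2 ^ k"
    using active_sylow[OF assms(1) S] by blast
  have p: "prime p" and op: "odd p" using assms(1) active_odd unfolding active_def by auto
  have dv: "p dvd 2 ^ k * (2 ^ (n - k) - 1)" 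
    using k(2,3) by (simp add: right_diff_distrib' flip: power_add)
  have q: "p dvd 2 ^ (n - k) - 1" by (rule prime_dvd_2_mult[OF p op dv])
  have pr: "prime (3::nat)" "prime (5::nat)" "prime (7::nat)" "prime (31::nat)"
    by (simp_all add: prime_nat_numeral_eq)
  have pd: "p dvd 3 \<Longrightarrow> p = 3" "p dvd 5 \<Longrightarrow> p = 5" "p dvd 7 \<Longrightarrow> p = 7" "p dvd 31 \<Longrightarrow> p = 31"
    using primes_dvd_imp_eq[OF p] pr by blast+
  have pd15: "p = 3 \<or> p = 5" if "p dvd 15"
    using prime_dvd_multD[OF p, of 3 5] that pd by auto
  have p1: "p \<noteq> 1" using p by auto
  consider "n = k + 1" | "n = k + 2" | "n = k + 3" | "n = k + 4" | "n = k + 5"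
    using k n by linarith
  then have "n = k + 2 \<and> p = 3 \<or> n = k + 3 \<and> p = 7 \<or> n = k + 4 \<and> (p = 3 \<or> p = 5) \<or> n = k + 5 \<and> p = 31"
  proof cases
    case 1 then show ?thesis using q p1 by simp
  next
    case 2 then show ?thesis using q pd by simp
  next
    case 3 then show ?thesis using q pd by simp
  next
    case 4 then show ?thesis using q pd15 by simp
  next
    case 5 then show ?thesis using q pd by simp
  qed
  moreover have "k = 1 \<or> k = 2 \<or> k = 3 \<or> k = 4 \<or> k = 5" using k n by linarith
  ultimately have "(n, p, k) \<in> {(3, 3, 1), (4, 3, 2), (4, 7, 1), (5, 3, 1), (5, 5, 1), (5, 7, 2), (5, 3, 3),
      (6, 31, 1), (6, 3, 2), (6, 5, 2), (6, 7, 3), (6, 3, 4)}"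
    using n by (elim disjE conjE; simp)
  then show ?thesis by (rule that[OF P])
qed

lemma zero_in_Fix: "sylow_subgroup p P \<Longrightarrow> 0\<^sub>v n \<in> Fix P"
  using subgroup.subset[of P A] unfolding Fix_def sylow_subgroup_def by auto

lemma finite_stable: "stable X \<Longrightarrow> finite X"
  using finite_subset[OF _ finite_bit_vec] by blast

text \<open>The inequality is strict because 0 lies in C_V(P) and not in X. It is what turns a
  residue modulo p into an exact number of fixed points.\<close>

lemma card_Int_Fix_less:
  assumes "0\<^sub>v n \<notin> X" "sylow_subgroup p P" "card (Fix P) = c"
  shows "card (X \<inter> Fix P) < c"
proof -
  have "finite (Fix P)" using finite_subset[OF _ finite_bit_vec] unfolding Fix_def by auto
  moreover have "X \<inter> Fix P \<subset> Fix P" using zero_in_Fix[OF assms(2)] assms(1) by blast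
  ultimately have "card (X \<inter> Fix P) < card (Fix P)" by (rule psubset_card_mono)
  then show ?thesis using assms(3) by simp
qed

lemma card_Int_Fix_mod:
  "sylow_subgroup p P \<Longrightarrow> stable X \<Longrightarrow> card (X \<inter> Fix P) mod p = card X mod p"
  using Fix_cong[of p P X] unfolding cong_def by simp

lemma inactive_not_dvd: "\<not> active q \<Longrightarrow> prime q \<Longrightarrow> x \<in> V \<Longrightarrow> \<not> q dvd card (orbit A \<phi> x)"
  unfolding active_def by auto

end

section \<open>Elimination of the remaining dimensions and primes\<close>

locale stable_half = odd_linear_action +
  fixes S
  assumes stable_S: "S \<subseteq> carrier_vec n \<and> (\<forall>g \<in> carrier A. \<forall>x \<in> S. \<phi> g x \<in> S)"
    and zero_S: "0\<^sub>v n \<notin> S" and half_S: "2 * card S = 2 ^ n" and n6: "n \<le> 6"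
begin

lemma card_S: "card S = 2 ^ (n - 1)"
proof (cases n)
  case 0
  then have "2 * card S = 1" using half_S by simp
  then show ?thesis by simp
next
  case (Suc m)
  then show ?thesis using half_S by simp
qed

text \<open>The other half without 0. Its orbits are nontrivial too, and its size 2^(n-1) - 1 has
  other residues than |S|, which gives a second source of congruences.\<close>

definition "T = V - S - {0\<^sub>v n}"

lemma stable_T: "stable T"
proof -
  have "stable (V - S)" by (rule stable_Diff[OF _ stable_S]) auto
  then show ?thesis unfolding T_def by (rule stable_Diff) auto
qed

lemma zero_T: "0\<^sub>v n \<notin> T"
  unfolding T_def by simp

lemma card_T: "card T = 2 ^ (n - 1) - 1"
proof -
  have n0: "n \<noteq> 0"
  proof
    assume "n = 0"
    then have "2 * card S = 1" using half_S by simp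
    then show False by presburger
  qed
  have "card (V - S) = 2 ^ n - card S"
    using stable_S finite_stable[OF stable_S] by (simp add: card_Diff_subset card_bit_vec)
  then have "card (V - S) = 2 ^ (n - 1)" using half_S card_S by linarith
  moreover have "0\<^sub>v n \<in> V - S" using zero_S by simp
  ultimately show ?thesis unfolding T_def by (simp add: card_Diff_subset)
qed

lemmas cases_active = active_cases[OF _ stable_S zero_S card_S n6]

lemma inactive_other: "q \<notin> {3, 5, 7, 31} \<Longrightarrow> \<not> active q"
  using cases_active[of q] by auto

text \<open>|S| is a power of two, so some orbit in S has size prime to 3. That size is not 1, hence
  has another prime divisor.\<close>

lemma ex_active:
  obtains p where "active p" "p \<noteq> 3"
proof -
  have "\<not> 3 dvd card S"
    unfolding card_S using prime_dvd_power[of 3 "2::nat" "n - 1"] by (auto simp: prime_nat_numeral_eq)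
  then obtain x where x: "x \<in> S" "\<not> 3 dvd card (orbit A \<phi> x)"
    using dvd_card_stable[OF stable_S finite_stable[OF stable_S]] by blast
  then have xV: "x \<in> V" "x \<noteq> 0\<^sub>v n" using stable_S zero_S by auto
  obtain p where p: "prime p" "p dvd card (orbit A \<phi> x)"
    using prime_factor_nat[OF card_orbit_neq_1[OF xV]] by blast
  then have "active p" unfolding active_def using xV(1) by auto
  moreover have "p \<noteq> 3" using p x by auto
  ultimately show ?thesis by (rule that)
qed

text \<open>The number of points of S in C_V(P) is 1 modulo p and smaller than 2^k <= p, hence
  exactly 1.\<close>

lemma one_fixed_point_S:
  assumes P: "sylow_subgroup p P" "card (Fix P) = 2 ^ k" and "2 ^ k \<le> p" "2 ^ (n - 1) mod p = 1"
  obtains y where "y \<in> S" "odd (card (orbit A \<phi> y))" "card (orbit A \<phi> y) \<noteq> 1"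
    "card (orbit A \<phi> y) mod p = 1" "card (orbit A \<phi> y) \<le> 2 ^ (n - 1)"
proof -
  have m: "card (S \<inter> Fix P) mod p = 1"
    using card_Int_Fix_mod[OF P(1) stable_S] assms(4) card_S by simp
  moreover have "card (S \<inter> Fix P) < p"
    using card_Int_Fix_less[OF zero_S P] assms(3) by linarith
  ultimately have 1: "card (S \<inter> Fix P) = 1" by simp
  then have "p \<noteq> 1" using m by auto
  moreover have "p \<noteq> 0" using assms(3) by (intro notI) simp
  ultimately have "1 mod p = 1" by simp
  with single_fixed_point[OF P(1) stable_S zero_S 1] that show ?thesis
    unfolding card_S by metis
qed

lemma one_fixed_point_T:
  assumes P: "sylow_subgroup p P" "card (Fix P) = 2 ^ k" and "2 ^ k \<le> p" "(2 ^ (n - 1) - 1) mod p = 1"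
  obtains y where "y \<in> T" "T \<inter> Fix P \<subseteq> orbit A \<phi> y" "odd (card (orbit A \<phi> y))"
    "card (orbit A \<phi> y) \<noteq> 1" "card (orbit A \<phi> y) mod p = 1" "card (orbit A \<phi> y) \<le> 2 ^ (n - 1) - 1"
proof -
  have m: "card (T \<inter> Fix P) mod p = 1"
    using card_Int_Fix_mod[OF P(1) stable_T] assms(4) card_T by simp
  moreover have "card (T \<inter> Fix P) < p"
    using card_Int_Fix_less[OF zero_T P] assms(3) by linarith
  ultimately have 1: "card (T \<inter> Fix P) = 1" by simp
  then have "p \<noteq> 1" using m by auto
  moreover have "p \<noteq> 0" using assms(3) by (intro notI) simp
  ultimately have "1 mod p = 1" by simp
  with single_fixed_point[OF P(1) stable_T zero_T 1] that show ?thesis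
    unfolding card_T by metis
qed

lemma S_V: "y \<in> S \<Longrightarrow> y \<in> V" and T_V: "y \<in> T \<Longrightarrow> y \<in> V"
  using stable_S unfolding T_def by auto

lemma n_neq_4: "n \<noteq> 4"
proof
  assume n: "n = 4"
  obtain p where p: "active p" "p \<noteq> 3" by (rule ex_active)
  obtain P where P: "sylow_subgroup p P" "card (Fix P) = 2 ^ 1" and pk: "p = 7"
    using cases_active[OF p(1)] p(2) n by auto
  \<comment> \<open>The only size above 1 that is at most 8 and 1 modulo 7 is 8, which is
    even.\<close>
  have False if "odd c" "c \<noteq> 1" "c mod 7 = 1" "c \<le> 8" for c :: nat
    using that by presburger
  then show False using one_fixed_point_S[OF P] pk n by auto
qed

text \<open>An orbit of size 6, 11 or 16 is forced in S. Only 11 is odd, and 11 is not among the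
  possible primes.\<close>

lemma inactive_5_if_n_5:
  assumes n: "n = 5"
  shows "\<not> active 5"
proof
  assume p: "active 5"
  obtain P where P: "sylow_subgroup 5 P" "card (Fix P) = 2 ^ 1"
    using cases_active[OF p] n by auto
  obtain y where y: "y \<in> S" and "odd (card (orbit A \<phi> y))" "card (orbit A \<phi> y) \<noteq> 1"
    "card (orbit A \<phi> y) mod 5 = 1" "card (orbit A \<phi> y) \<le> 16"
    using one_fixed_point_S[OF P] n by auto
  moreover have "c = 11" if "odd c" "c \<noteq> 1" "c mod 5 = 1" "c \<le> 16" for c :: nat
    using that by presburger
  ultimately have "card (orbit A \<phi> y) = 11" by blast
  moreover have "\<not> 11 dvd card (orbit A \<phi> y)"
    using inactive_not_dvd[OF inactive_other _ S_V[OF y], of 11] by (simp add: prime_nat_numeral_eq)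
  ultimately show False by simp
qed

text \<open>Here p = 7 and |S| = 16 is 2 modulo 7, so the count is made in T, of size 15. It forces
  an orbit of size 8 or 15; the first is even, the second would make 5 active.\<close>

lemma n_neq_5: "n \<noteq> 5"
proof
  assume n: "n = 5"
  obtain p where p: "active p" "p \<noteq> 3" by (rule ex_active)
  moreover have "p \<noteq> 5" using p(1) inactive_5_if_n_5[OF n] by auto
  ultimately obtain P where P: "sylow_subgroup p P" "card (Fix P) = 2 ^ 2" and pk: "p = 7"
    using cases_active[OF p(1)] n by auto
  obtain y where y: "y \<in> T" and "odd (card (orbit A \<phi> y))" "card (orbit A \<phi> y) \<noteq> 1"
    "card (orbit A \<phi> y) mod 7 = 1" "card (orbit A \<phi> y) \<le> 15"
    using one_fixed_point_T[OF P] pk n by auto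
  moreover have "c = 15" if "odd c" "c \<noteq> 1" "c mod 7 = 1" "c \<le> 15" for c :: nat
    using that by presburger
  ultimately have "card (orbit A \<phi> y) = 15" by blast
  moreover have "\<not> 5 dvd card (orbit A \<phi> y)"
    using inactive_not_dvd[OF inactive_5_if_n_5[OF n] _ T_V[OF y]] by (simp add: prime_nat_numeral_eq)
  ultimately show False by simp
qed

text \<open>In dimensions up to 3 the table contains no prime other than 3.\<close>

lemma n_eq_6: "n = 6"
proof -
  obtain p where p: "active p" "p \<noteq> 3" by (rule ex_active)
  then show ?thesis using cases_active[OF p(1)] n_neq_4 n_neq_5 by auto
qed

lemma inactive_31: "\<not> active 31"
proof
  assume p: "active 31"
  obtain P where P: "sylow_subgroup 31 P" "card (Fix P) = 2 ^ 1"
    using cases_active[OF p] by auto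
  \<comment> \<open>The orbit would have to be all of S, of even size 32.\<close>
  have False if "odd c" "c \<noteq> 1" "c mod 31 = 1" "c \<le> 32" for c :: nat
    using that by presburger
  then show False using one_fixed_point_S[OF P] n_eq_6 by auto
qed

lemma active_7:
  assumes "active 7"
  obtains Q where "sylow_subgroup 7 Q" "card (Fix Q) = 8"
  using cases_active[OF assms] n_eq_6 by auto

text \<open>Among 11, 21, 31 the inactivity of 11 and 31 leaves an orbit of size 21 in T, so 7 is
  active. The other 10 points of T avoid C_V(P), so they form orbits of size 5. Such an orbit would
  have 5 points fixed by the Sylow 7-subgroup Q modulo 7, but only 3 of the 10 points are fixed by
  Q.\<close>

lemma inactive_5: "\<not> active 5"
proof
  assume p: "active 5"
  obtain P where P: "sylow_subgroup 5 P" "card (Fix P) = 2 ^ 2"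
    using cases_active[OF p] n_eq_6 by auto
  obtain y where y: "y \<in> T" "T \<inter> Fix P \<subseteq> orbit A \<phi> y" and
    c: "odd (card (orbit A \<phi> y))" "card (orbit A \<phi> y) \<noteq> 1" 
    "card (orbit A \<phi> y) mod 5 = 1" "card (orbit A \<phi> y) \<le> 31"
    using one_fixed_point_T[OF P] n_eq_6 by auto
  note yV = T_V[OF y(1)]
  have "\<not> 11 dvd card (orbit A \<phi> y)" "\<not> 31 dvd card (orbit A \<phi> y)"
    using inactive_not_dvd[OF inactive_other _ yV, of 11] inactive_not_dvd[OF inactive_31 _ yV]
    by (simp_all add: prime_nat_numeral_eq)
  moreover have "c = 21" if "odd c" "c \<noteq> 1" "c mod 5 = 1" "c \<le> 31" "\<not> 11 dvd c" "\<not> 31 dvd c" for c :: nat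
  proof -
    from that(1-4) have "c = 11 \<or> c = 21 \<or> c = 31" by presburger
    then show ?thesis using that(5,6) by auto
  qed
  ultimately have c21: "card (orbit A \<phi> y) = 21" using c by blast
  have "(7::nat) dvd 21" by simp
  then have "active 7" unfolding active_def using yV c21
    by (intro conjI bexI[of _ y]) (simp_all add: prime_nat_numeral_eq)
  then obtain Q where Q: "sylow_subgroup 7 Q" "card (Fix Q) = 8" by (rule active_7)
  define R where "R = T - orbit A \<phi> y"
  have R: "stable R" unfolding R_def by (rule stable_Diff[OF stable_T stable_orbit[OF yV]])
  have R0: "0\<^sub>v n \<notin> R" using zero_T unfolding R_def by blast
  have sub: "orbit A \<phi> y \<subseteq> T" by (rule orbit_subset_stable[OF stable_T y(1)])
  have cR: "card R = 10"
    unfolding R_def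
    using card_Diff_subset[OF finite_subset[OF sub finite_stable[OF stable_T]] sub] c21 card_T n_eq_6
    by simp
  have RQ: "card (R \<inter> Fix Q) = 3"
  proof -
    have "card (R \<inter> Fix Q) < 8" "card (R \<inter> Fix Q) mod 7 = 3"
      using card_Int_Fix_less[OF R0 Q] card_Int_Fix_mod[OF Q(1) R] cR by simp_all
    then show ?thesis by presburger
  qed
  have "R \<noteq> {}" using cR by auto
  then obtain z where z: "z \<in> R" by blast
  have zV: "z \<in> V" using z R by blast
  have zR: "orbit A \<phi> z \<subseteq> R" by (rule orbit_subset_stable[OF R z])
  have "orbit A \<phi> z \<inter> Fix P = {}" using zR y(2) unfolding R_def by auto
  then have "5 dvd card (orbit A \<phi> z)" using p_dvd_card_orbit_iff[OF P(1) zV] by simp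
  moreover have "card (orbit A \<phi> z) \<le> 10" using card_mono[OF finite_stable[OF R] zR] cR by simp
  moreover have "odd (card (orbit A \<phi> z))" by (rule odd_card_orbit[OF zV])
  moreover have "c = 5" if "5 dvd c" "c \<le> 10" "odd c" for c :: nat
    using that by presburger
  ultimately have "card (orbit A \<phi> z) = 5" by blast
  then have "card (orbit A \<phi> z \<inter> Fix Q) mod 7 = 5"
    using card_Int_Fix_mod[OF Q(1) stable_orbit[OF zV]] by simp
  moreover have "card (orbit A \<phi> z \<inter> Fix Q) \<le> card (R \<inter> Fix Q)"
    by (rule card_mono) (use zR finite_stable[OF R] in auto)
  ultimately show False using RQ by simp
qed

text \<open>Only 3 and 7 can still be active, so a size prime to 7 is a power of 3 between 3 and
  32.\<close>

lemma orbit_card_cases: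
  assumes "y \<in> S" "\<not> 7 dvd card (orbit A \<phi> y)"
  shows "card (orbit A \<phi> y) \<in> {3, 9, 27}"
proof -
  define c where "c = card (orbit A \<phi> y)"
  have yV: "y \<in> V" "y \<noteq> 0\<^sub>v n" using assms stable_S zero_S by auto
  have nd: "\<not> q dvd c" if "prime q" "q \<notin> {3, 7}" for q
  proof -
    have "\<not> active q" using inactive_other[of q] inactive_5 inactive_31 that(2) by auto
    then show ?thesis unfolding c_def by (rule inactive_not_dvd[OF _ that(1) yV(1)])
  qed
  have "c \<le> 32" unfolding c_def
    using card_mono[OF finite_stable[OF stable_S] orbit_subset_stable[OF stable_S assms(1)]] card_S n_eq_6
    by simp
  have "odd c" "c \<noteq> 1"
    using odd_card_orbit[OF yV(1)] card_orbit_neq_1[OF yV] unfolding c_def by auto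
  then obtain m where m: "c = 2 * m + 1" by (metis oddE)
  have "m = 1 \<or> m = 2 \<or> m = 3 \<or> m = 4 \<or> m = 5 \<or> m = 6 \<or> m = 7 \<or> m = 8 \<or> m = 9 \<or> m = 10
      \<or> m = 11 \<or> m = 12 \<or> m = 13 \<or> m = 14 \<or> m = 15"
    using \<open>c \<le> 32\<close> \<open>c \<noteq> 1\<close> m by presburger
  moreover have "\<not> 5 dvd c" "\<not> 11 dvd c" "\<not> 13 dvd c" "\<not> 17 dvd c"
      "\<not> 19 dvd c" "\<not> 23 dvd c" "\<not> 29 dvd c" "\<not> 31 dvd c"
    by (rule nd; simp add: prime_nat_numeral_eq)+
  moreover have "\<not> 7 dvd c" using assms(2) unfolding c_def .
  ultimately have "c \<in> {3, 9, 27}"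
    unfolding m by (elim disjE) simp_all
  then show ?thesis unfolding c_def .
qed

text \<open>S has 4 points in C_V(P), as 32 is 4 modulo 7. An orbit through one of them has size 3,
  since 27 would need 6 of them and 9 exactly 2. It uses up 3 points, and the orbit of the fourth
  would have size 1 modulo 7, which none of 3, 9, 27 is.\<close>

lemma contradiction: False
proof -
  obtain p where p: "active p" "p \<noteq> 3" by (rule ex_active)
  have "p = 7" using p inactive_other[of p] inactive_5 inactive_31 by auto
  then obtain P where P: "sylow_subgroup 7 P" "card (Fix P) = 8" using active_7 p by auto
  have c4: "card (S \<inter> Fix P) = 4"
  proof -
    have "card (S \<inter> Fix P) < 8" "card (S \<inter> Fix P) mod 7 = 4"
      using card_Int_Fix_less[OF zero_S P] card_Int_Fix_mod[OF P(1) stable_S] card_S n_eq_6 by simp_all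
    then show ?thesis by presburger
  qed
  have "S \<inter> Fix P \<noteq> {}" using c4 by auto
  then obtain y where y: "y \<in> S" "y \<in> Fix P" by blast
  define O1 where "O1 = orbit A \<phi> y"
  note yV = S_V[OF y(1)]
  have OS: "O1 \<subseteq> S" unfolding O1_def by (rule orbit_subset_stable[OF stable_S y(1)])
  have sO: "stable O1" unfolding O1_def by (rule stable_orbit[OF yV])
  have "O1 \<inter> Fix P \<noteq> {}" using y orbit_refl[OF yV] unfolding O1_def by blast
  then have "\<not> 7 dvd card O1"
    using p_dvd_card_orbit_iff[OF P(1) yV] unfolding O1_def by simp
  then have c: "card O1 \<in> {3, 9, 27}" using orbit_card_cases[OF y(1)] unfolding O1_def by simp
  have "card (O1 \<inter> Fix P) \<le> card (S \<inter> Fix P)"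
    by (rule card_mono) (use OS finite_stable[OF stable_S] in auto)
  then have le: "card (O1 \<inter> Fix P) \<le> 4" using c4 by simp
  have md: "card (O1 \<inter> Fix P) mod 7 = card O1 mod 7" by (rule card_Int_Fix_mod[OF P(1) sO])
  have "card O1 \<noteq> 27" using md le by auto
  moreover have "card O1 \<noteq> 9"
  proof
    assume c9: "card O1 = 9"
    with md le have "card (O1 \<inter> Fix P) = 2" by auto
    then show False using not_two_fixed_points[OF P(1) _ yV] c9 unfolding O1_def by simp
  qed
  ultimately have c3: "card O1 = 3" using c by blast
  then have f3: "card (O1 \<inter> Fix P) = 3" using md le by auto
  define R where "R = S - O1"
  have R: "stable R" unfolding R_def by (rule stable_Diff[OF stable_S sO])
  have R0: "0\<^sub>v n \<notin> R" unfolding R_def using zero_S by blast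
  have "R \<inter> Fix P = (S \<inter> Fix P) - (O1 \<inter> Fix P)" unfolding R_def by blast
  moreover have "O1 \<inter> Fix P \<subseteq> S \<inter> Fix P" using OS by blast
  ultimately have "card (R \<inter> Fix P) = 1"
    using f3 c4 finite_stable[OF sO] by (simp add: card_Diff_subset)
  from single_fixed_point[OF P(1) R R0 this]
  obtain z where z: "z \<in> R" and cz: "odd (card (orbit A \<phi> z))" "card (orbit A \<phi> z) \<noteq> 1" 
      "card (orbit A \<phi> z) mod 7 = 1 mod 7"
    by metis
  then have zS: "z \<in> S" unfolding R_def by blast
  have "card (orbit A \<phi> z) mod 7 = 1" using cz(3) by simp
  moreover from this have "\<not> 7 dvd card (orbit A \<phi> z)" by presburger
  then have "card (orbit A \<phi> z) \<in> {3, 9, 27}" by (rule orbit_card_cases[OF zS])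
  ultimately show False by auto
qed

end

context odd_linear_action
begin

lemma no_stable_half:
  assumes "stable S" "0\<^sub>v n \<notin> S" "2 * card S = 2 ^ n" "n \<le> 6"
  shows False
proof -
  interpret stable_half A n \<phi> S by unfold_locales (use assms in auto)
  show False by (rule contradiction)
qed

theorem not_balanced:
  assumes "n \<le> 6"
  shows "\<not> balanced A n \<phi>"
proof
  assume "balanced A n \<phi>"
  then obtain S where S: "S \<subseteq> V" "\<forall>a \<in> carrier A. \<phi> a ` S \<subseteq> S" "2 * card S = 2 ^ n"
    unfolding balanced_def card_bit_vec by blast
  have st: "stable S" using S(1,2) by blast
  show False
  proof (cases "0\<^sub>v n \<in> S")
    case False
    then show False using no_stable_half[OF st _ S(3) assms] by blast
  next
    case True
    have "stable (V - S)" by (rule stable_Diff[OF _ st]) auto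
    moreover have "2 * card (V - S) = 2 ^ n"
      using S finite_subset[OF S(1) finite_bit_vec] by (simp add: card_Diff_subset card_bit_vec)
    ultimately show False using no_stable_half[of "V - S"] True assms by blast
  qed
qed

end

section \<open>The characters of the base group\<close>

definition bsgn :: "bit \<Rightarrow> complex" where
  "bsgn b = (if b = 0 then 1 else - 1)"

lemma bsgn_simps [simp]: "bsgn 0 = 1" "bsgn 1 = - 1"
  by (simp_all add: bsgn_def)

lemma bsgn_add: "bsgn (a + b) = bsgn a * bsgn b"
  by (cases a; cases b) simp_all

lemma bsgn_sq [simp]: "bsgn b * bsgn b = 1"
  by (cases b) simp_all

lemma bsgn_neq_0 [simp]: "bsgn b \<noteq> 0"
  by (cases b) simp_all

abbreviation bitvecs :: "nat \<Rightarrow> bit vec set" where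
  "bitvecs n \<equiv> carrier_vec n"

definition bfuns :: "nat \<Rightarrow> (bit vec \<Rightarrow> bit) set" where
  "bfuns n = (carrier_vec n \<rightarrow>\<^sub>E UNIV)"

definition lam :: "bit vec set \<Rightarrow> (bit vec \<Rightarrow> bit) \<Rightarrow> complex" where
  "lam S f = (\<Prod>x\<in>S. bsgn (f x))"

definition shift :: "bit vec \<Rightarrow> bit vec set \<Rightarrow> bit vec set" where
  "shift t S = (\<lambda>x. x + t) ` S"

lemma finite_bfuns [simp]: "finite (bfuns n)"
  unfolding bfuns_def by (intro finite_PiE) (simp_all add: UNIV_bit)

lemma shift_subset: "S \<subseteq> bitvecs n \<Longrightarrow> t \<in> bitvecs n \<Longrightarrow> shift t S \<subseteq> bitvecs n"
  unfolding shift_def by auto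

lemma shift_shift:
  assumes "S \<subseteq> bitvecs n" "s \<in> bitvecs n" "t \<in> bitvecs n"
  shows "shift t (shift s S) = shift (s + t) S"
proof -
  have "x + s + t = x + (s + t)" if "x \<in> S" for x
    by (rule assoc_add_vec[of _ n]) (use that assms in auto)
  then show ?thesis unfolding shift_def image_image by (intro image_cong) auto
qed

lemma shift_zero [simp]: "S \<subseteq> bitvecs n \<Longrightarrow> shift (0\<^sub>v n) S = S"
  unfolding shift_def by (auto simp: subset_iff image_iff)

lemma shift_self [simp]:
  assumes "S \<subseteq> bitvecs n" "t \<in> bitvecs n"
  shows "shift t (shift t S) = S"
  using assms by (simp add: shift_shift[OF assms(1)] bit_vec_add_self)

lemma inj_add_vec: "t \<in> bitvecs n \<Longrightarrow> inj_on (\<lambda>x. x + t) (bitvecs n)"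
  by (rule inj_on_inverseI[where g = "\<lambda>x. x + t"]) (simp add: bit_vec_add_cancel del: assoc_add_vec)

text \<open>Translations act on the characters of B as on the sets that index them. No inverse
  appears, since in characteristic 2 a translation is its own inverse.\<close>

lemma lam_transl:
  assumes "S \<subseteq> bitvecs n" "t \<in> bitvecs n"
  shows "lam S (transl n t f) = lam (shift t S) f"
proof -
  have "lam (shift t S) f = (\<Prod>x\<in>S. bsgn (f (x + t)))"
    unfolding lam_def shift_def
    by (subst prod.reindex) (use inj_on_subset[OF inj_add_vec[OF assms(2)] assms(1)] in auto)
  moreover have "lam S (transl n t f) = (\<Prod>x\<in>S. bsgn (f (x + t)))"
    unfolding lam_def transl_def by (rule prod.cong) (use assms(1) in auto)
  ultimately show ?thesis by simp
qed

section \<open>The additive group of functions and its translations\<close>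

definition badd :: "nat \<Rightarrow> (bit vec \<Rightarrow> bit) \<Rightarrow> (bit vec \<Rightarrow> bit) \<Rightarrow> bit vec \<Rightarrow> bit" where
  "badd n f g = (\<lambda>x \<in> carrier_vec n. f x + g x)"

definition bzero :: "nat \<Rightarrow> bit vec \<Rightarrow> bit" where
  "bzero n = (\<lambda>x \<in> carrier_vec n. 0)"

lemma badd_closed [simp]: "badd n f g \<in> bfuns n"
  and bzero_closed [simp]: "bzero n \<in> bfuns n"
  and transl_closed [simp]: "transl n t f \<in> bfuns n"
  by (simp_all add: badd_def bzero_def transl_def bfuns_def)

lemma bfuns_eqI: "f \<in> bfuns n \<Longrightarrow> g \<in> bfuns n \<Longrightarrow> (\<And>x. x \<in> carrier_vec n \<Longrightarrow> f x = g x) \<Longrightarrow> f = g"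
  unfolding bfuns_def by (rule PiE_ext)

lemma badd_apply [simp]: "x \<in> bitvecs n \<Longrightarrow> badd n f g x = f x + g x"
  and bzero_apply [simp]: "x \<in> bitvecs n \<Longrightarrow> bzero n x = 0"
  and transl_apply [simp]: "x \<in> bitvecs n \<Longrightarrow> transl n t f x = f (x + t)"
  by (simp_all add: badd_def bzero_def transl_def)

lemma badd_zero [simp]: "f \<in> bfuns n \<Longrightarrow> badd n f (bzero n) = f" "f \<in> bfuns n \<Longrightarrow> badd n (bzero n) f = f"
  by (rule bfuns_eqI[of _ n]; simp)+

lemma badd_self [simp]: "f \<in> bfuns n \<Longrightarrow> badd n f f = bzero n"
  by (rule bfuns_eqI[of _ n]) (simp_all)

lemma badd_assoc: "badd n (badd n f g) h = badd n f (badd n g h)"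
  by (rule bfuns_eqI[of _ n]) (simp_all add: add.assoc)

lemma badd_commute: "badd n f g = badd n g f"
  by (rule bfuns_eqI[of _ n]) (simp_all add: add.commute)

lemma badd_cancel [simp]: "f \<in> bfuns n \<Longrightarrow> badd n g (badd n g f) = f"
  by (rule bfuns_eqI[of _ n]) (simp_all flip: add.assoc)

lemma transl_bzero [simp]: "t \<in> bitvecs n \<Longrightarrow> transl n t (bzero n) = bzero n"
  by (rule bfuns_eqI[of _ n]) (simp_all)

lemma transl_zero [simp]: "f \<in> bfuns n \<Longrightarrow> transl n (0\<^sub>v n) f = f"
  by (rule bfuns_eqI[of _ n]) (simp_all)

lemma transl_badd: "t \<in> bitvecs n \<Longrightarrow> transl n t (badd n f g) = badd n (transl n t f) (transl n t g)"
  by (rule bfuns_eqI[of _ n]) (simp_all)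

lemma transl_transl:
  assumes "s \<in> bitvecs n" "t \<in> bitvecs n"
  shows "transl n t (transl n s f) = transl n (t + s) f"
  by (rule bfuns_eqI[of _ n]) (use assms in \<open>simp_all add: assoc_add_vec[of _ n]\<close>)

lemma lam_badd: "S \<subseteq> bitvecs n \<Longrightarrow> lam S (badd n f g) = lam S f * lam S g"
  unfolding lam_def prod.distrib[symmetric]
  by (rule prod.cong) (auto simp: badd_def bsgn_add)

lemma lam_bzero [simp]: "S \<subseteq> bitvecs n \<Longrightarrow> lam S (bzero n) = 1"
  unfolding lam_def by (rule prod.neutral) (auto simp: bzero_def)

lemma lam_sq [simp]: "lam S f * lam S f = 1"
  unfolding lam_def prod.distrib[symmetric] by simp

lemma lam_cases: "lam S f = 1 \<or> lam S f = - 1"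
  using lam_sq[of S f] square_eq_1_iff by blast

text \<open>The sum equals its own negative. Each orthogonality relation below comes from a
  sign-reversing involution of this kind.\<close>

lemma sum_involution_zero:
  fixes h :: "'x \<Rightarrow> complex"
  assumes "\<And>x. x \<in> X \<Longrightarrow> i x \<in> X" "\<And>x. x \<in> X \<Longrightarrow> i (i x) = x" "\<And>x. x \<in> X \<Longrightarrow> h (i x) = - h x"
  shows "sum h X = 0"
proof -
  have "sum h X = (\<Sum>x\<in>X. - h x)"
    by (rule sum.reindex_bij_witness[of _ i i]) (use assms in auto)
  then have "sum h X = - sum h X" by (simp add: sum_negf)
  then show ?thesis by simp
qed

lemma lam_orthogonal:
  assumes "S \<subseteq> bitvecs n" "S' \<subseteq> bitvecs n"
  shows "(\<Sum>f\<in>bfuns n. lam S f * lam S' f) = (if S = S' then of_nat (card (bfuns n)) else 0)"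
proof (cases "S = S'")
  case False
  have fin: "finite S" "finite S'" using assms finite_subset finite_bit_vec by blast+
  obtain x where x: "x \<in> bitvecs n" "x \<in> S \<longleftrightarrow> x \<notin> S'" using False assms by blast
  \<comment> \<open>Adding the indicator of a point x at which S and S' differ negates exactly one
    of the two factors.\<close>
  define e where "e = (\<lambda>y \<in> carrier_vec n. if y = x then 1 else (0::bit))"
  have l: "lam Q e = (if x \<in> Q then - 1 else 1)" if "Q \<subseteq> bitvecs n" for Q
  proof -
    have "finite Q" using that finite_subset finite_bit_vec by blast
    moreover have "lam Q e = (\<Prod>y\<in>Q. if y = x then - 1 else 1)"
      unfolding lam_def e_def by (rule prod.cong) (use that in auto)
    ultimately show ?thesis by simp
  qed
  have "(\<Sum>f\<in>bfuns n. lam S f * lam S' f) = 0"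
  proof (rule sum_involution_zero[of _ "\<lambda>f. badd n e f"])
    show "lam S (badd n e f) * lam S' (badd n e f) = - (lam S f * lam S' f)" for f
      using x(2) l[OF assms(1)] l[OF assms(2)]
      by (auto simp: lam_badd[OF assms(1)] lam_badd[OF assms(2)])
  qed auto
  then show ?thesis using False by simp
qed simp

text \<open>Toggling in S a point x with \<open>f x = 1\<close> reverses the sign. The relation
  shows later that the projections onto the eigenspaces of B recover a multiple of the vector
  projected.\<close>

lemma sum_lam_Pow:
  assumes "f \<in> bfuns n"
  shows "(\<Sum>S\<in>Pow (bitvecs n). lam S f) = (if f = bzero n then of_nat (card (Pow (bitvecs n))) else 0)"
proof (cases "f = bzero n")
  case True
  then show ?thesis by (simp del: card_Pow)
next
  case False
  then obtain x where x: "x \<in> bitvecs n" "f x = 1"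
    using bfuns_eqI[OF assms bzero_closed] by (force simp: bzero_def)
  define i where "i S = (if x \<in> S then S - {x} else insert x S)" for S
  have "(\<Sum>S\<in>Pow (bitvecs n). lam S f) = 0"
  proof (rule sum_involution_zero[of _ i])
    fix S assume "S \<in> Pow (bitvecs n)"
    then have "S \<subseteq> bitvecs n" by simp
    then have fin: "finite S" by (rule finite_subset) simp
    show "i S \<in> Pow (bitvecs n)" using x \<open>S \<subseteq> bitvecs n\<close> unfolding i_def by auto
    show "i (i S) = S" unfolding i_def by auto
    show "lam (i S) f = - lam S f"
    proof (cases "x \<in> S")
      case True
      then show ?thesis unfolding i_def lam_def using prod.remove[OF fin True, of "\<lambda>x. bsgn (f x)"] x by simp
    next
      case False
      then show ?thesis unfolding i_def lam_def using fin x by simp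
    qed
  qed
  then show ?thesis using False by simp
qed

text \<open>The characters of V. A character of the stabilizer of S extends to V, so indexing by a
  vector a loses nothing; the price is that several a may give the same character.\<close>

definition dotsgn :: "bit vec \<Rightarrow> bit vec \<Rightarrow> complex" where
  "dotsgn a t = bsgn (a \<bullet> t)"

lemma dotsgn_add: "a \<in> bitvecs n \<Longrightarrow> s \<in> bitvecs n \<Longrightarrow> t \<in> bitvecs n \<Longrightarrow> dotsgn a (s + t) = dotsgn a s * dotsgn a t"
  unfolding dotsgn_def by (simp add: scalar_prod_add_distrib[of _ n] bsgn_add)

lemma dotsgn_zero [simp]: "a \<in> bitvecs n \<Longrightarrow> dotsgn a (0\<^sub>v n) = 1"
  unfolding dotsgn_def by simp

lemma dotsgn_sq [simp]: "dotsgn a t * dotsgn a t = 1"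
  unfolding dotsgn_def by simp

lemma dotsgn_neq_0 [simp]: "dotsgn a t \<noteq> 0"
  unfolding dotsgn_def by simp

lemma dotsgn_zero_left [simp]: "t \<in> bitvecs n \<Longrightarrow> dotsgn (0\<^sub>v n) t = 1"
  unfolding dotsgn_def by simp

lemma sum_dotsgn:
  assumes t: "t \<in> bitvecs n"
  shows "(\<Sum>a\<in>bitvecs n. dotsgn a t) = (if t = 0\<^sub>v n then of_nat (card (bitvecs n)) else 0)"
proof (cases "t = 0\<^sub>v n")
  case True
  then show ?thesis by simp
next
  case False
  then obtain i where i: "i < n" "t $ i = 1" using t by (metis bit_not_zero_iff carrier_vecD eq_vecI index_zero_vec)
  have "(\<Sum>a\<in>bitvecs n. dotsgn a t) = 0"
  proof (rule sum_involution_zero[of _ "\<lambda>a. a + unit_vec n i"])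
    show "dotsgn (a + unit_vec n i) t = - dotsgn a t" if "a \<in> bitvecs n" for a
      unfolding dotsgn_def using that t i
      by (simp add: add_scalar_prod_distrib[of _ n] scalar_prod_left_unit[of _ n] bsgn_add)
  qed (auto simp: bit_vec_add_cancel)
  then show ?thesis using False by simp
qed

section \<open>Representations and Schur's lemma\<close>

lemma carrier_wreath: "carrier (wreath n) = bfuns n \<times> bitvecs n"
  by (simp add: wreath_def bfuns_def)

lemma mult_wreath: "(f, t) \<otimes>\<^bsub>wreath n\<^esub> (g, s) = (badd n f (transl n t g), t + s)"
  by (simp add: wreath_def badd_def)

lemma one_wreath: "\<one>\<^bsub>wreath n\<^esub> = (bzero n, 0\<^sub>v n)"
  by (simp add: wreath_def bzero_def)

lemma group_wreath: "group (wreath n)"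
proof (rule groupI)
  fix x y z assume "x \<in> carrier (wreath n)" "y \<in> carrier (wreath n)" "z \<in> carrier (wreath n)"
  then obtain f t g s h r where "x = (f, t)" "y = (g, s)" "z = (h, r)"
    "t \<in> bitvecs n" "s \<in> bitvecs n" "r \<in> bitvecs n"
    by (auto simp: carrier_wreath)
  then show "x \<otimes>\<^bsub>wreath n\<^esub> y \<otimes>\<^bsub>wreath n\<^esub> z = x \<otimes>\<^bsub>wreath n\<^esub> (y \<otimes>\<^bsub>wreath n\<^esub> z)"
    by (simp add: mult_wreath transl_badd transl_transl badd_assoc assoc_add_vec[of _ n])
next
  fix x assume "x \<in> carrier (wreath n)"
  then obtain f t where x: "x = (f, t)" "f \<in> bfuns n" "t \<in> bitvecs n" by (auto simp: carrier_wreath)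
  \<comment> \<open>In characteristic 2 both f and t are their own negatives, so only the twist by t
    remains in the inverse.\<close>
  then have "(transl n t f, t) \<otimes>\<^bsub>wreath n\<^esub> x = \<one>\<^bsub>wreath n\<^esub>"
    by (simp add: mult_wreath one_wreath bit_vec_add_self)
  moreover have "(transl n t f, t) \<in> carrier (wreath n)" using x by (simp add: carrier_wreath)
  ultimately show "\<exists>y\<in>carrier (wreath n). y \<otimes>\<^bsub>wreath n\<^esub> x = \<one>\<^bsub>wreath n\<^esub>" by blast
qed (auto simp: carrier_wreath mult_wreath one_wreath)

section \<open>Matrix representations and their invariant subspaces\<close>

definition subspace_vec :: "nat \<Rightarrow> complex vec set \<Rightarrow> bool" where
  "subspace_vec d W \<longleftrightarrow> W \<subseteq> carrier_vec d \<and> 0\<^sub>v d \<in> W \<and>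
     (\<forall>v\<in>W. \<forall>w\<in>W. v + w \<in> W) \<and> (\<forall>c. \<forall>w\<in>W. c \<cdot>\<^sub>v w \<in> W)"

lemma subspace_iff_subspace_vec:
  "VectorSpace.subspace class_ring W (module_vec TYPE(complex) d) \<longleftrightarrow> subspace_vec d W"
proof -
  interpret vec_space "TYPE(complex)" d .
  show ?thesis
    unfolding VectorSpace.subspace_def LinearCombinations.submodule_def subspace_vec_def
    using vectorspace_axioms module_axioms by (auto simp: module_vec_simps)
qed

lemma irreducible_repI:
  assumes "group G" "d > 0" "\<And>g. g \<in> carrier G \<Longrightarrow> \<rho> g \<in> carrier_mat d d"
    "\<And>g h. g \<in> carrier G \<Longrightarrow> h \<in> carrier G \<Longrightarrow> \<rho> (g \<otimes>\<^bsub>G\<^esub> h) = \<rho> g * \<rho> h" "\<rho> \<one>\<^bsub>G\<^esub> = 1\<^sub>m d"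
    "\<And>W. subspace_vec d W \<Longrightarrow> (\<And>g w. g \<in> carrier G \<Longrightarrow> w \<in> W \<Longrightarrow> \<rho> g *\<^sub>v w \<in> W) \<Longrightarrow>
      W = {0\<^sub>v d} \<or> W = carrier_vec d"
  shows "irreducible_rep G d \<rho>"
proof -
  interpret group G by (rule assms)
  have "\<rho> g \<in> Units (ring_mat TYPE(complex) d ())" if "g \<in> carrier G" for g
    unfolding Units_def ring_mat_simps
    using that assms(3)[of g] assms(3)[of "inv\<^bsub>G\<^esub> g"] assms(4)[of g "inv\<^bsub>G\<^esub> g"] assms(4)[of "inv\<^bsub>G\<^esub> g" g] assms(5)
    by auto
  then have "\<rho> \<in> hom G (units_of (ring_mat TYPE(complex) d ()))"
    unfolding hom_def using assms(4) by (auto simp: units_of_def ring_mat_simps)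
  then show ?thesis
    unfolding irreducible_rep_def subspace_iff_subspace_vec using assms(2,6) by blast
qed

lemma irreducible_repD:
  assumes "group G" "irreducible_rep G d \<rho>"
  shows "d > 0" and "\<And>g. g \<in> carrier G \<Longrightarrow> \<rho> g \<in> carrier_mat d d"
    and "\<And>g h. g \<in> carrier G \<Longrightarrow> h \<in> carrier G \<Longrightarrow> \<rho> (g \<otimes>\<^bsub>G\<^esub> h) = \<rho> g * \<rho> h"
    and "\<rho> \<one>\<^bsub>G\<^esub> = 1\<^sub>m d"
    and "\<And>W. subspace_vec d W \<Longrightarrow> (\<And>g w. g \<in> carrier G \<Longrightarrow> w \<in> W \<Longrightarrow> \<rho> g *\<^sub>v w \<in> W) \<Longrightarrow>
      W = {0\<^sub>v d} \<or> W = carrier_vec d"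
proof -
  let ?R = "ring_mat TYPE(complex) d ()"
  interpret G: group G by (rule assms(1))
  interpret R: ring ?R by (rule ring_mat)
  have h: "\<rho> \<in> hom G (units_of ?R)" and "d > 0"
    and W: "\<forall>W. subspace_vec d W \<and> (\<forall>g \<in> carrier G. \<forall>w \<in> W. \<rho> g *\<^sub>v w \<in> W) \<longrightarrow>
          W = {0\<^sub>v d} \<or> W = carrier_vec d"
    using assms(2) unfolding irreducible_rep_def subspace_iff_subspace_vec by blast+
  show "d > 0" by fact
  show "\<rho> g \<in> carrier_mat d d" if "g \<in> carrier G" for g
    using hom_in_carrier[OF h that] by (simp add: units_of_def Units_def ring_mat_simps)
  show "\<rho> (g \<otimes>\<^bsub>G\<^esub> h) = \<rho> g * \<rho> h" if "g \<in> carrier G" "h \<in> carrier G" for g h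
    using hom_mult[OF h that] by (simp add: units_of_def ring_mat_simps)
  show "\<rho> \<one>\<^bsub>G\<^esub> = 1\<^sub>m d"
    using hom_one[OF h G.is_group R.units_group] by (simp add: units_of_def ring_mat_simps)
  show "W = {0\<^sub>v d} \<or> W = carrier_vec d"
    if "subspace_vec d W" "\<And>g w. g \<in> carrier G \<Longrightarrow> w \<in> W \<Longrightarrow> \<rho> g *\<^sub>v w \<in> W" for W
    using W that by blast
qed

text \<open>With the values of a character as weights and the images of a vector under an elementary
  abelian 2-group as family, this is a multiple of the projection onto an eigenspace.\<close>

definition lincomb_vec :: "nat \<Rightarrow> 'k set \<Rightarrow> ('k \<Rightarrow> 'a :: comm_semiring_1) \<Rightarrow> ('k \<Rightarrow> 'a vec) \<Rightarrow> 'a vec" where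
  "lincomb_vec d K c u = vec d (\<lambda>i. \<Sum>k\<in>K. c k * u k $ i)"

lemma lincomb_vec_carrier [simp]: "lincomb_vec d K c u \<in> carrier_vec d"
  by (simp add: lincomb_vec_def)

lemma lincomb_vec_in_subspace:
  assumes "subspace_vec d W" "finite K" "\<And>k. k \<in> K \<Longrightarrow> u k \<in> W"
  shows "lincomb_vec d K c u \<in> W"
  using assms(2,3)
proof (induction K rule: finite_induct)
  case empty
  have "lincomb_vec d {} c u = 0\<^sub>v d" by (rule eq_vecI) (simp_all add: lincomb_vec_def)
  then show ?case using assms(1) unfolding subspace_vec_def by simp
next
  case (insert k K)
  have u: "u k \<in> carrier_vec d" using insert.prems assms(1) unfolding subspace_vec_def by auto
  have "lincomb_vec d (insert k K) c u = c k \<cdot>\<^sub>v u k + lincomb_vec d K c u"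
    by (rule eq_vecI) (use insert.hyps u in \<open>simp_all add: lincomb_vec_def\<close>)
  then show ?case using insert assms(1) unfolding subspace_vec_def by simp
qed

lemma mult_mat_vec_lincomb_vec:
  assumes "M \<in> carrier_mat m d" "\<And>k. k \<in> K \<Longrightarrow> u k \<in> carrier_vec d"
  shows "M *\<^sub>v lincomb_vec d K c u = lincomb_vec m K c (\<lambda>k. M *\<^sub>v u k)"
proof (rule eq_vecI)
  fix i assume "i < dim_vec (lincomb_vec m K c (\<lambda>k. M *\<^sub>v u k))"
  then have i: "i < m" by (simp add: lincomb_vec_def)
  have "(M *\<^sub>v lincomb_vec d K c u) $ i = (\<Sum>j<d. M $$ (i, j) * (\<Sum>k\<in>K. c k * u k $ j))"
    using i assms(1) by (simp add: lincomb_vec_def scalar_prod_def atLeast0LessThan)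
  also have "\<dots> = (\<Sum>k\<in>K. \<Sum>j<d. M $$ (i, j) * (c k * u k $ j))"
    unfolding sum_distrib_left by (rule sum.swap)
  also have "\<dots> = (\<Sum>k\<in>K. c k * (\<Sum>j<d. M $$ (i, j) * u k $ j))"
    unfolding sum_distrib_left by (intro sum.cong refl) (simp add: algebra_simps)
  also have "\<dots> = (\<Sum>k\<in>K. c k * (M *\<^sub>v u k) $ i)"
  proof (rule sum.cong[OF refl])
    fix k assume "k \<in> K"
    then have "u k \<in> carrier_vec d" by (rule assms(2))
    then show "c k * (\<Sum>j<d. M $$ (i, j) * u k $ j) = c k * (M *\<^sub>v u k) $ i"
      using i assms(1) by (auto simp: scalar_prod_def atLeast0LessThan)
  qed
  finally show "(M *\<^sub>v lincomb_vec d K c u) $ i = lincomb_vec m K c (\<lambda>k. M *\<^sub>v u k) $ i"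
    using i by (simp add: lincomb_vec_def)
qed (use assms(1) in \<open>simp add: lincomb_vec_def\<close>)

lemma trace_mult_commute:
  assumes "X \<in> carrier_mat d e" "(Y :: complex mat) \<in> carrier_mat e d"
  shows "(\<Sum>i<d. (X * Y) $$ (i, i)) = (\<Sum>i<e. (Y * X) $$ (i, i))"
proof -
  have "(\<Sum>i<d. (X * Y) $$ (i, i)) = (\<Sum>i<d. \<Sum>k<e. X $$ (i, k) * Y $$ (k, i))"
    using assms by (intro sum.cong refl) (simp add: scalar_prod_def atLeast0LessThan)
  also have "\<dots> = (\<Sum>k<e. \<Sum>i<d. Y $$ (k, i) * X $$ (i, k))"
    by (subst sum.swap) (simp add: mult.commute)
  also have "\<dots> = (\<Sum>i<e. (Y * X) $$ (i, i))"
    using assms by (intro sum.cong refl) (simp add: scalar_prod_def atLeast0LessThan)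
  finally show ?thesis .
qed

lemma mult_mat_unit_vec:
  assumes "M \<in> carrier_mat m d" "j < d"
  shows "(M :: complex mat) *\<^sub>v unit_vec d j = col M j"
  by (rule eq_vecI) (use assms in \<open>auto simp: scalar_prod_right_unit[of _ d]\<close>)

text \<open>Schur's lemma: a nonzero intertwiner has trivial kernel and full image.\<close>

lemma intertwiner_imp_character_eq:
  assumes G: "group G" and \<rho>: "irreducible_rep G d \<rho>" and \<sigma>: "irreducible_rep G e \<sigma>"
    and M: "M \<in> carrier_mat d e" "M \<noteq> 0\<^sub>m d e"
    and eq: "\<And>g. g \<in> carrier G \<Longrightarrow> \<rho> g * M = M * \<sigma> g"
  shows "rep_character G d \<rho> = rep_character G e \<sigma>"
proof -
  note R = irreducible_repD[OF G \<rho>] and S = irreducible_repD[OF G \<sigma>]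
  have eqv: "\<rho> g *\<^sub>v (M *\<^sub>v u) = M *\<^sub>v (\<sigma> g *\<^sub>v u)" if "g \<in> carrier G" "u \<in> carrier_vec e" for g u
    using assoc_mult_mat_vec[OF R(2)[OF that(1)] M(1) that(2)]
      assoc_mult_mat_vec[OF M(1) S(2)[OF that(1)] that(2)] eq[OF that(1)] by simp
  obtain i j where ij: "i < d" "j < e" "M $$ (i, j) \<noteq> 0"
    using M by (metis (no_types, lifting) carrier_matD eq_matI index_zero_mat(1,2,3))
  then have Mj: "M *\<^sub>v unit_vec e j \<noteq> 0\<^sub>v d"
    unfolding mult_mat_unit_vec[OF M(1) ij(2)] using M(1) by (metis carrier_matD index_col index_zero_vec(1))
  define W where "W = (\<lambda>u. M *\<^sub>v u) ` carrier_vec e"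
  have "subspace_vec d W"
    unfolding subspace_vec_def
  proof (intro conjI ballI allI)
    show "W \<subseteq> carrier_vec d" unfolding W_def using M(1) by auto
    have "M *\<^sub>v 0\<^sub>v e = 0\<^sub>v d" using M(1) by auto
    then show "0\<^sub>v d \<in> W" unfolding W_def by (metis imageI zero_carrier_vec)
    fix v assume "v \<in> W"
    then obtain u where u: "u \<in> carrier_vec e" "v = M *\<^sub>v u" unfolding W_def by blast
    show "c \<cdot>\<^sub>v v \<in> W" for c
      unfolding W_def u(2) using mult_mat_vec[OF M(1) u(1), of c] u(1) by (metis imageI smult_carrier_vec)
    fix w assume "w \<in> W"
    then obtain u' where u': "u' \<in> carrier_vec e" "w = M *\<^sub>v u'" unfolding W_def by blast
    show "v + w \<in> W"
      unfolding W_def u(2) u'(2) using mult_add_distrib_mat_vec[OF M(1) u(1) u'(1)] u(1) u'(1)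
      by (metis imageI add_carrier_vec)
  qed
  moreover have "\<rho> g *\<^sub>v w \<in> W" if "g \<in> carrier G" "w \<in> W" for g w
    using that eqv S(2)[OF that(1)] mult_mat_vec_carrier unfolding W_def by fastforce
  ultimately have "W = {0\<^sub>v d} \<or> W = carrier_vec d" by (rule R(5))
  moreover have "M *\<^sub>v unit_vec e j \<in> W" unfolding W_def by simp
  ultimately have W: "W = carrier_vec d" using Mj by auto
  define K where "K = {u \<in> carrier_vec e. M *\<^sub>v u = 0\<^sub>v d}"
  have "subspace_vec e K"
    unfolding subspace_vec_def K_def
    using M(1) by (auto simp: mult_add_distrib_mat_vec[OF M(1)] mult_mat_vec[OF M(1)])
  moreover have "\<sigma> g *\<^sub>v w \<in> K" if "g \<in> carrier G" "w \<in> K" for g w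
  proof -
    have w: "w \<in> carrier_vec e" "M *\<^sub>v w = 0\<^sub>v d" using that unfolding K_def by auto
    have "M *\<^sub>v (\<sigma> g *\<^sub>v w) = \<rho> g *\<^sub>v 0\<^sub>v d" using eqv[OF that(1) w(1)] w(2) by simp
    also have "\<dots> = 0\<^sub>v d" using R(2)[OF that(1)] by auto
    finally show ?thesis unfolding K_def using mult_mat_vec_carrier[OF S(2)[OF that(1)] w(1)] by simp
  qed
  ultimately have "K = {0\<^sub>v e} \<or> K = carrier_vec e" by (rule S(5))
  moreover have "unit_vec e j \<notin> K" using Mj unfolding K_def by simp
  ultimately have K: "K = {0\<^sub>v e}" by auto
  have "\<exists>u \<in> carrier_vec e. M *\<^sub>v u = unit_vec d i" for i
  proof -
    have "unit_vec d i \<in> W" using W by simp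
    then show ?thesis unfolding W_def by auto
  qed
  then obtain u where u: "\<And>i. u i \<in> carrier_vec e" "\<And>i. M *\<^sub>v u i = unit_vec d i" by metis
  \<comment> \<open>Column j of N is a preimage of the j-th unit vector, which makes N a right
    inverse of M.\<close>
  define N where "N = mat e d (\<lambda>(i, j). u j $ i)"
  have N: "N \<in> carrier_mat e d" unfolding N_def by simp
  have colN: "col N j = u j" if "j < d" for j
    using u(1)[of j] that unfolding N_def by (intro eq_vecI) auto
  have MN: "M * N = 1\<^sub>m d"
  proof (rule eq_matI)
    fix i j assume "i < dim_row (1\<^sub>m d :: complex mat)" "j < dim_col (1\<^sub>m d :: complex mat)"
    then have ij: "i < d" "j < d" by simp_all
    have "(M * N) $$ (i, j) = (M *\<^sub>v u j) $ i" using ij M(1) N colN by simp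
    then show "(M * N) $$ (i, j) = 1\<^sub>m d $$ (i, j)" using u(2) ij by simp
  qed (use M(1) N in auto)
  have NMc: "N * M \<in> carrier_mat e e" using M(1) N by simp
  \<comment> \<open>The equality of d and e is not known at this point; N is a left inverse because
    M (N M) = M and the kernel of M is trivial.\<close>
  have NM: "N * M = 1\<^sub>m e"
  proof (rule eq_matI)
    fix i j assume "i < dim_row (1\<^sub>m e :: complex mat)" "j < dim_col (1\<^sub>m e :: complex mat)"
    then have ij: "i < e" "j < e" by simp_all
    let ?v = "(N * M) *\<^sub>v unit_vec e j"
    have v: "?v \<in> carrier_vec e" using NMc by simp
    have "M *\<^sub>v ?v = (M * (N * M)) *\<^sub>v unit_vec e j"
      by (rule assoc_mult_mat_vec[symmetric, OF M(1) NMc]) simp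
    also have "M * (N * M) = M" using assoc_mult_mat[OF M(1) N M(1)] MN M(1) by simp
    finally have "M *\<^sub>v (?v - unit_vec e j) = 0\<^sub>v d"
      using mult_minus_distrib_mat_vec[OF M(1) v, of "unit_vec e j"] M(1) by simp
    then have "?v - unit_vec e j \<in> K" unfolding K_def using v by simp
    then have z: "?v - unit_vec e j = 0\<^sub>v e" using K by simp
    have "?v $ i - unit_vec e j $ i = (?v - unit_vec e j) $ i" using ij by simp
    then have "?v $ i = unit_vec e j $ i" unfolding z using ij by simp
    then show "(N * M) $$ (i, j) = 1\<^sub>m e $$ (i, j)"
      unfolding mult_mat_unit_vec[OF NMc ij(2)] using ij M(1) N by simp
  qed (use M(1) N in auto)
  \<comment> \<open>As \<rho>(g) = M \<sigma>(g) N, cyclicity of the trace leaves the trace of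
    \<sigma>(g).\<close>
  have "(\<Sum>i<d. \<rho> g $$ (i, i)) = (\<Sum>i<e. \<sigma> g $$ (i, i))" if g: "g \<in> carrier G" for g
  proof -
    have "\<rho> g = \<rho> g * (M * N)" unfolding MN using R(2)[OF g] by simp
    also have "\<dots> = (\<rho> g * M) * N" using assoc_mult_mat[OF R(2)[OF g] M(1) N] by simp
    also have "\<dots> = M * (\<sigma> g * N)" unfolding eq[OF g] using assoc_mult_mat[OF M(1) S(2)[OF g] N] by simp
    finally have "(\<Sum>i<d. \<rho> g $$ (i, i)) = (\<Sum>i<e. ((\<sigma> g * N) * M) $$ (i, i))"
      using trace_mult_commute[OF M(1), of "\<sigma> g * N"] S(2)[OF g] N by simp
    also have "(\<sigma> g * N) * M = \<sigma> g"
      using assoc_mult_mat[OF S(2)[OF g] N M(1)] NM S(2)[OF g] by simp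
    finally show ?thesis .
  qed
  then show ?thesis unfolding rep_character_def by (intro restrict_ext) simp
qed

section \<open>The irreducible characters of the wreath product\<close>

definition shifts :: "nat \<Rightarrow> bit vec set \<Rightarrow> bit vec set set" where
  "shifts n S = (\<lambda>t. shift t S) ` bitvecs n"

text \<open>The character induced from \<open>lam S\<close> times \<open>dotsgn a\<close> on the
  inertia group. V is abelian, so all translates of S have the same stabilizer and t fixes either
  all of them or none.\<close>

definition chi :: "nat \<Rightarrow> bit vec \<Rightarrow> bit vec set \<Rightarrow> (bit vec \<Rightarrow> bit) \<times> bit vec \<Rightarrow> complex" where
  "chi n a S = (\<lambda>(f, t) \<in> carrier (wreath n).
     if shift t S = S then dotsgn a t * (\<Sum>Q\<in>shifts n S. lam Q f) else 0)"

lemma shifts_subset: "S \<subseteq> bitvecs n \<Longrightarrow> Q \<in> shifts n S \<Longrightarrow> Q \<subseteq> bitvecs n"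
  unfolding shifts_def using shift_subset by blast

lemma finite_shifts [simp]: "finite (shifts n S)"
  unfolding shifts_def by simp

lemma self_in_shifts: "S \<subseteq> bitvecs n \<Longrightarrow> S \<in> shifts n S"
  unfolding shifts_def by (rule image_eqI[of _ _ "0\<^sub>v n"]) simp_all

lemma shift_in_shifts:
  assumes "S \<subseteq> bitvecs n" "Q \<in> shifts n S" "t \<in> bitvecs n"
  shows "shift t Q \<in> shifts n S"
proof -
  obtain x where "x \<in> bitvecs n" "Q = shift x S" using assms(2) unfolding shifts_def by blast
  then have "shift t Q = shift (x + t) S" "x + t \<in> bitvecs n" using assms shift_shift by auto
  then show ?thesis unfolding shifts_def by blast
qed

lemma shift_shift_commute:
  assumes "S \<subseteq> bitvecs n" "s \<in> bitvecs n" "t \<in> bitvecs n"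
  shows "shift t (shift s S) = shift s (shift t S)"
  using assms by (simp add: shift_shift comm_add_vec[of _ n])

lemma shift_fixes_shifts_iff:
  assumes "S \<subseteq> bitvecs n" "Q \<in> shifts n S" "t \<in> bitvecs n"
  shows "shift t Q = Q \<longleftrightarrow> shift t S = S"
proof -
  obtain x where x: "x \<in> bitvecs n" "Q = shift x S" using assms(2) unfolding shifts_def by blast
  have "shift t Q = shift x (shift t S)"
    unfolding x(2) by (rule shift_shift_commute[OF assms(1) x(1) assms(3)])
  then show ?thesis
    using x assms shift_self[OF assms(1) x(1)] shift_self[OF shift_subset[OF assms(1,3)] x(1)] by metis
qed

locale monomial_rep =
  fixes n :: nat and a :: "bit vec" and S :: "bit vec set"
  assumes a: "a \<in> bitvecs n" and S: "S \<subseteq> bitvecs n"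
begin

definition "basis_sets = (SOME xs. distinct xs \<and> set xs = shifts n S)"

definition "deg = length basis_sets"

abbreviation "L i \<equiv> basis_sets ! i"

definition "pos t i = (SOME j. j < deg \<and> L j = shift t (L i))"

text \<open>The induced representation, with coordinates indexed by the distinct translates
  \<open>L i\<close> of S. Since \<open>dotsgn a\<close> is defined on all of V, no cocycle of a
  transversal enters: t acts by a permutation times a scalar.\<close>

definition sigma :: "(bit vec \<Rightarrow> bit) \<times> bit vec \<Rightarrow> complex mat" where
  "sigma = (\<lambda>(f, t). mat deg deg (\<lambda>(i, j). if j = pos t i then dotsgn a t * lam (L i) f else 0))"

lemma basis_sets: "distinct basis_sets" "set basis_sets = shifts n S"
proof -
  obtain xs where "distinct xs \<and> set xs = shifts n S"
    using finite_distinct_list[OF finite_shifts] by blast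
  then have "distinct basis_sets \<and> set basis_sets = shifts n S"
    unfolding basis_sets_def by (rule someI)
  then show "distinct basis_sets" "set basis_sets = shifts n S" by auto
qed

lemma L_in: "i < deg \<Longrightarrow> L i \<in> shifts n S"
  unfolding deg_def basis_sets(2)[symmetric] by simp

lemma L_subset: "i < deg \<Longrightarrow> L i \<subseteq> bitvecs n"
  using L_in shifts_subset[OF S] by blast

lemma L_inj: "i < deg \<Longrightarrow> j < deg \<Longrightarrow> L i = L j \<longleftrightarrow> i = j"
  unfolding deg_def using nth_eq_iff_index_eq[OF basis_sets(1)] by blast

lemma L_surj:
  assumes "Q \<in> shifts n S"
  obtains i where "i < deg" "L i = Q"
  using assms unfolding deg_def basis_sets(2)[symmetric] in_set_conv_nth by blast

lemma deg_pos: "deg > 0"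
  using L_surj[OF self_in_shifts[OF S]] by (metis gr_implies_not0 neq0_conv)

lemma pos:
  assumes "i < deg" "t \<in> bitvecs n"
  shows "pos t i < deg" and "L (pos t i) = shift t (L i)"
proof -
  have "\<exists>j. j < deg \<and> L j = shift t (L i)"
    using L_surj[OF shift_in_shifts[OF S L_in[OF assms(1)] assms(2)]] by metis
  then have "pos t i < deg \<and> L (pos t i) = shift t (L i)"
    unfolding pos_def by (rule someI_ex)
  then show "pos t i < deg" "L (pos t i) = shift t (L i)" by auto
qed

lemma pos_eqI: "i < deg \<Longrightarrow> j < deg \<Longrightarrow> t \<in> bitvecs n \<Longrightarrow> L j = shift t (L i) \<Longrightarrow> pos t i = j"
  using pos L_inj by metis

lemma pos_add:
  assumes "i < deg" "s \<in> bitvecs n" "t \<in> bitvecs n"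
  shows "pos t (pos s i) = pos (s + t) i"
  using assms pos[of i s] pos[of i "s + t"]
  by (intro pos_eqI) (simp_all add: shift_shift[OF L_subset])

lemma pos_zero: "i < deg \<Longrightarrow> pos (0\<^sub>v n) i = i"
  by (rule pos_eqI) (simp_all add: L_subset)

lemma pos_pos: "i < deg \<Longrightarrow> t \<in> bitvecs n \<Longrightarrow> pos t (pos t i) = i"
  by (simp add: pos_add bit_vec_add_self pos_zero)

lemma pos_trans:
  assumes "i < deg" "j < deg"
  obtains t where "t \<in> bitvecs n" "pos t i = j"
proof -
  obtain x y where xy: "x \<in> bitvecs n" "y \<in> bitvecs n" "L i = shift x S" "L j = shift y S"
    using L_in[OF assms(1)] L_in[OF assms(2)] unfolding shifts_def by blast
  then have "L j = shift (x + y) (L i)"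
    using shift_shift[OF S xy(1), of "x + y"] bit_vec_add_cancel(2)[OF xy(2,1)] by simp
  then have "pos (x + y) i = j" using pos_eqI[OF assms, of "x + y"] xy(1,2) by simp
  then show ?thesis by (rule that[rotated]) (use xy(1,2) in simp)
qed

lemma sigma_carrier [simp]: "sigma g \<in> carrier_mat deg deg"
  by (cases g) (simp add: sigma_def)

lemma sigma_dim: "dim_row (sigma g) = deg" "dim_col (sigma g) = deg"
  using carrier_matD[OF sigma_carrier[of g]] by simp_all

lemma sum_pos:
  assumes "i < deg" "t \<in> bitvecs n"
  shows "(\<Sum>j<deg. (if j = pos t i then c else 0) * h j) = c * (h (pos t i) :: complex)"
proof -
  have "(\<Sum>j<deg. (if j = pos t i then c else 0) * h j) = (\<Sum>j<deg. if j = pos t i then c * h j else 0)"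
    by (rule sum.cong) auto
  then show ?thesis using pos(1)[OF assms] by simp
qed

lemma sigma_mult_vec:
  assumes "i < deg" "t \<in> bitvecs n" "w \<in> carrier_vec deg"
  shows "(sigma (f, t) *\<^sub>v w) $ i = dotsgn a t * lam (L i) f * w $ pos t i"
  using assms sum_pos[OF assms(1,2), of "dotsgn a t * lam (L i) f" "\<lambda>j. w $ j"]
  by (simp add: sigma_def scalar_prod_def atLeast0LessThan)

lemma sigma_mult_mat:
  assumes "i < deg" "j < m" "t \<in> bitvecs n" "X \<in> carrier_mat deg m"
  shows "(sigma (f, t) * X) $$ (i, j) = dotsgn a t * lam (L i) f * X $$ (pos t i, j)"
  using assms sum_pos[OF assms(1,3), of "dotsgn a t * lam (L i) f" "\<lambda>k. X $$ (k, j)"]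
  by (simp add: sigma_def scalar_prod_def atLeast0LessThan)

lemma sigma_mult:
  assumes "t \<in> bitvecs n" "s \<in> bitvecs n"
  shows "sigma ((f, t) \<otimes>\<^bsub>wreath n\<^esub> (g, s)) = sigma (f, t) * sigma (g, s)"
proof (rule eq_matI)
  fix i j assume "i < dim_row (sigma (f, t) * sigma (g, s))" "j < dim_col (sigma (f, t) * sigma (g, s))"
  then have ij: "i < deg" "j < deg" by (simp_all add: sigma_dim)
  have "lam (L i) (transl n t g) = lam (L (pos t i)) g"
    using lam_transl[OF L_subset[OF ij(1)] assms(1)] pos[OF ij(1) assms(1)] by simp
  then have "lam (L i) (badd n f (transl n t g)) = lam (L i) f * lam (L (pos t i)) g"
    using lam_badd[OF L_subset[OF ij(1)]] by simp
  moreover have "dotsgn a (t + s) = dotsgn a t * dotsgn a s" by (rule dotsgn_add[OF a assms])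
  ultimately show "sigma ((f, t) \<otimes>\<^bsub>wreath n\<^esub> (g, s)) $$ (i, j) = (sigma (f, t) * sigma (g, s)) $$ (i, j)"
    unfolding sigma_mult_mat[OF ij assms(1) sigma_carrier]
    using ij pos(1)[OF ij(1) assms(1)] pos_add[OF ij(1) assms]
    by (simp add: sigma_def mult_wreath)
qed (simp_all add: sigma_dim)

lemma sigma_one: "sigma \<one>\<^bsub>wreath n\<^esub> = 1\<^sub>m deg"
  by (rule eq_matI) (auto simp: sigma_def one_wreath pos_zero L_subset a)

text \<open>Distinct translates give distinct characters of B, so averaging over B against
  \<open>lam (L j)\<close> cuts a nonzero vector of W down to a multiple of one unit vector. V
  permutes the translates transitively, hence yields all the others.\<close>

lemma sigma_irreducible: "irreducible_rep (wreath n) deg sigma"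
proof (rule irreducible_repI[OF group_wreath deg_pos])
  show "sigma (g \<otimes>\<^bsub>wreath n\<^esub> h) = sigma g * sigma h"
    if "g \<in> carrier (wreath n)" "h \<in> carrier (wreath n)" for g h
    using that sigma_mult by (auto simp: carrier_wreath)
  fix W assume W: "subspace_vec deg W"
    and inv: "\<And>g w. g \<in> carrier (wreath n) \<Longrightarrow> w \<in> W \<Longrightarrow> sigma g *\<^sub>v w \<in> W"
  have WV: "W \<subseteq> carrier_vec deg" using W unfolding subspace_vec_def by blast
  show "W = {0\<^sub>v deg} \<or> W = carrier_vec deg"
  proof (cases "W = {0\<^sub>v deg}")
    case False
    then obtain w where w: "w \<in> W" "w \<noteq> 0\<^sub>v deg" using W unfolding subspace_vec_def by blast
    have wV: "w \<in> carrier_vec deg" using w WV by blast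
    obtain j where j: "j < deg" "w $ j \<noteq> 0" using w(2) wV
      by (metis carrier_vecD eq_vecI index_zero_vec(1,2))
    define e where "e = lincomb_vec deg (bfuns n) (lam (L j)) (\<lambda>f. sigma (f, 0\<^sub>v n) *\<^sub>v w)"
    have "e \<in> W" unfolding e_def
      by (rule lincomb_vec_in_subspace[OF W finite_bfuns]) (auto intro!: inv w simp: carrier_wreath)
    define c where "c = of_nat (card (bfuns n)) * w $ j"
    have "bfuns n \<noteq> {}" using bzero_closed by blast
    then have c0: "c \<noteq> 0" unfolding c_def using j by simp
    have "e = c \<cdot>\<^sub>v unit_vec deg j"
    proof (rule eq_vecI)
      fix i assume "i < dim_vec (c \<cdot>\<^sub>v unit_vec deg j)"
      then have i: "i < deg" by simp
      have "e $ i = (\<Sum>f\<in>bfuns n. lam (L j) f * (lam (L i) f * w $ i))"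
        using i wV unfolding e_def lincomb_vec_def by (simp add: sigma_mult_vec pos_zero a)
      also have "\<dots> = (\<Sum>f\<in>bfuns n. lam (L j) f * lam (L i) f) * w $ i"
        unfolding sum_distrib_right by (simp add: mult.assoc)
      also have "\<dots> = (c \<cdot>\<^sub>v unit_vec deg j) $ i"
        using lam_orthogonal[OF L_subset[OF j(1)] L_subset[OF i]] i j L_inj[OF j(1) i]
        by (auto simp: c_def)
      finally show "e $ i = (c \<cdot>\<^sub>v unit_vec deg j) $ i" .
    qed (simp add: e_def lincomb_vec_def)
    then have "unit_vec deg j = (1 / c) \<cdot>\<^sub>v e" using c0 by (simp add: smult_smult_assoc)
    then have uj: "unit_vec deg j \<in> W" using W \<open>e \<in> W\<close> unfolding subspace_vec_def by simp
    have uk: "unit_vec deg k \<in> W" if k: "k < deg" for k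
    proof -
      obtain t where t: "t \<in> bitvecs n" "pos t k = j" by (rule pos_trans[OF k j(1)])
      have "sigma (bzero n, t) *\<^sub>v unit_vec deg j = dotsgn a t \<cdot>\<^sub>v unit_vec deg k"
      proof (rule eq_vecI)
        fix i assume "i < dim_vec (dotsgn a t \<cdot>\<^sub>v unit_vec deg k)"
        then have i: "i < deg" by simp
        have "pos t i = j \<longleftrightarrow> i = k" using t pos_pos[OF i t(1)] pos_pos[OF k t(1)] by metis
        then show "(sigma (bzero n, t) *\<^sub>v unit_vec deg j) $ i = (dotsgn a t \<cdot>\<^sub>v unit_vec deg k) $ i"
          using i j k pos(1)[OF i t(1)] by (auto simp: sigma_mult_vec[OF i t(1)] L_subset)
      qed (simp add: sigma_def)
      moreover have "sigma (bzero n, t) *\<^sub>v unit_vec deg j \<in> W"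
        by (rule inv[OF _ uj]) (simp add: carrier_wreath t)
      ultimately have "dotsgn a t \<cdot>\<^sub>v (dotsgn a t \<cdot>\<^sub>v unit_vec deg k) \<in> W"
        using W unfolding subspace_vec_def by simp
      then show ?thesis by (simp add: smult_smult_assoc)
    qed
    have "v \<in> W" if "v \<in> carrier_vec deg" for v
    proof -
      have "v = lincomb_vec deg {..<deg} (\<lambda>k. v $ k) (unit_vec deg)"
      proof (rule eq_vecI)
        fix i assume "i < dim_vec (lincomb_vec deg {..<deg} (\<lambda>k. v $ k) (unit_vec deg))"
        then have i: "i < deg" by (simp add: lincomb_vec_def)
        have "(\<Sum>k<deg. v $ k * unit_vec deg k $ i) = (\<Sum>k<deg. if k = i then v $ k else 0)"
          by (rule sum.cong) (use i in auto)
        then show "v $ i = lincomb_vec deg {..<deg} (\<lambda>k. v $ k) (unit_vec deg) $ i"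
          using i by (simp add: lincomb_vec_def)
      qed (use that in \<open>simp add: lincomb_vec_def\<close>)
      moreover have "lincomb_vec deg {..<deg} (\<lambda>k. v $ k) (unit_vec deg) \<in> W"
        by (rule lincomb_vec_in_subspace[OF W]) (use uk in auto)
      ultimately show ?thesis by metis
    qed
    then show ?thesis using WV by blast
  qed simp
qed (simp_all add: sigma_one)

lemma sigma_character: "rep_character (wreath n) deg sigma = chi n a S"
proof -
  have "(\<Sum>i<deg. sigma (f, t) $$ (i, i)) =
      (if shift t S = S then dotsgn a t * (\<Sum>Q\<in>shifts n S. lam Q f) else 0)"
    if t: "t \<in> bitvecs n" for f t
  proof -
    have p: "i = pos t i \<longleftrightarrow> shift t S = S" if i: "i < deg" for i
      using pos[OF i t] L_inj[OF pos(1)[OF i t] i] shift_fixes_shifts_iff[OF S L_in[OF i] t] by metis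
    have "(\<Sum>i<deg. lam (L i) f) = (\<Sum>Q\<in>shifts n S. lam Q f)"
      by (rule sum.reindex_bij_betw) (use bij_betw_nth[OF basis_sets(1) refl refl] basis_sets(2) deg_def in simp)
    moreover have "(\<Sum>i<deg. sigma (f, t) $$ (i, i)) =
        (\<Sum>i<deg. if shift t S = S then dotsgn a t * lam (L i) f else 0)"
      by (rule sum.cong) (use p in \<open>auto simp: sigma_def\<close>)
    ultimately show ?thesis by (simp flip: sum_distrib_left)
  qed
  then show ?thesis
    unfolding rep_character_def chi_def by (intro restrict_ext) (auto simp: carrier_wreath)
qed

end

lemma chi_in_Irr:
  assumes "a \<in> bitvecs n" "S \<subseteq> bitvecs n"
  shows "chi n a S \<in> Irr (wreath n)"
proof -
  interpret monomial_rep n a S by unfold_locales fact+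
  show ?thesis unfolding Irr_def using sigma_irreducible sigma_character by (metis (mono_tags, lifting) mem_Collect_eq)
qed

section \<open>Every irreducible representation has an induced character\<close>

locale wreath_rep =
  fixes n d \<rho>
  assumes irr: "irreducible_rep (wreath n) d \<rho>"
begin

lemmas rho = irreducible_repD[OF group_wreath irr]

lemma rho_carrier [simp]: "f \<in> bfuns n \<Longrightarrow> t \<in> bitvecs n \<Longrightarrow> \<rho> (f, t) \<in> carrier_mat d d"
  by (rule rho(2)) (simp add: carrier_wreath)

lemma rho_vec [simp]:
  "f \<in> bfuns n \<Longrightarrow> t \<in> bitvecs n \<Longrightarrow> w \<in> carrier_vec d \<Longrightarrow> \<rho> (f, t) *\<^sub>v w \<in> carrier_vec d"
  by (rule mult_mat_vec_carrier[OF rho_carrier])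

lemma rho_mult_vec:
  assumes "f \<in> bfuns n" "t \<in> bitvecs n" "g \<in> bfuns n" "s \<in> bitvecs n" "w \<in> carrier_vec d"
  shows "\<rho> (f, t) *\<^sub>v (\<rho> (g, s) *\<^sub>v w) = \<rho> (badd n f (transl n t g), t + s) *\<^sub>v w"
proof -
  have "\<rho> ((f, t) \<otimes>\<^bsub>wreath n\<^esub> (g, s)) = \<rho> (f, t) * \<rho> (g, s)"
    by (rule rho(3)) (use assms in \<open>simp_all add: carrier_wreath\<close>)
  then show ?thesis
    using assoc_mult_mat_vec[OF rho_carrier[OF assms(1,2)] rho_carrier[OF assms(3,4)] assms(5)]
    by (simp add: mult_wreath)
qed

lemma rho_one_vec: "w \<in> carrier_vec d \<Longrightarrow> \<rho> (bzero n, 0\<^sub>v n) *\<^sub>v w = w"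
  using rho(4) by (simp add: one_wreath)

text \<open>The averages \<open>p S\<close> of the first unit vector are eigenvectors of B or zero.
  They cannot all be zero, because their sum over all S is a nonzero multiple of that
  vector.\<close>

lemma exists_base_eigenvector:
  obtains S w where "S \<subseteq> bitvecs n" "w \<in> carrier_vec d" "w \<noteq> 0\<^sub>v d"
    "\<And>g. g \<in> bfuns n \<Longrightarrow> \<rho> (g, 0\<^sub>v n) *\<^sub>v w = lam S g \<cdot>\<^sub>v w"
proof -
  have d: "0 < d" by (rule rho(1))
  let ?e = "unit_vec d 0 :: complex vec"
  define x where "x f = \<rho> (f, 0\<^sub>v n) *\<^sub>v ?e" for f
  have x: "x f \<in> carrier_vec d" if "f \<in> bfuns n" for f unfolding x_def using that by simp
  define p where "p S = lincomb_vec d (bfuns n) (lam S) x" for S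
  have eig: "\<rho> (g, 0\<^sub>v n) *\<^sub>v p S = lam S g \<cdot>\<^sub>v p S" if S: "S \<subseteq> bitvecs n" and g: "g \<in> bfuns n" for S g
  proof -
    have "\<rho> (g, 0\<^sub>v n) *\<^sub>v p S = lincomb_vec d (bfuns n) (lam S) (\<lambda>f. \<rho> (g, 0\<^sub>v n) *\<^sub>v x f)"
      unfolding p_def by (rule mult_mat_vec_lincomb_vec[OF rho_carrier]) (use g x in auto)
    also have "\<dots> = lincomb_vec d (bfuns n) (lam S) (\<lambda>f. x (badd n g f))"
      unfolding lincomb_vec_def x_def
      by (intro eq_vecI) (use g in \<open>auto intro!: sum.cong simp: rho_mult_vec\<close>)
    also have "\<dots> = lam S g \<cdot>\<^sub>v p S"
    proof (rule eq_vecI)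
      fix i assume "i < dim_vec (lam S g \<cdot>\<^sub>v p S)"
      then have i: "i < d" by (simp add: p_def lincomb_vec_def)
      have "(\<Sum>f\<in>bfuns n. lam S f * x (badd n g f) $ i) = (\<Sum>f\<in>bfuns n. lam S (badd n g f) * x f $ i)"
        by (rule sum.reindex_bij_witness[of _ "badd n g" "badd n g"]) auto
      also have "\<dots> = lam S g * (\<Sum>f\<in>bfuns n. lam S f * x f $ i)"
        unfolding sum_distrib_left by (rule sum.cong) (simp_all add: lam_badd[OF S] mult.assoc)
      finally show "lincomb_vec d (bfuns n) (lam S) (\<lambda>f. x (badd n g f)) $ i = (lam S g \<cdot>\<^sub>v p S) $ i"
        using i by (simp add: p_def lincomb_vec_def)
    qed (simp add: p_def lincomb_vec_def)
    finally show ?thesis .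
  qed
  have "\<exists>S \<in> Pow (bitvecs n). p S \<noteq> 0\<^sub>v d"
  proof (rule ccontr)
    assume "\<not> ?thesis"
    then have z: "p S $ 0 = 0" if "S \<in> Pow (bitvecs n)" for S using that d by auto
    have "(\<Sum>S\<in>Pow (bitvecs n). p S $ 0) = (\<Sum>S\<in>Pow (bitvecs n). \<Sum>f\<in>bfuns n. lam S f * x f $ 0)"
      using d by (simp add: p_def lincomb_vec_def)
    also have "\<dots> = (\<Sum>f\<in>bfuns n. (\<Sum>S\<in>Pow (bitvecs n). lam S f) * x f $ 0)"
      unfolding sum_distrib_right by (rule sum.swap)
    also have "\<dots> = (\<Sum>f\<in>bfuns n. if f = bzero n then of_nat (card (Pow (bitvecs n))) * x f $ 0 else 0)"
      by (rule sum.cong) (simp_all add: sum_lam_Pow del: card_Pow)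
    also have "\<dots> = of_nat (card (Pow (bitvecs n))) * x (bzero n) $ 0" by (simp del: card_Pow)
    also have "x (bzero n) = ?e" unfolding x_def by (rule rho_one_vec) simp
    finally show False using z d by (simp add: card_Pow)
  qed
  then obtain S where "S \<subseteq> bitvecs n" "p S \<noteq> 0\<^sub>v d" by blast
  then show ?thesis using that[of S "p S"] eig by (simp add: p_def)
qed

text \<open>The same averaging is repeated inside the eigenspace of \<open>lam S\<close>, now over
  the stabilizer T of S.\<close>

lemma exists_joint_eigenvector:
  obtains S a v where "S \<subseteq> bitvecs n" "a \<in> bitvecs n" "v \<in> carrier_vec d" "v \<noteq> 0\<^sub>v d"
    "\<And>g. g \<in> bfuns n \<Longrightarrow> \<rho> (g, 0\<^sub>v n) *\<^sub>v v = lam S g \<cdot>\<^sub>v v"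
    "\<And>t. t \<in> bitvecs n \<Longrightarrow> shift t S = S \<Longrightarrow> \<rho> (bzero n, t) *\<^sub>v v = dotsgn a t \<cdot>\<^sub>v v"
proof -
  obtain S w where S: "S \<subseteq> bitvecs n" and w: "w \<in> carrier_vec d" "w \<noteq> 0\<^sub>v d"
    and base: "\<And>g. g \<in> bfuns n \<Longrightarrow> \<rho> (g, 0\<^sub>v n) *\<^sub>v w = lam S g \<cdot>\<^sub>v w"
    using exists_base_eigenvector by metis
  define T where "T = {t \<in> bitvecs n. shift t S = S}"
  have TV: "T \<subseteq> bitvecs n" unfolding T_def by blast
  have finT: "finite T" by (rule finite_subset[OF TV]) simp
  have Tadd: "s + t \<in> T" if "s \<in> T" "t \<in> T" for s t
    using that shift_shift[OF S, of s t] unfolding T_def by auto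
  have T0: "0\<^sub>v n \<in> T" unfolding T_def using S by simp
  define x where "x t = \<rho> (bzero n, t) *\<^sub>v w" for t
  have x: "x t \<in> carrier_vec d" if "t \<in> bitvecs n" for t unfolding x_def using that w by simp
  have xT: "x t \<in> carrier_vec d" if "t \<in> T" for t using x TV that by blast
  define p where "p a = lincomb_vec d T (dotsgn a) x" for a
  \<comment> \<open>T preserves the eigenspace: moving g past t replaces it by its translate, on
    which \<open>lam S\<close> has the same value as t fixes S.\<close>
  have baseT: "\<rho> (g, 0\<^sub>v n) *\<^sub>v x t = lam S g \<cdot>\<^sub>v x t" if g: "g \<in> bfuns n" and t: "t \<in> T" for g t
  proof -
    have tV: "t \<in> bitvecs n" and ts: "shift t S = S" using t unfolding T_def by auto
    have "\<rho> (g, 0\<^sub>v n) *\<^sub>v x t = \<rho> (g, t) *\<^sub>v w"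
      unfolding x_def using g tV w by (simp add: rho_mult_vec)
    also have "\<dots> = \<rho> (bzero n, t) *\<^sub>v (\<rho> (transl n t g, 0\<^sub>v n) *\<^sub>v w)"
      using rho_mult_vec[OF bzero_closed tV transl_closed[of n t g] zero_carrier_vec w(1)] tV g
      by (simp add: transl_transl bit_vec_add_self)
    also have "\<dots> = lam S (transl n t g) \<cdot>\<^sub>v x t"
      unfolding base[OF transl_closed] x_def by (rule mult_mat_vec[OF rho_carrier[OF bzero_closed tV] w(1)])
    also have "lam S (transl n t g) = lam S g" using lam_transl[OF S tV] ts by simp
    finally show ?thesis .
  qed
  have eigB: "\<rho> (g, 0\<^sub>v n) *\<^sub>v p a = lam S g \<cdot>\<^sub>v p a" if g: "g \<in> bfuns n" for g a
  proof -
    have "\<rho> (g, 0\<^sub>v n) *\<^sub>v p a = lincomb_vec d T (dotsgn a) (\<lambda>t. \<rho> (g, 0\<^sub>v n) *\<^sub>v x t)"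
      unfolding p_def by (rule mult_mat_vec_lincomb_vec[OF rho_carrier]) (use g xT in auto)
    also have "\<dots> = lam S g \<cdot>\<^sub>v p a"
    proof (rule eq_vecI)
      fix i assume "i < dim_vec (lam S g \<cdot>\<^sub>v p a)"
      then have i: "i < d" by (simp add: p_def lincomb_vec_def)
      have "(\<Sum>t\<in>T. dotsgn a t * (\<rho> (g, 0\<^sub>v n) *\<^sub>v x t) $ i) = (\<Sum>t\<in>T. lam S g * (dotsgn a t * x t $ i))"
      proof (rule sum.cong[OF refl])
        fix t assume t: "t \<in> T"
        then show "dotsgn a t * (\<rho> (g, 0\<^sub>v n) *\<^sub>v x t) $ i = lam S g * (dotsgn a t * x t $ i)"
          unfolding baseT[OF g t] using i xT[OF t] by simp
      qed
      then show "lincomb_vec d T (dotsgn a) (\<lambda>t. \<rho> (g, 0\<^sub>v n) *\<^sub>v x t) $ i = (lam S g \<cdot>\<^sub>v p a) $ i"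
        using i by (simp add: p_def lincomb_vec_def sum_distrib_left)
    qed (simp add: p_def lincomb_vec_def)
    finally show ?thesis .
  qed
  have eigT: "\<rho> (bzero n, s) *\<^sub>v p a = dotsgn a s \<cdot>\<^sub>v p a" if s: "s \<in> T" and a: "a \<in> bitvecs n" for s a
  proof -
    have sV: "s \<in> bitvecs n" using s TV by blast
    have ss: "s + (s + t) = t" if "t \<in> T" for t
      using bit_vec_add_cancel(2)[of t n s] that TV sV by blast
    have xs: "\<rho> (bzero n, s) *\<^sub>v x t = x (s + t)" if "t \<in> T" for t
      unfolding x_def using that TV sV w by (auto simp: rho_mult_vec)
    have "\<rho> (bzero n, s) *\<^sub>v p a = lincomb_vec d T (dotsgn a) (\<lambda>t. \<rho> (bzero n, s) *\<^sub>v x t)"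
      unfolding p_def by (rule mult_mat_vec_lincomb_vec[OF rho_carrier]) (use sV xT in auto)
    also have "\<dots> = dotsgn a s \<cdot>\<^sub>v p a"
    proof (rule eq_vecI)
      fix i assume "i < dim_vec (dotsgn a s \<cdot>\<^sub>v p a)"
      then have i: "i < d" by (simp add: p_def lincomb_vec_def)
      have "(\<Sum>t\<in>T. dotsgn a t * (\<rho> (bzero n, s) *\<^sub>v x t) $ i) = (\<Sum>t\<in>T. dotsgn a t * x (s + t) $ i)"
        by (rule sum.cong) (simp_all add: xs)
      also have "\<dots> = (\<Sum>t\<in>T. dotsgn a (s + t) * x t $ i)"
        by (rule sum.reindex_bij_witness[of _ "\<lambda>t. s + t" "\<lambda>t. s + t"])
          (use Tadd s ss in auto)
      also have "\<dots> = dotsgn a s * (\<Sum>t\<in>T. dotsgn a t * x t $ i)"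
        unfolding sum_distrib_left
      proof (rule sum.cong[OF refl])
        fix t assume "t \<in> T"
        then have "t \<in> bitvecs n" using TV by blast
        then show "dotsgn a (s + t) * x t $ i = dotsgn a s * (dotsgn a t * x t $ i)"
          by (simp add: dotsgn_add[OF a sV])
      qed
      finally show "lincomb_vec d T (dotsgn a) (\<lambda>t. \<rho> (bzero n, s) *\<^sub>v x t) $ i = (dotsgn a s \<cdot>\<^sub>v p a) $ i"
        using i by (simp add: p_def lincomb_vec_def)
    qed (simp add: p_def lincomb_vec_def)
    finally show ?thesis .
  qed
  obtain i where i: "i < d" "w $ i \<noteq> 0" using w by (metis carrier_vecD eq_vecI index_zero_vec(1,2))
  have "\<exists>a \<in> bitvecs n. p a \<noteq> 0\<^sub>v d"
  proof (rule ccontr)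
    assume "\<not> ?thesis"
    then have z: "p a $ i = 0" if "a \<in> bitvecs n" for a using that i by auto
    \<comment> \<open>Summing over all a in V, rather than over the characters of T, still isolates
      the term t = 0 and returns a multiple of w.\<close>
    have "(\<Sum>a\<in>bitvecs n. p a $ i) = (\<Sum>a\<in>bitvecs n. \<Sum>t\<in>T. dotsgn a t * x t $ i)"
      using i by (simp add: p_def lincomb_vec_def)
    also have "\<dots> = (\<Sum>t\<in>T. (\<Sum>a\<in>bitvecs n. dotsgn a t) * x t $ i)"
      unfolding sum_distrib_right by (rule sum.swap)
    also have "\<dots> = (\<Sum>t\<in>T. if t = 0\<^sub>v n then of_nat (card (bitvecs n)) * x t $ i else 0)"
      by (rule sum.cong) (use TV in \<open>auto simp: sum_dotsgn\<close>)
    also have "\<dots> = of_nat (card (bitvecs n)) * x (0\<^sub>v n) $ i" using T0 finT by simp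
    also have "x (0\<^sub>v n) = w" unfolding x_def by (rule rho_one_vec[OF w(1)])
    finally show False using z i by (simp add: card_bit_vec)
  qed
  then obtain a where "a \<in> bitvecs n" "p a \<noteq> 0\<^sub>v d" by blast
  then show ?thesis
    using that[of S a "p a"] S eigB eigT unfolding T_def by (simp add: p_def)
qed

end

text \<open>The images of the joint eigenvector v under V provide a map from the monomial
  representation to \<rho>. It is enough that this map is not zero, since both representations are
  irreducible.\<close>

locale wreath_eigenvector = monomial_rep n a S + wreath_rep n d \<rho> for n a S d \<rho> +
  fixes v
  assumes v: "v \<in> carrier_vec d" "v \<noteq> 0\<^sub>v d"
    and base: "\<And>f. f \<in> bfuns n \<Longrightarrow> \<rho> (f, 0\<^sub>v n) *\<^sub>v v = lam S f \<cdot>\<^sub>v v"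
    and stab: "\<And>t. t \<in> bitvecs n \<Longrightarrow> shift t S = S \<Longrightarrow> \<rho> (bzero n, t) *\<^sub>v v = dotsgn a t \<cdot>\<^sub>v v"
begin

text \<open>The factor \<open>dotsgn a y\<close> cancels the eigenvalue of v under the stabilizer,
  so the vector depends on y only through the translate \<open>shift y S\<close>.\<close>

definition "translate y = dotsgn a y \<cdot>\<^sub>v (\<rho> (bzero n, y) *\<^sub>v v)"

lemma translate_carrier [simp]: "y \<in> bitvecs n \<Longrightarrow> translate y \<in> carrier_vec d"
  unfolding translate_def using mult_mat_vec_carrier[OF rho_carrier[OF bzero_closed] v(1)] by simp

lemma translate_cong:
  assumes "y \<in> bitvecs n" "z \<in> bitvecs n" "shift y S = shift z S"
  shows "translate y = translate z"
proof -
  define u where "u = y + z"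
  have u: "u \<in> bitvecs n" using assms unfolding u_def by simp
  have z: "z = y + u" unfolding u_def using bit_vec_add_cancel(2)[OF assms(2,1)] by simp
  have "shift u S = shift z (shift y S)"
    unfolding u_def by (rule shift_shift[OF S assms(1,2), symmetric])
  then have su: "shift u S = S" unfolding assms(3) using shift_self[OF S assms(2)] by simp
  have "\<rho> (bzero n, z) *\<^sub>v v = \<rho> (bzero n, y) *\<^sub>v (\<rho> (bzero n, u) *\<^sub>v v)"
    using rho_mult_vec[OF bzero_closed assms(1) bzero_closed u v(1)] assms(1) z by simp
  also have "\<dots> = dotsgn a u \<cdot>\<^sub>v (\<rho> (bzero n, y) *\<^sub>v v)"
    unfolding stab[OF u su] by (rule mult_mat_vec[OF rho_carrier[OF bzero_closed assms(1)] v(1)])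
  finally have "translate z = (dotsgn a z * dotsgn a u) \<cdot>\<^sub>v (\<rho> (bzero n, y) *\<^sub>v v)"
    unfolding translate_def by (simp add: smult_smult_assoc)
  moreover have "dotsgn a z * dotsgn a u = dotsgn a y"
    unfolding z dotsgn_add[OF a assms(1) u] by (simp add: mult.assoc)
  ultimately show ?thesis unfolding translate_def by simp
qed

lemma rho_translate:
  assumes f: "f \<in> bfuns n" and t: "t \<in> bitvecs n" and y: "y \<in> bitvecs n"
  shows "\<rho> (f, t) *\<^sub>v translate y = (dotsgn a t * lam (shift (y + t) S) f) \<cdot>\<^sub>v translate (y + t)"
proof -
  define z where "z = y + t"
  have z: "z \<in> bitvecs n" "t + y = z" unfolding z_def using t y comm_add_vec[of t n y] by auto
  have cz: "\<rho> (bzero n, z) *\<^sub>v v \<in> carrier_vec d"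
    by (rule mult_mat_vec_carrier[OF rho_carrier[OF bzero_closed z(1)] v(1)])
  have "\<rho> (f, t) *\<^sub>v (\<rho> (bzero n, y) *\<^sub>v v) = \<rho> (f, z) *\<^sub>v v"
    using rho_mult_vec[OF f t bzero_closed y v(1)] f t z(2) by simp
  also have "\<dots> = \<rho> (bzero n, z) *\<^sub>v (\<rho> (transl n z f, 0\<^sub>v n) *\<^sub>v v)"
    using rho_mult_vec[OF bzero_closed z(1) transl_closed[of n z f] zero_carrier_vec v(1)] z(1) f
    by (simp add: transl_transl bit_vec_add_self)
  also have "\<dots> = lam S (transl n z f) \<cdot>\<^sub>v (\<rho> (bzero n, z) *\<^sub>v v)"
    unfolding base[OF transl_closed] by (rule mult_mat_vec[OF rho_carrier[OF bzero_closed z(1)] v(1)])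
  also have "lam S (transl n z f) = lam (shift z S) f" by (rule lam_transl[OF S z(1)])
  finally have e: "\<rho> (f, t) *\<^sub>v (\<rho> (bzero n, y) *\<^sub>v v) = lam (shift z S) f \<cdot>\<^sub>v (\<rho> (bzero n, z) *\<^sub>v v)" .
  have "\<rho> (f, t) *\<^sub>v translate y = dotsgn a y \<cdot>\<^sub>v (\<rho> (f, t) *\<^sub>v (\<rho> (bzero n, y) *\<^sub>v v))"
    unfolding translate_def
    by (rule mult_mat_vec[OF rho_carrier[OF f t] mult_mat_vec_carrier[OF rho_carrier[OF bzero_closed y] v(1)]])
  also have "\<dots> = (dotsgn a y * lam (shift z S) f) \<cdot>\<^sub>v (\<rho> (bzero n, z) *\<^sub>v v)"
    unfolding e by (simp add: smult_smult_assoc)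
  also have "dotsgn a y * lam (shift z S) f = (dotsgn a t * lam (shift z S) f) * dotsgn a z"
    unfolding z_def dotsgn_add[OF a y t] by (simp add: algebra_simps)
  finally show ?thesis unfolding translate_def z_def[symmetric] by (simp add: smult_smult_assoc)
qed

definition "rep_shift j = (SOME x. x \<in> bitvecs n \<and> shift x S = L j)"

lemma rep_shift:
  assumes "j < deg"
  shows "rep_shift j \<in> bitvecs n" "shift (rep_shift j) S = L j"
proof -
  have "\<exists>x. x \<in> bitvecs n \<and> shift x S = L j" using L_in[OF assms] unfolding shifts_def by auto
  then have "rep_shift j \<in> bitvecs n \<and> shift (rep_shift j) S = L j"
    unfolding rep_shift_def by (rule someI_ex)
  then show "rep_shift j \<in> bitvecs n" "shift (rep_shift j) S = L j" by auto
qed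

definition "intertwiner = mat d deg (\<lambda>(i, j). translate (rep_shift j) $ i)"

lemma intertwiner_carrier: "intertwiner \<in> carrier_mat d deg"
  by (simp add: intertwiner_def)

lemma col_intertwiner: "j < deg \<Longrightarrow> col intertwiner j = translate (rep_shift j)"
  using carrier_vecD[OF translate_carrier[OF rep_shift(1)]] unfolding intertwiner_def by (intro eq_vecI) simp_all

lemma intertwiner_nonzero: "intertwiner \<noteq> 0\<^sub>m d deg"
proof
  assume z: "intertwiner = 0\<^sub>m d deg"
  obtain j where j: "j < deg" "L j = S" using L_surj[OF self_in_shifts[OF S]] .
  have "translate (rep_shift j) = translate (0\<^sub>v n)"
    by (rule translate_cong) (use rep_shift[OF j(1)] j(2) S in simp_all)
  also have "\<dots> = v"
    unfolding translate_def using a rho(4) v(1) by (simp add: one_wreath)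
  finally have "col intertwiner j = v" using col_intertwiner[OF j(1)] by simp
  then show False using v z j(1) by simp
qed

lemma intertwiner:
  assumes f: "f \<in> bfuns n" and t: "t \<in> bitvecs n"
  shows "\<rho> (f, t) * intertwiner = intertwiner * sigma (f, t)"
proof (rule eq_matI)
  fix i j assume "i < dim_row (intertwiner * sigma (f, t))" "j < dim_col (intertwiner * sigma (f, t))"
  then have ij: "i < d" "j < deg" using intertwiner_carrier sigma_carrier[of "(f, t)"] by auto
  define k where "k = pos t j"
  have k: "k < deg" "L k = shift t (L j)" unfolding k_def using pos[OF ij(2) t] by auto
  note rj = rep_shift[OF ij(2)]
  have sk: "shift (rep_shift j + t) S = L k"
    using shift_shift[OF S rj(1) t] rj(2) k(2) by simp
  have bk: "translate (rep_shift j + t) = translate (rep_shift k)"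
    by (rule translate_cong) (use sk rep_shift[OF k(1)] rj t in simp_all)
  have "(\<rho> (f, t) * intertwiner) $$ (i, j) = (\<rho> (f, t) *\<^sub>v col intertwiner j) $ i"
    using ij rho_carrier[OF f t] intertwiner_carrier by auto
  also have "\<dots> = dotsgn a t * lam (L k) f * translate (rep_shift k) $ i"
    using rho_translate[OF f t rj(1)] ij translate_carrier[OF rep_shift(1)[OF k(1)]]
    by (simp add: col_intertwiner sk bk)
  also have "\<dots> = (\<Sum>l<deg. translate (rep_shift l) $ i * (if j = pos t l then dotsgn a t * lam (L l) f else 0))"
  proof -
    have p: "j = pos t l \<longleftrightarrow> l = k" if "l < deg" for l
      unfolding k_def using pos_pos[OF that t] pos_pos[OF ij(2) t] by metis
    have "(\<Sum>l<deg. translate (rep_shift l) $ i * (if j = pos t l then dotsgn a t * lam (L l) f else 0)) =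
        (\<Sum>l<deg. if l = k then translate (rep_shift l) $ i * (dotsgn a t * lam (L l) f) else 0)"
      by (rule sum.cong) (use p in auto)
    then show ?thesis using k(1) by (simp add: algebra_simps)
  qed
  also have "\<dots> = (intertwiner * sigma (f, t)) $$ (i, j)"
    using ij by (simp add: intertwiner_def sigma_def scalar_prod_def atLeast0LessThan)
  finally show "(\<rho> (f, t) * intertwiner) $$ (i, j) = (intertwiner * sigma (f, t)) $$ (i, j)" .
qed (use carrier_matD[OF rho_carrier[OF f t]] carrier_matD[OF intertwiner_carrier] in \<open>simp_all add: sigma_dim\<close>)

lemma character: "rep_character (wreath n) d \<rho> = chi n a S"
proof -
  have "rep_character (wreath n) d \<rho> = rep_character (wreath n) deg sigma"
    by (rule intertwiner_imp_character_eq[OF group_wreath irr sigma_irreducible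
          intertwiner_carrier intertwiner_nonzero])
      (use intertwiner in \<open>auto simp: carrier_wreath\<close>)
  then show ?thesis using sigma_character by simp
qed

end

lemma (in wreath_rep) character_eq_chi:
  obtains a S where "a \<in> bitvecs n" "S \<subseteq> bitvecs n" "rep_character (wreath n) d \<rho> = chi n a S"
proof -
  obtain S a v where S: "S \<subseteq> bitvecs n" and a: "a \<in> bitvecs n" and v: "v \<in> carrier_vec d" "v \<noteq> 0\<^sub>v d"
    "\<And>g. g \<in> bfuns n \<Longrightarrow> \<rho> (g, 0\<^sub>v n) *\<^sub>v v = lam S g \<cdot>\<^sub>v v"
    "\<And>t. t \<in> bitvecs n \<Longrightarrow> shift t S = S \<Longrightarrow> \<rho> (bzero n, t) *\<^sub>v v = dotsgn a t \<cdot>\<^sub>v v"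
    using exists_joint_eigenvector by blast
  interpret wreath_eigenvector n a S d \<rho> v
    by unfold_locales (use S a v irr in auto)
  show ?thesis by (rule that[OF a S character])
qed

text \<open>The parameters are not unique: translating S, or changing a without changing
  \<open>dotsgn a\<close> on the stabilizer of S, gives the same character. Uniqueness is settled
  for stable S in \<open>inj_chi_stable\<close>.\<close>

theorem Irr_wreath:
  "Irr (wreath n) = {chi n a S | a S. a \<in> bitvecs n \<and> S \<subseteq> bitvecs n}"
proof
  show "{chi n a S | a S. a \<in> bitvecs n \<and> S \<subseteq> bitvecs n} \<subseteq> Irr (wreath n)"
    using chi_in_Irr by blast
  show "Irr (wreath n) \<subseteq> {chi n a S | a S. a \<in> bitvecs n \<and> S \<subseteq> bitvecs n}"
  proof
    fix \<chi> assume "\<chi> \<in> Irr (wreath n)"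
    then obtain d \<rho> where \<chi>: "\<chi> = rep_character (wreath n) d \<rho>" "irreducible_rep (wreath n) d \<rho>"
      unfolding Irr_def by blast
    then interpret wreath_rep n d \<rho> by unfold_locales
    obtain a S where "a \<in> bitvecs n" "S \<subseteq> bitvecs n" "\<chi> = chi n a S"
      using character_eq_chi \<chi>(1) by metis
    then show "\<chi> \<in> {chi n a S | a S. a \<in> bitvecs n \<and> S \<subseteq> bitvecs n}" by blast
  qed
qed

section \<open>Invariant characters and balanced actions\<close>

text \<open>Applied to |A|, this makes a plain sum over A an average over A in characteristic
  2.\<close>

lemma of_nat_odd_bit: "odd k \<Longrightarrow> (of_nat k :: bit) = 1"
  by (auto elim!: oddE)

lemma shift_eq_iff:
  assumes "S \<subseteq> bitvecs n" "y \<in> bitvecs n" "z \<in> bitvecs n"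
  shows "shift y S = shift z S \<longleftrightarrow> shift (y + z) S = S"
proof -
  have "shift (y + z) S = shift z (shift y S)" by (rule shift_shift[OF assms, symmetric])
  then show ?thesis
    using shift_self[OF assms(1,3)] shift_self[OF shift_subset[OF assms(1,2)] assms(3)] by metis
qed

lemma shifts_shift:
  assumes "S \<subseteq> bitvecs n" "x \<in> bitvecs n"
  shows "shifts n (shift x S) = shifts n S"
proof
  show "shifts n (shift x S) \<subseteq> shifts n S"
    using shift_shift[OF assms] assms(2) unfolding shifts_def by auto
  show "shifts n S \<subseteq> shifts n (shift x S)"
  proof
    fix Q assume "Q \<in> shifts n S"
    then obtain t where t: "t \<in> bitvecs n" "Q = shift t S" unfolding shifts_def by blast
    have "shift (x + t) (shift x S) = shift t S"
      using shift_shift[OF assms, of "x + t"] bit_vec_add_cancel(2)[OF t(1) assms(2)] assms(2) t(1) by simp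
    then show "Q \<in> shifts n (shift x S)" unfolding shifts_def t(2) using assms(2) t(1)
      by (intro image_eqI[of _ _ "x + t"]) simp_all
  qed
qed

lemma chi_shift:
  assumes "S \<subseteq> bitvecs n" "x \<in> bitvecs n"
  shows "chi n a (shift x S) = chi n a S"
proof -
  have "shift x S \<in> shifts n S" unfolding shifts_def using assms(2) by blast
  then have "shift t (shift x S) = shift x S \<longleftrightarrow> shift t S = S" if "t \<in> bitvecs n" for t
    using shift_fixes_shifts_iff[OF assms(1)] that by blast
  then show ?thesis
    unfolding chi_def shifts_shift[OF assms] by (intro restrict_ext) (auto simp: carrier_wreath)
qed

lemma chi_base:
  assumes "S \<subseteq> bitvecs n" "a \<in> bitvecs n" "f \<in> bfuns n"
  shows "chi n a S (f, 0\<^sub>v n) = (\<Sum>Q\<in>shifts n S. lam Q f)"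
  using assms by (simp add: chi_def carrier_wreath)

text \<open>Linear independence of the characters of B: orthogonality reads off whether R occurs in
  the sum. Thus a character restricted to B determines the whole set of translates of S.\<close>

lemma sum_lam_determines:
  assumes "X \<subseteq> Pow (bitvecs n)" "Y \<subseteq> Pow (bitvecs n)"
    and eq: "\<And>f. f \<in> bfuns n \<Longrightarrow> (\<Sum>Q\<in>X. lam Q f) = (\<Sum>Q\<in>Y. lam Q f)"
  shows "X = Y"
proof -
  have coeff: "(\<Sum>f\<in>bfuns n. lam R f * (\<Sum>Q\<in>Z. lam Q f)) = (if R \<in> Z then of_nat (card (bfuns n)) else 0)"
    if Z: "Z \<subseteq> Pow (bitvecs n)" and R: "R \<subseteq> bitvecs n" for R Z
  proof -
    have fin: "finite Z" by (rule finite_subset[OF Z]) simp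
    have "(\<Sum>f\<in>bfuns n. lam R f * (\<Sum>Q\<in>Z. lam Q f)) = (\<Sum>Q\<in>Z. \<Sum>f\<in>bfuns n. lam R f * lam Q f)"
      unfolding sum_distrib_left by (rule sum.swap)
    also have "\<dots> = (\<Sum>Q\<in>Z. if R = Q then of_nat (card (bfuns n)) else 0)"
    proof (rule sum.cong[OF refl])
      fix Q assume "Q \<in> Z"
      then have "Q \<subseteq> bitvecs n" using Z by blast
      then show "(\<Sum>f\<in>bfuns n. lam R f * lam Q f) = (if R = Q then of_nat (card (bfuns n)) else 0)"
        by (rule lam_orthogonal[OF R])
    qed
    finally show ?thesis using fin by simp
  qed
  have "bfuns n \<noteq> {}" using bzero_closed by blast
  then have c0: "(of_nat (card (bfuns n)) :: complex) \<noteq> 0" by simp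
  have "R \<in> X \<longleftrightarrow> R \<in> Y" if "R \<subseteq> bitvecs n" for R
  proof -
    have "(\<Sum>f\<in>bfuns n. lam R f * (\<Sum>Q\<in>X. lam Q f)) = (\<Sum>f\<in>bfuns n. lam R f * (\<Sum>Q\<in>Y. lam Q f))"
      by (rule sum.cong) (simp_all add: eq)
    then show ?thesis unfolding coeff[OF assms(1) that] coeff[OF assms(2) that] using c0
      by (auto split: if_splits)
  qed
  then show ?thesis using assms(1,2) by blast
qed

text \<open>Each translate is attained on a coset of the stabilizer. The sum over V on the left is
  the form in which halves of V can be counted.\<close>

lemma sum_over_shifts:
  fixes h :: "bit vec set \<Rightarrow> complex"
  assumes "S \<subseteq> bitvecs n"
  shows "(\<Sum>x\<in>bitvecs n. h (shift x S)) = of_nat (card {t \<in> bitvecs n. shift t S = S}) * (\<Sum>Q\<in>shifts n S. h Q)"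
proof -
  have fiber: "card {x \<in> bitvecs n. shift x S = Q} = card {t \<in> bitvecs n. shift t S = S}"
    if Q: "Q \<in> shifts n S" for Q
  proof -
    obtain y where y: "y \<in> bitvecs n" "Q = shift y S" using Q unfolding shifts_def by blast
    have "bij_betw (\<lambda>t. y + t) {t \<in> bitvecs n. shift t S = S} {x \<in> bitvecs n. shift x S = Q}"
    proof (rule bij_betw_byWitness[where f' = "\<lambda>t. y + t"])
      show "\<forall>t\<in>{t \<in> bitvecs n. shift t S = S}. y + (y + t) = t"
        using bit_vec_add_cancel(2)[OF _ y(1)] by blast
      show "\<forall>x\<in>{x \<in> bitvecs n. shift x S = Q}. y + (y + x) = x"
        using bit_vec_add_cancel(2)[OF _ y(1)] by blast
      show "(\<lambda>t. y + t) ` {t \<in> bitvecs n. shift t S = S} \<subseteq> {x \<in> bitvecs n. shift x S = Q}"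
      proof (rule image_subsetI)
        fix t assume "t \<in> {t \<in> bitvecs n. shift t S = S}"
        then have t: "t \<in> bitvecs n" "shift t S = S" by auto
        have "shift (y + t) S = shift t (shift y S)" by (rule shift_shift[OF assms y(1) t(1), symmetric])
        also have "\<dots> = shift y (shift t S)" by (rule shift_shift_commute[OF assms y(1) t(1)])
        finally show "y + t \<in> {x \<in> bitvecs n. shift x S = Q}" using t y by simp
      qed
      show "(\<lambda>t. y + t) ` {x \<in> bitvecs n. shift x S = Q} \<subseteq> {t \<in> bitvecs n. shift t S = S}"
        using shift_eq_iff[OF assms y(1)] y by auto
    qed
    then show ?thesis by (simp add: bij_betw_same_card)
  qed
  have "(\<Sum>x\<in>bitvecs n. h (shift x S)) =
      (\<Sum>Q\<in>shifts n S. \<Sum>x\<in>{x \<in> bitvecs n. shift x S = Q}. h (shift x S))"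
    by (rule sum.group[symmetric]) (auto simp: shifts_def)
  also have "\<dots> = (\<Sum>Q\<in>shifts n S. of_nat (card {t \<in> bitvecs n. shift t S = S}) * h Q)"
    by (rule sum.cong) (simp_all add: fiber)
  finally show ?thesis by (simp add: sum_distrib_left)
qed

lemma card_sum_signs_eq_zero_iff:
  assumes "finite X" "U \<subseteq> X"
  shows "(\<Sum>x\<in>X. if x \<in> U then - 1 else 1 :: complex) = 0 \<longleftrightarrow> 2 * card U = card X"
proof -
  have "(\<Sum>x\<in>X. if x \<in> U then - 1 else 1 :: complex) = of_nat (card (X - U)) - of_nat (card U)"
    using assms by (simp add: sum.If_cases Int_absorb1 Diff_eq finite_subset)
  also have "\<dots> = 0 \<longleftrightarrow> card (X - U) = card U" by simp
  also have "\<dots> \<longleftrightarrow> 2 * card U = card X"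
    using assms card_mono[OF assms] finite_subset[OF assms(2,1)] by (auto simp: card_Diff_subset)
  finally show ?thesis .
qed

lemma order_abelianization_comm_group:
  assumes "comm_group H"
  shows "Coset.order (abelianization H) = Coset.order H"
proof -
  interpret comm_group H by (rule assms)
  have "derived H (carrier H) = {\<one>\<^bsub>H\<^esub>}" by (rule derived_eq_singleton) simp
  then show ?thesis
    using lagrange[OF triv_subgroup] by (simp add: abelianization_def FactGroup_def Coset.order_def)
qed

section \<open>Averaging over the acting group\<close>

context odd_linear_action
begin

definition vsum :: "'k set \<Rightarrow> ('k \<Rightarrow> bit vec) \<Rightarrow> bit vec" where
  "vsum K u = vec n (\<lambda>i. \<Sum>k\<in>K. u k $ i)"

lemma vsum_carrier [simp]: "vsum K u \<in> V"
  by (simp add: vsum_def)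

lemma vsum_empty: "vsum {} u = 0\<^sub>v n"
  by (rule eq_vecI) (simp_all add: vsum_def)

lemma vsum_insert:
  assumes "finite K" "k \<notin> K" "u k \<in> V"
  shows "vsum (insert k K) u = u k + vsum K u"
  by (rule eq_vecI) (use assms in \<open>simp_all add: vsum_def\<close>)

lemma vsum_closed:
  assumes "finite K" "0\<^sub>v n \<in> T" "\<And>x y. x \<in> T \<Longrightarrow> y \<in> T \<Longrightarrow> x + y \<in> T" "T \<subseteq> V"
    "\<And>k. k \<in> K \<Longrightarrow> u k \<in> T"
  shows "vsum K u \<in> T"
  using assms(1,5)
proof (induction K rule: finite_induct)
  case empty
  then show ?case using assms(2) by (simp add: vsum_empty)
next
  case (insert k K)
  have "u k \<in> V" using insert.prems assms(4) by blast
  then show ?case using insert assms(3) by (simp add: vsum_insert)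
qed

lemma act_vsum:
  assumes "finite K" "b \<in> carrier A" "\<And>k. k \<in> K \<Longrightarrow> u k \<in> V"
  shows "\<phi> b (vsum K u) = vsum K (\<lambda>k. \<phi> b (u k))"
  using assms(1,3)
proof (induction K rule: finite_induct)
  case empty
  then show ?case using assms(2) by (simp add: vsum_empty)
next
  case (insert k K)
  have "u k \<in> V" using insert.prems by blast
  then show ?case using insert assms(2) by (simp add: vsum_insert act_add)
qed

lemma vsum_mult_left:
  assumes "b \<in> carrier A"
  shows "vsum (carrier A) (\<lambda>c. u (b \<otimes> c)) = vsum (carrier A) u"
proof (rule eq_vecI)
  fix i assume "i < dim_vec (vsum (carrier A) u)"
  then have i: "i < n" by (simp add: vsum_def)
  have "(\<Sum>c\<in>carrier A. u (b \<otimes> c) $ i) = (\<Sum>c\<in>carrier A. u c $ i)"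
    by (rule sum.reindex_bij_witness[of _ "\<lambda>c. inv b \<otimes> c" "\<lambda>c. b \<otimes> c"])
      (use assms in \<open>auto simp flip: A.m_assoc\<close>)
  then show "vsum (carrier A) (\<lambda>c. u (b \<otimes> c)) $ i = vsum (carrier A) u $ i"
    using i by (simp add: vsum_def)
qed (simp add: vsum_def)

text \<open>The sum over A is fixed by A, and C_V(A) = 0.\<close>

lemma vsum_orbit_zero:
  assumes x: "x \<in> V"
  shows "vsum (carrier A) (\<lambda>b. \<phi> b x) = 0\<^sub>v n"
proof (rule act_fixed_imp_zero)
  fix a assume a: "a \<in> carrier A"
  have "\<phi> a (vsum (carrier A) (\<lambda>b. \<phi> b x)) = vsum (carrier A) (\<lambda>b. \<phi> a (\<phi> b x))"
    by (rule act_vsum[OF finite_A a]) (simp add: x)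
  also have "\<dots> = vsum (carrier A) (\<lambda>b. \<phi> (a \<otimes> b) x)"
    unfolding vsum_def by (intro arg_cong[of _ _ "vec n"] ext sum.cong) (simp_all add: a x composition_rule)
  also have "\<dots> = vsum (carrier A) (\<lambda>b. \<phi> b x)" by (rule vsum_mult_left[OF a])
  finally show "\<phi> a (vsum (carrier A) (\<lambda>b. \<phi> b x)) = vsum (carrier A) (\<lambda>b. \<phi> b x)" .
qed simp

lemma vsum_add_const:
  assumes u: "\<And>b. b \<in> carrier A \<Longrightarrow> u b \<in> V" and x: "x \<in> V"
  shows "vsum (carrier A) (\<lambda>b. u b + x) = vsum (carrier A) u + x"
proof (rule eq_vecI)
  fix i assume "i < dim_vec (vsum (carrier A) u + x)"
  then have i: "i < n" using x by simp
  have "(of_nat (card (carrier A)) :: bit) = 1"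
    by (rule of_nat_odd_bit) (use odd_A in \<open>simp add: Coset.order_def\<close>)
  then have "(\<Sum>b\<in>carrier A. u b $ i + x $ i) = (\<Sum>b\<in>carrier A. u b $ i) + x $ i"
    by (simp add: sum.distrib)
  moreover have "(\<Sum>b\<in>carrier A. (u b + x) $ i) = (\<Sum>b\<in>carrier A. u b $ i + x $ i)"
    by (rule sum.cong) (use i x in auto)
  ultimately show "vsum (carrier A) (\<lambda>b. u b + x) $ i = (vsum (carrier A) u + x) $ i"
    using i x by (simp add: vsum_def)
qed (use x in \<open>simp add: vsum_def\<close>)

text \<open>An odd group without fixed points in \<open>V\<close> has none in \<open>V / T\<close> either, by averaging.\<close>

lemma fixed_mod_subgroup:
  assumes T: "T \<subseteq> V" "0\<^sub>v n \<in> T" "\<And>x y. x \<in> T \<Longrightarrow> y \<in> T \<Longrightarrow> x + y \<in> T"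
    and x: "x \<in> V" "\<And>b. b \<in> carrier A \<Longrightarrow> \<phi> b x + x \<in> T"
  shows "x \<in> T"
proof -
  have "vsum (carrier A) (\<lambda>b. \<phi> b x + x) = vsum (carrier A) (\<lambda>b. \<phi> b x) + x"
    by (rule vsum_add_const) (use x in auto)
  also have "\<dots> = x" unfolding vsum_orbit_zero[OF x(1)] using x(1) by simp
  finally have "x = vsum (carrier A) (\<lambda>b. \<phi> b x + x)" by simp
  also have "\<dots> \<in> T" by (rule vsum_closed[OF finite_A T(2,3,1)]) (use x in auto)
  finally show ?thesis .
qed

definition "stab_shift S = {t \<in> V. shift t S = S}"

lemma stab_shift_subgroup:
  assumes "S \<subseteq> V"
  shows "stab_shift S \<subseteq> V" "0\<^sub>v n \<in> stab_shift S"
    "\<And>x y. x \<in> stab_shift S \<Longrightarrow> y \<in> stab_shift S \<Longrightarrow> x + y \<in> stab_shift S"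
proof -
  show "stab_shift S \<subseteq> V" "0\<^sub>v n \<in> stab_shift S" using assms unfolding stab_shift_def by auto
  fix x y assume "x \<in> stab_shift S" "y \<in> stab_shift S"
  then show "x + y \<in> stab_shift S"
    using shift_shift[OF assms, of x y] unfolding stab_shift_def by auto
qed

lemma act_image_subset: "b \<in> carrier A \<Longrightarrow> S \<subseteq> V \<Longrightarrow> \<phi> b ` S \<subseteq> V"
  using act_closed by blast

lemma act_shift:
  assumes "b \<in> carrier A" "S \<subseteq> V" "t \<in> V"
  shows "\<phi> b ` shift t S = shift (\<phi> b t) (\<phi> b ` S)"
proof -
  have "\<phi> b (x + t) = \<phi> b x + \<phi> b t" if "x \<in> S" for x
    by (rule act_add) (use assms that in auto)
  then show ?thesis unfolding shift_def image_image by (intro image_cong) auto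
qed

lemma act_image_inv:
  assumes "b \<in> carrier A" "S \<subseteq> V"
  shows "\<phi> (inv b) ` \<phi> b ` S = S" "\<phi> b ` \<phi> (inv b) ` S = S"
proof -
  have "\<phi> (inv b) (\<phi> b x) = x" "\<phi> b (\<phi> (inv b) x) = x" if "x \<in> S" for x
    using assms that by auto
  then show "\<phi> (inv b) ` \<phi> b ` S = S" "\<phi> b ` \<phi> (inv b) ` S = S"
    unfolding image_image by auto
qed

lemma stable_image:
  assumes "stable S" "b \<in> carrier A"
  shows "\<phi> b ` S = S"
proof
  show "\<phi> b ` S \<subseteq> S" using assms by blast
  have "\<phi> (inv b) ` S \<subseteq> S" using assms by blast
  then have "\<phi> b ` \<phi> (inv b) ` S \<subseteq> \<phi> b ` S" by (rule image_mono)
  then show "S \<subseteq> \<phi> b ` S" using act_image_inv(2)[OF assms(2), of S] assms(1) by simp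
qed

text \<open>Glauberman's lemma for the affine action of \<open>A\<close> on the translates of \<open>S\<close>: the sum over \<open>A\<close> of
  the translations \<open>c b\<close> moves \<open>S\<close> to a fixed translate.\<close>

lemma exists_stable_shift:
  assumes S: "S \<subseteq> V" and c: "\<And>b. b \<in> carrier A \<Longrightarrow> \<phi> b ` S \<in> shifts n S"
  obtains x where "x \<in> V" "stable (shift x S)"
proof -
  have "\<forall>b\<in>carrier A. \<exists>c. c \<in> V \<and> \<phi> b ` S = shift c S" using c unfolding shifts_def by blast
  then obtain c where c: "\<And>b. b \<in> carrier A \<Longrightarrow> c b \<in> V" "\<And>b. b \<in> carrier A \<Longrightarrow> \<phi> b ` S = shift (c b) S"
    by metis
  define x where "x = vsum (carrier A) c"
  have xV: "x \<in> V" unfolding x_def by simp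
  note T = stab_shift_subgroup[OF S]
  \<comment> \<open>Comparing \<open>a \<otimes> b\<close> applied to S with a applied to
    \<open>shift (c b) S\<close> shows that c is a cocycle modulo the stabilizer of S. Summing the
    relation over b leaves one copy of \<open>c a\<close>, because |A| is odd.\<close>
  have step: "\<phi> a x + x + c a \<in> stab_shift S" if a: "a \<in> carrier A" for a
  proof -
    have m: "\<phi> a (c b) + c (a \<otimes> b) + c a \<in> stab_shift S" if b: "b \<in> carrier A" for b
    proof -
      have ab: "a \<otimes> b \<in> carrier A" using a b by simp
      have v: "\<phi> a (c b) \<in> V" "c (a \<otimes> b) \<in> V" "c a \<in> V" using a b ab c(1) by auto
      have "shift (c (a \<otimes> b)) S = \<phi> (a \<otimes> b) ` S" using c(2)[OF ab] by simp
      also have "\<dots> = \<phi> a ` \<phi> b ` S"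
        unfolding image_image by (rule image_cong) (use a b S composition_rule in auto)
      also have "\<dots> = shift (\<phi> a (c b)) (shift (c a) S)"
        unfolding c(2)[OF b] by (simp add: act_shift[OF a S c(1)[OF b]] c(2)[OF a])
      also have "\<dots> = shift (c a + \<phi> a (c b)) S" by (rule shift_shift[OF S v(3,1)])
      finally have "shift (c a + \<phi> a (c b) + c (a \<otimes> b)) S = S"
        using shift_eq_iff[OF S, of "c a + \<phi> a (c b)" "c (a \<otimes> b)"] v by simp
      moreover have "c a + \<phi> a (c b) + c (a \<otimes> b) = \<phi> a (c b) + c (a \<otimes> b) + c a"
        by (rule eq_vecI) (use v in \<open>auto simp: algebra_simps\<close>)
      ultimately show ?thesis unfolding stab_shift_def using v by simp
    qed
    have "vsum (carrier A) (\<lambda>b. \<phi> a (c b) + c (a \<otimes> b) + c a) \<in> stab_shift S"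
      by (rule vsum_closed[OF finite_A T(2,3,1)]) (use m in auto)
    also have "vsum (carrier A) (\<lambda>b. \<phi> a (c b) + c (a \<otimes> b) + c a) =
        vsum (carrier A) (\<lambda>b. \<phi> a (c b) + c (a \<otimes> b)) + c a"
      by (rule vsum_add_const) (use a c(1) in auto)
    also have "vsum (carrier A) (\<lambda>b. \<phi> a (c b) + c (a \<otimes> b)) =
        vsum (carrier A) (\<lambda>b. \<phi> a (c b)) + vsum (carrier A) (\<lambda>b. c (a \<otimes> b))"
    proof (rule eq_vecI)
      fix i assume "i < dim_vec (vsum (carrier A) (\<lambda>b. \<phi> a (c b)) + vsum (carrier A) (\<lambda>b. c (a \<otimes> b)))"
      then have i: "i < n" by (simp add: vsum_def)
      have "(\<Sum>b\<in>carrier A. (\<phi> a (c b) + c (a \<otimes> b)) $ i) = (\<Sum>b\<in>carrier A. \<phi> a (c b) $ i + c (a \<otimes> b) $ i)"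
      proof (rule sum.cong[OF refl])
        fix b assume "b \<in> carrier A"
        then have "c (a \<otimes> b) \<in> V" using a c(1) by simp
        then show "(\<phi> a (c b) + c (a \<otimes> b)) $ i = \<phi> a (c b) $ i + c (a \<otimes> b) $ i"
          using i by simp
      qed
      then show "vsum (carrier A) (\<lambda>b. \<phi> a (c b) + c (a \<otimes> b)) $ i =
          (vsum (carrier A) (\<lambda>b. \<phi> a (c b)) + vsum (carrier A) (\<lambda>b. c (a \<otimes> b))) $ i"
        using i by (simp add: vsum_def sum.distrib)
    qed (simp add: vsum_def)
    also have "vsum (carrier A) (\<lambda>b. \<phi> a (c b)) = \<phi> a x"
      unfolding x_def by (rule act_vsum[symmetric, OF finite_A a c(1)])
    also have "vsum (carrier A) (\<lambda>b. c (a \<otimes> b)) = x"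
      unfolding x_def by (rule vsum_mult_left[OF a])
    finally show ?thesis .
  qed
  \<comment> \<open>The image of S + x is S + c(a) + a x, and c(a) + a x + x stabilizes S.\<close>
  have "\<phi> a ` shift x S = shift x S" if a: "a \<in> carrier A" for a
  proof -
    have v: "\<phi> a x \<in> V" "c a \<in> V" using a xV c(1) by auto
    have "\<phi> a ` shift x S = shift (c a + \<phi> a x) S"
      unfolding act_shift[OF a S xV] c(2)[OF a] by (rule shift_shift[OF S v(2,1)])
    moreover have "c a + \<phi> a x + x = \<phi> a x + x + c a"
      by (rule eq_vecI) (use v xV in \<open>auto simp: algebra_simps\<close>)
    ultimately show ?thesis
      using step[OF a] shift_eq_iff[OF S _ xV, of "c a + \<phi> a x"] v unfolding stab_shift_def by simp
  qed
  then have "stable (shift x S)" using shift_subset[OF S xV] by blast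
  then show ?thesis by (rule that[OF xV])
qed

section \<open>Invariant characters and the fixed subgroup\<close>

abbreviation "\<alpha> \<equiv> wreath_act A n \<phi>"

definition "bact b f = (\<lambda>x \<in> V. f (\<phi> (inv b) x))"

lemma bact_closed [simp]: "bact b f \<in> bfuns n"
  by (simp add: bact_def bfuns_def)

lemma wreath_act_eq: "\<alpha> b (f, t) = (bact b f, \<phi> b t)"
  by (simp add: wreath_act_def bact_def)

lemma lam_bact:
  assumes "b \<in> carrier A" "Q \<subseteq> V"
  shows "lam Q (bact b f) = lam (\<phi> (inv b) ` Q) f"
proof -
  have "inj_on (\<phi> (inv b)) Q" using inj_on_subset[OF inj_prop[of "inv b"] assms(2)] assms(1) by simp
  then have "lam (\<phi> (inv b) ` Q) f = (\<Prod>x\<in>Q. bsgn (f (\<phi> (inv b) x)))"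
    unfolding lam_def by (simp add: prod.reindex)
  also have "\<dots> = lam Q (bact b f)"
    unfolding lam_def bact_def by (rule prod.cong) (use assms(2) in auto)
  finally show ?thesis by simp
qed

lemma bact_bzero: "b \<in> carrier A \<Longrightarrow> bact b (bzero n) = bzero n"
  by (rule bfuns_eqI[OF bact_closed bzero_closed]) (simp add: bact_def)

lemma sum_lam_bact:
  assumes "b \<in> carrier A" "X \<subseteq> Pow V"
  shows "(\<Sum>Q\<in>X. lam Q (bact b f)) = (\<Sum>Q\<in>(`) (\<phi> (inv b)) ` X. lam Q f)"
proof -
  have "inj_on ((`) (\<phi> (inv b))) X"
  proof (rule inj_on_inverseI)
    fix Q assume "Q \<in> X"
    then have "Q \<subseteq> V" using assms(2) by blast
    then show "\<phi> b ` \<phi> (inv b) ` Q = Q" by (rule act_image_inv(2)[OF assms(1)])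
  qed
  then show ?thesis
    by (simp add: sum.reindex) (rule sum.cong, use lam_bact[OF assms(1)] assms(2) in auto)
qed

text \<open>On B, invariance says that A permutes the translates of S, so one of them, S', is
  stable. At (0, t) with t stabilizing S' it says that \<open>dotsgn a\<close> takes equal values at
  t and b t.\<close>

lemma chi_inv_imp:
  assumes a: "a \<in> V" and S: "S \<subseteq> V"
    and inv: "\<And>b g. b \<in> carrier A \<Longrightarrow> g \<in> carrier (wreath n) \<Longrightarrow> chi n a S (\<alpha> b g) = chi n a S g"
  obtains S' where "stable S'" "chi n a S = chi n (0\<^sub>v n) S'"
proof -
  have sub: "shifts n S \<subseteq> Pow V" using shifts_subset[OF S] by blast
  have "\<phi> b ` S \<in> shifts n S" if b: "b \<in> carrier A" for b
  proof -
    have ib: "inv b \<in> carrier A" using b by simp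
    \<comment> \<open>The element \<open>inv b\<close> acts here, since \<open>lam_bact\<close>
      converts an action on functions into the inverse action on sets.\<close>
    have "(`) (\<phi> (inv (inv b))) ` shifts n S = shifts n S"
    proof (rule sum_lam_determines[of _ n])
      show "(`) (\<phi> (inv (inv b))) ` shifts n S \<subseteq> Pow V"
      proof (rule image_subsetI)
        fix Q assume "Q \<in> shifts n S"
        then have "Q \<subseteq> V" using sub by blast
        then show "\<phi> (inv (inv b)) ` Q \<in> Pow V" using act_image_subset[OF b] b by simp
      qed
      fix f assume f: "f \<in> bfuns n"
      have "chi n a S (bact (inv b) f, 0\<^sub>v n) = chi n a S (f, 0\<^sub>v n)"
        using inv[OF ib, of "(f, 0\<^sub>v n)"] f ib by (simp add: wreath_act_eq carrier_wreath)
      then show "(\<Sum>Q\<in>(`) (\<phi> (inv (inv b))) ` shifts n S. lam Q f) = (\<Sum>Q\<in>shifts n S. lam Q f)"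
        using f S a sum_lam_bact[OF ib sub, of f] by (simp add: chi_base)
    qed (rule sub)
    then show ?thesis using self_in_shifts[OF S] b by auto
  qed
  then obtain x where x: "x \<in> V" "stable (shift x S)" by (rule exists_stable_shift[OF S])
  define S' where "S' = shift x S"
  have S': "stable S'" "S' \<subseteq> V" using x(2) unfolding S'_def by blast+
  have eq: "chi n a S' = chi n a S" unfolding S'_def by (rule chi_shift[OF S x(1)])
  note T = stab_shift_subgroup[OF S'(2)]
  have "dotsgn a t = 1" if t: "t \<in> stab_shift S'" for t
  proof -
    have val: "chi n a S' (bzero n, s) = dotsgn a s * of_nat (card (shifts n S'))" if "s \<in> stab_shift S'" for s
    proof -
      have "(\<Sum>Q\<in>shifts n S'. lam Q (bzero n)) = (\<Sum>Q\<in>shifts n S'. 1)"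
        by (rule sum.cong) (use shifts_subset[OF S'(2)] in auto)
      then show ?thesis using that by (simp add: chi_def stab_shift_def carrier_wreath)
    qed
    have "shifts n S' \<noteq> {}" using self_in_shifts[OF S'(2)] by blast
    then have c0: "(of_nat (card (shifts n S')) :: complex) \<noteq> 0" by simp
    have tV: "t \<in> V" using t T(1) by blast
    have cl: "\<phi> b t \<in> stab_shift S'" if b: "b \<in> carrier A" for b
      using act_shift[OF b S'(2) tV] stable_image[OF S'(1) b] t b unfolding stab_shift_def by simp
    have d: "dotsgn a (\<phi> b t) = dotsgn a t" if b: "b \<in> carrier A" for b
    proof -
      have "chi n a S' (bzero n, \<phi> b t) = chi n a S' (bzero n, t)"
        using inv[OF b, of "(bzero n, t)"] tV b unfolding eq
        by (simp add: wreath_act_eq bact_bzero carrier_wreath)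
      then show ?thesis using val[OF t] val[OF cl[OF b]] c0 by simp
    qed
    \<comment> \<open>b t + t lies in the kernel of \<open>dotsgn a\<close> for every b. A fixes no
      nonzero class modulo this subgroup, so t lies in the kernel as well.\<close>
    have "t \<in> {s \<in> stab_shift S'. dotsgn a s = 1}"
    proof (rule fixed_mod_subgroup[OF _ _ _ tV])
      show "{s \<in> stab_shift S'. dotsgn a s = 1} \<subseteq> V" using T(1) by blast
      show "0\<^sub>v n \<in> {s \<in> stab_shift S'. dotsgn a s = 1}" using T(2) a by simp
      show "x + y \<in> {s \<in> stab_shift S'. dotsgn a s = 1}"
        if "x \<in> {s \<in> stab_shift S'. dotsgn a s = 1}" "y \<in> {s \<in> stab_shift S'. dotsgn a s = 1}" for x y
      proof -
        have "x \<in> V" "y \<in> V" using that T(1) by blast+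
        then show ?thesis using that T(3) dotsgn_add[OF a, of x y] by simp
      qed
      show "\<phi> b t + t \<in> {s \<in> stab_shift S'. dotsgn a s = 1}" if b: "b \<in> carrier A" for b
        using T(3)[OF cl[OF b] t] dotsgn_add[OF a _ tV, of "\<phi> b t"] d[OF b] b tV by simp
    qed
    then show ?thesis by simp
  qed
  then have "chi n a S' = chi n (0\<^sub>v n) S'"
    unfolding chi_def by (intro restrict_ext) (auto simp: carrier_wreath stab_shift_def)
  then show ?thesis using that[OF S'(1)] eq by simp
qed

lemma act_image_shifts:
  assumes "stable S" "b \<in> carrier A"
  shows "(`) (\<phi> b) ` shifts n S = shifts n S"
proof -
  have S: "S \<subseteq> V" using assms(1) by blast
  have sub: "(`) (\<phi> b) ` shifts n S \<subseteq> shifts n S" if b: "b \<in> carrier A" for b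
  proof
    fix Q assume "Q \<in> (`) (\<phi> b) ` shifts n S"
    then obtain t where t: "t \<in> V" "Q = \<phi> b ` shift t S" unfolding shifts_def by blast
    then have "Q = shift (\<phi> b t) S" using act_shift[OF b S t(1)] stable_image[OF assms(1) b] by simp
    then show "Q \<in> shifts n S"
      unfolding shifts_def using t(1) b by (intro image_eqI[of _ _ "\<phi> b t"]) simp_all
  qed
  show ?thesis
  proof
    show "(`) (\<phi> b) ` shifts n S \<subseteq> shifts n S" by (rule sub[OF assms(2)])
    show "shifts n S \<subseteq> (`) (\<phi> b) ` shifts n S"
    proof
      fix Q assume Q: "Q \<in> shifts n S"
      then have "\<phi> (inv b) ` Q \<in> shifts n S" using sub[of "inv b"] assms(2) by blast
      moreover have "Q = \<phi> b ` \<phi> (inv b) ` Q"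
        using act_image_inv(2)[OF assms(2) shifts_subset[OF S Q]] by simp
      ultimately show "Q \<in> (`) (\<phi> b) ` shifts n S" by blast
    qed
  qed
qed

lemma chi_stable_inv:
  assumes S: "stable S" and b: "b \<in> carrier A" and g: "g \<in> carrier (wreath n)"
  shows "chi n (0\<^sub>v n) S (\<alpha> b g) = chi n (0\<^sub>v n) S g"
proof -
  have SV: "S \<subseteq> V" using S by blast
  have sub: "shifts n S \<subseteq> Pow V" using shifts_subset[OF SV] by blast
  obtain f t where ft: "g = (f, t)" "f \<in> bfuns n" "t \<in> V" using g by (auto simp: carrier_wreath)
  have "shift (\<phi> b t) S = \<phi> b ` shift t S"
    using act_shift[OF b SV ft(3)] stable_image[OF S b] by simp
  moreover have "\<phi> b ` shift t S = S \<longleftrightarrow> shift t S = S"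
    using act_image_inv(1)[OF b shift_subset[OF SV ft(3)]] stable_image[OF S b] stable_image[OF S A.inv_closed[OF b]]
    by metis
  moreover have "(\<Sum>Q\<in>shifts n S. lam Q (bact b f)) = (\<Sum>Q\<in>shifts n S. lam Q f)"
    unfolding sum_lam_bact[OF b sub] act_image_shifts[OF S A.inv_closed[OF b]] ..
  ultimately show ?thesis using ft b by (simp add: chi_def wreath_act_eq carrier_wreath)
qed

text \<open>Equality on B gives S' = S + x. Stability of both sets puts every b x + x into the
  stabilizer of S, and then x itself by \<open>fixed_mod_subgroup\<close>.\<close>

lemma inj_chi_stable: "inj_on (chi n (0\<^sub>v n)) {S. stable S}"
proof (rule inj_onI)
  fix S S' assume "S \<in> {S. stable S}" "S' \<in> {S. stable S}" and eq: "chi n (0\<^sub>v n) S = chi n (0\<^sub>v n) S'"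
  then have S: "stable S" "S \<subseteq> V" and S': "stable S'" "S' \<subseteq> V" by blast+
  have "shifts n S = shifts n S'"
  proof (rule sum_lam_determines[of _ n])
    show "shifts n S \<subseteq> Pow V" "shifts n S' \<subseteq> Pow V" using shifts_subset S S' by blast+
    fix f assume "f \<in> bfuns n"
    then show "(\<Sum>Q\<in>shifts n S. lam Q f) = (\<Sum>Q\<in>shifts n S'. lam Q f)"
      using chi_base[OF S(2), of "0\<^sub>v n" f] chi_base[OF S'(2), of "0\<^sub>v n" f] eq by simp
  qed
  then have "S' \<in> shifts n S" using self_in_shifts[OF S'(2)] by simp
  then obtain x where x: "x \<in> V" "S' = shift x S" unfolding shifts_def by blast
  note T = stab_shift_subgroup[OF S(2)]
  have "x \<in> stab_shift S"
  proof (rule fixed_mod_subgroup[OF T x(1)])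
    fix b assume b: "b \<in> carrier A"
    have "shift (\<phi> b x) S = shift x S"
      using act_shift[OF b S(2) x(1)] stable_image[OF S(1) b] stable_image[OF S'(1) b] x(2) by simp
    then show "\<phi> b x + x \<in> stab_shift S"
      using shift_eq_iff[OF S(2) _ x(1), of "\<phi> b x"] b x(1) unfolding stab_shift_def by simp
  qed
  then show "S = S'" using x(2) unfolding stab_shift_def by simp
qed

lemma Irr_inv_wreath: "Irr_inv A (wreath n) \<alpha> = chi n (0\<^sub>v n) ` {S. stable S}"
proof
  show "Irr_inv A (wreath n) \<alpha> \<subseteq> chi n (0\<^sub>v n) ` {S. stable S}"
  proof
    fix \<chi> assume \<chi>: "\<chi> \<in> Irr_inv A (wreath n) \<alpha>"
    then obtain a S where aS: "\<chi> = chi n a S" "a \<in> V" "S \<subseteq> V"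
      unfolding Irr_inv_def Irr_wreath by blast
    then have "\<And>b g. b \<in> carrier A \<Longrightarrow> g \<in> carrier (wreath n) \<Longrightarrow> chi n a S (\<alpha> b g) = chi n a S g"
      using \<chi> unfolding Irr_inv_def by blast
    then obtain S' where "stable S'" "chi n a S = chi n (0\<^sub>v n) S'"
      by (rule chi_inv_imp[OF aS(2,3)])
    then show "\<chi> \<in> chi n (0\<^sub>v n) ` {S. stable S}" using aS(1) by blast
  qed
  show "chi n (0\<^sub>v n) ` {S. stable S} \<subseteq> Irr_inv A (wreath n) \<alpha>"
  proof
    fix \<chi> assume "\<chi> \<in> chi n (0\<^sub>v n) ` {S. stable S}"
    then obtain S where S: "stable S" "\<chi> = chi n (0\<^sub>v n) S" by blast
    have "\<chi> \<in> Irr (wreath n)" unfolding S(2) by (rule chi_in_Irr) (use S(1) in auto)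
    then show "\<chi> \<in> Irr_inv A (wreath n) \<alpha>"
      unfolding Irr_inv_def using chi_stable_inv[OF S(1)] S(2) by simp
  qed
qed

definition "inv_funs = {f \<in> bfuns n. \<forall>b \<in> carrier A. \<forall>x \<in> V. f (\<phi> b x) = f x}"

lemma fixed_points_wreath: "fixed_points A (carrier (wreath n)) \<alpha> = (\<lambda>f. (f, 0\<^sub>v n)) ` inv_funs"
proof
  show "fixed_points A (carrier (wreath n)) \<alpha> \<subseteq> (\<lambda>f. (f, 0\<^sub>v n)) ` inv_funs"
  proof
    fix g assume g: "g \<in> fixed_points A (carrier (wreath n)) \<alpha>"
    then obtain f t where ft: "g = (f, t)" "f \<in> bfuns n" "t \<in> V"
      unfolding fixed_points_def by (auto simp: carrier_wreath)
    have fx: "bact b f = f" "\<phi> b t = t" if "b \<in> carrier A" for b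
    proof -
      have "\<alpha> b (f, t) = (f, t)" using g that unfolding fixed_points_def ft(1) by blast
      then show "bact b f = f" "\<phi> b t = t" by (simp_all add: wreath_act_eq)
    qed
    have "t = 0\<^sub>v n" by (rule act_fixed_imp_zero[OF ft(3) fx(2)])
    moreover have "f (\<phi> b x) = f x" if b: "b \<in> carrier A" and x: "x \<in> V" for b x
    proof -
      have "bact b f (\<phi> b x) = f x" unfolding bact_def using b x by simp
      then show ?thesis using fx(1)[OF b] by simp
    qed
    ultimately show "g \<in> (\<lambda>f. (f, 0\<^sub>v n)) ` inv_funs" using ft unfolding inv_funs_def by blast
  qed
  show "(\<lambda>f. (f, 0\<^sub>v n)) ` inv_funs \<subseteq> fixed_points A (carrier (wreath n)) \<alpha>"
  proof
    fix g :: "(bit vec \<Rightarrow> bit) \<times> bit vec" assume "g \<in> (\<lambda>f. (f, 0\<^sub>v n)) ` inv_funs"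
    then obtain f where f: "g = (f, 0\<^sub>v n)" "f \<in> bfuns n"
      "\<And>b x. b \<in> carrier A \<Longrightarrow> x \<in> V \<Longrightarrow> f (\<phi> b x) = f x"
      unfolding inv_funs_def by blast
    have "bact b f = f" if "b \<in> carrier A" for b
      by (rule bfuns_eqI[OF bact_closed f(2)]) (use f(3) that in \<open>simp add: bact_def\<close>)
    then show "g \<in> fixed_points A (carrier (wreath n)) \<alpha>"
      unfolding fixed_points_def f(1) using f(2) by (simp add: wreath_act_eq carrier_wreath)
  qed
qed

text \<open>An invariant function corresponds to its support.\<close>

lemma card_inv_funs: "card inv_funs = card {S. stable S}"
proof (rule bij_betw_same_card)
  show "bij_betw (\<lambda>f. {x \<in> V. f x = 1}) inv_funs {S. stable S}"
  proof (rule bij_betw_byWitness[where f' = "\<lambda>S. \<lambda>x \<in> V. if x \<in> S then 1 else 0"])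
    show "\<forall>f\<in>inv_funs. (\<lambda>x\<in>V. if x \<in> {x \<in> V. f x = 1} then 1 else 0) = f"
    proof
      fix f assume "f \<in> inv_funs"
      then have f: "f \<in> bfuns n" unfolding inv_funs_def by blast
      show "(\<lambda>x\<in>V. if x \<in> {x \<in> V. f x = 1} then 1 else 0) = f"
        by (rule bfuns_eqI[OF _ f]) (auto simp: bfuns_def)
    qed
    show "\<forall>S\<in>{S. stable S}. {x \<in> V. (\<lambda>x\<in>V. if x \<in> S then 1 else 0 :: bit) x = 1} = S" by auto
    show "(\<lambda>f. {x \<in> V. f x = 1}) ` inv_funs \<subseteq> {S. stable S}" unfolding inv_funs_def by auto
    show "(\<lambda>S. \<lambda>x\<in>V. if x \<in> S then 1 else 0) ` {S. stable S} \<subseteq> inv_funs"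
    proof
      fix f :: "bit vec \<Rightarrow> bit" assume "f \<in> (\<lambda>S. \<lambda>x\<in>V. if x \<in> S then 1 else 0) ` {S. stable S}"
      then obtain S where S: "stable S" "f = (\<lambda>x\<in>V. if x \<in> S then 1 else 0)" by blast
      have "\<phi> b x \<in> S \<longleftrightarrow> x \<in> S" if "b \<in> carrier A" "x \<in> V" for b x
        using S(1) that act_inv(1)[OF that] A.inv_closed[OF that(1)] by metis
      then show "f \<in> inv_funs" unfolding inv_funs_def S(2) by (simp add: bfuns_def)
    qed
  qed
qed

text \<open>C_G(A) lies in B and is abelian, so its derived subgroup is trivial and its order is the
  number of stable sets. By \<open>Irr_inv_wreath\<close> and \<open>inj_chi_stable\<close> this is
  also the number of invariant characters.\<close>

lemma order_abelianization_fixed_subgroup: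
  "Coset.order (abelianization (fixed_subgroup A (wreath n) \<alpha>)) = card {S. stable S}"
proof -
  let ?H = "fixed_subgroup A (wreath n) \<alpha>"
  have car: "carrier ?H = (\<lambda>f. (f, 0\<^sub>v n)) ` inv_funs"
    unfolding fixed_subgroup_def fixed_points_wreath[symmetric] by simp
  have mult: "(f, 0\<^sub>v n) \<otimes>\<^bsub>?H\<^esub> (g, 0\<^sub>v n) = (badd n f g, 0\<^sub>v n)" if "g \<in> inv_funs" for f g
    using that unfolding fixed_subgroup_def inv_funs_def by (simp add: mult_wreath)
  have one: "\<one>\<^bsub>?H\<^esub> = (bzero n, 0\<^sub>v n)" unfolding fixed_subgroup_def by (simp add: one_wreath)
  have badd: "badd n f g \<in> inv_funs" if "f \<in> inv_funs" "g \<in> inv_funs" for f g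
    using that unfolding inv_funs_def by simp
  have z: "bzero n \<in> inv_funs" unfolding inv_funs_def by simp
  have b: "f \<in> bfuns n" if "f \<in> inv_funs" for f using that unfolding inv_funs_def by blast
  have "comm_group ?H"
  proof (rule comm_groupI)
    fix x y assume "x \<in> carrier ?H" "y \<in> carrier ?H"
    then obtain f g where fg: "f \<in> inv_funs" "g \<in> inv_funs" "x = (f, 0\<^sub>v n)" "y = (g, 0\<^sub>v n)"
      unfolding car by blast
    show "x \<otimes>\<^bsub>?H\<^esub> y \<in> carrier ?H" using fg badd unfolding car by (simp add: mult)
    show "x \<otimes>\<^bsub>?H\<^esub> y = y \<otimes>\<^bsub>?H\<^esub> x" using fg by (simp add: mult badd_commute)
    show "x \<otimes>\<^bsub>?H\<^esub> y \<otimes>\<^bsub>?H\<^esub> z = x \<otimes>\<^bsub>?H\<^esub> (y \<otimes>\<^bsub>?H\<^esub> z)" if "z \<in> carrier ?H" for z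
      using that fg badd unfolding car by (auto simp: mult badd_assoc)
    show "\<one>\<^bsub>?H\<^esub> \<otimes>\<^bsub>?H\<^esub> x = x" using fg b by (simp add: mult one)
    have "x \<otimes>\<^bsub>?H\<^esub> x = \<one>\<^bsub>?H\<^esub>" using fg b by (simp add: mult one)
    then show "\<exists>y\<in>carrier ?H. y \<otimes>\<^bsub>?H\<^esub> x = \<one>\<^bsub>?H\<^esub>" using \<open>x \<in> carrier ?H\<close> by blast
  qed (use z in \<open>simp add: car one\<close>)
  then have "Coset.order (abelianization ?H) = Coset.order ?H" by (rule order_abelianization_comm_group)
  also have "\<dots> = card (carrier ?H)" by (rule Coset.order_def)
  also have "\<dots> = card inv_funs" unfolding car by (rule card_image) (auto intro: inj_onI)
  finally show ?thesis by (simp add: card_inv_funs)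
qed

section \<open>Vanishing on the fixed subgroup and stable halves\<close>

lemma lam_act_image:
  assumes "f \<in> inv_funs" "b \<in> carrier A" "Q \<subseteq> V"
  shows "lam (\<phi> b ` Q) f = lam Q f"
proof -
  have "inj_on (\<phi> b) Q" by (rule inj_on_subset[OF inj_prop[OF assms(2)] assms(3)])
  then have "lam (\<phi> b ` Q) f = (\<Prod>x\<in>Q. bsgn (f (\<phi> b x)))" unfolding lam_def by (simp add: prod.reindex)
  also have "\<dots> = lam Q f"
    unfolding lam_def by (rule prod.cong) (use assms in \<open>auto simp: inv_funs_def\<close>)
  finally show ?thesis .
qed

text \<open>Up to the order of the stabilizer of S, the value is a sum over V of signs, which
  cancels exactly when half of them are -1.\<close>

lemma chi_base_zero_iff:
  assumes "S \<subseteq> V" "f \<in> bfuns n"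
  shows "chi n (0\<^sub>v n) S (f, 0\<^sub>v n) = 0 \<longleftrightarrow> 2 * card {x \<in> V. lam (shift x S) f = - 1} = card V"
proof -
  let ?U = "{x \<in> V. lam (shift x S) f = - 1}"
  define c where "c = card {t \<in> V. shift t S = S}"
  have "0\<^sub>v n \<in> {t \<in> V. shift t S = S}" using assms(1) by simp
  moreover have "finite {t \<in> V. shift t S = S}" by (rule finite_subset[of _ V]) auto
  ultimately have "c \<noteq> 0" unfolding c_def using card_0_eq by blast
  then have "chi n (0\<^sub>v n) S (f, 0\<^sub>v n) = 0 \<longleftrightarrow> (\<Sum>x\<in>V. lam (shift x S) f) = 0"
    unfolding chi_base[OF assms(1) zero_carrier_vec assms(2)]
      sum_over_shifts[OF assms(1), of "\<lambda>Q. lam Q f"] c_def[symmetric] by simp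
  also have "(\<Sum>x\<in>V. lam (shift x S) f) = (\<Sum>x\<in>V. if x \<in> ?U then - 1 else 1)"
  proof (rule sum.cong[OF refl])
    fix x assume "x \<in> V"
    then show "lam (shift x S) f = (if x \<in> ?U then - 1 else 1)" using lam_cases[of "shift x S" f] by auto
  qed
  also have "\<dots> = 0 \<longleftrightarrow> 2 * card ?U = card V" by (rule card_sum_signs_eq_zero_iff) auto
  finally show ?thesis .
qed

text \<open>The points of sign -1 form the half; it is stable because both f and S are
  invariant.\<close>

lemma vanishing_imp_balanced:
  assumes S: "stable S" and f: "f \<in> inv_funs" and z: "chi n (0\<^sub>v n) S (f, 0\<^sub>v n) = 0"
  shows "balanced A n \<phi>"
proof -
  let ?U = "{x \<in> V. lam (shift x S) f = - 1}"
  have SV: "S \<subseteq> V" using S by blast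
  have "f \<in> bfuns n" using f unfolding inv_funs_def by blast
  then have "2 * card ?U = card V" using chi_base_zero_iff[OF SV] z by blast
  moreover have "\<phi> b ` ?U \<subseteq> ?U" if b: "b \<in> carrier A" for b
  proof
    fix y assume "y \<in> \<phi> b ` ?U"
    then obtain x where x: "x \<in> V" "lam (shift x S) f = - 1" "y = \<phi> b x" by blast
    have "shift y S = \<phi> b ` shift x S"
      using act_shift[OF b SV x(1)] stable_image[OF S b] x(3) by simp
    then have "lam (shift y S) f = - 1" using lam_act_image[OF f b shift_subset[OF SV x(1)]] x(2) by simp
    then show "y \<in> ?U" using x b by simp
  qed
  ultimately show ?thesis unfolding balanced_def by (intro exI[of _ ?U] conjI ballI) auto
qed

lemma balanced_imp_vanishing:
  assumes "balanced A n \<phi>"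
  obtains S f where "stable S" "f \<in> inv_funs" "chi n (0\<^sub>v n) S (f, 0\<^sub>v n) = 0"
proof -
  obtain S where SV: "S \<subseteq> V" and st: "\<forall>a \<in> carrier A. \<phi> a ` S \<subseteq> S" and half: "2 * card S = card V"
    using assms unfolding balanced_def by blast
  have S: "stable S" using SV st by blast
  define f where "f = (\<lambda>x \<in> V. if x = 0\<^sub>v n then 1 else (0::bit))"
  have "\<phi> b x = 0\<^sub>v n \<longleftrightarrow> x = 0\<^sub>v n" if "b \<in> carrier A" "x \<in> V" for b x
    using act_inv(1)[OF that] act_zero[OF that(1)] act_zero[OF A.inv_closed[OF that(1)]] by metis
  then have f: "f \<in> inv_funs" unfolding inv_funs_def f_def by (simp add: bfuns_def)
  have l: "lam Q f = (if 0\<^sub>v n \<in> Q then - 1 else 1)" if "Q \<subseteq> V" for Q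
  proof -
    have "finite Q" by (rule finite_subset[OF that]) simp
    moreover have "lam Q f = (\<Prod>y\<in>Q. if y = 0\<^sub>v n then - 1 else 1)"
      unfolding lam_def f_def by (rule prod.cong) (use that in auto)
    ultimately show ?thesis by simp
  qed
  \<comment> \<open>In characteristic 2, y + x = 0 means y = x. Hence the set of points with sign -1
    is S itself.\<close>
  have "0\<^sub>v n \<in> shift x S \<longleftrightarrow> x \<in> S" if x: "x \<in> V" for x
  proof
    assume "0\<^sub>v n \<in> shift x S"
    then obtain y where y: "y \<in> S" "0\<^sub>v n = y + x" unfolding shift_def by blast
    have yV: "y \<in> V" using y(1) SV by blast
    have "x = y + x + y" using bit_vec_add_cancel(3)[OF x yV] assoc_add_vec[OF yV x yV] by simp
    also have "\<dots> = y" using y(2) yV by (metis left_zero_vec)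
    finally have "x = y" .
    then show "x \<in> S" using y by simp
  next
    assume "x \<in> S"
    then show "0\<^sub>v n \<in> shift x S" unfolding shift_def using bit_vec_add_self[OF x] by (metis imageI)
  qed
  then have "lam (shift x S) f = - 1 \<longleftrightarrow> x \<in> S" if "x \<in> V" for x
    using l[OF shift_subset[OF SV that]] that by simp
  then have "{x \<in> V. lam (shift x S) f = - 1} = S" using SV by blast
  then have "chi n (0\<^sub>v n) S (f, 0\<^sub>v n) = 0"
    using chi_base_zero_iff[OF SV] f half unfolding inv_funs_def by simp
  then show ?thesis by (rule that[OF S f])
qed

text \<open>There are as many invariant characters as elements of C_G(A)/C_G(A)'. As N_A(G) is a
  subset of this finite set, the counts differ exactly when some invariant character vanishes on
  C_G(A).\<close>

theorem counts_differ_iff_balanced: "counts_differ A n \<phi> \<longleftrightarrow> balanced A n \<phi>"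
proof -
  define N where "N = nonvanishing_Irr_inv A (wreath n) \<alpha>"
  have fin: "finite {S. stable S}" by (rule finite_subset[of _ "Pow V"]) auto
  then have finI: "finite (Irr_inv A (wreath n) \<alpha>)" unfolding Irr_inv_wreath by simp
  have cI: "card (Irr_inv A (wreath n) \<alpha>) = card {S. stable S}"
    unfolding Irr_inv_wreath by (rule card_image[OF inj_chi_stable])
  have N: "N = {\<chi> \<in> Irr_inv A (wreath n) \<alpha>. \<forall>f \<in> inv_funs. \<chi> (f, 0\<^sub>v n) \<noteq> 0}"
    unfolding N_def nonvanishing_Irr_inv_def fixed_points_wreath by blast
  have "card N = card {S. stable S} \<longleftrightarrow> \<not> balanced A n \<phi>"
  proof
    assume "\<not> balanced A n \<phi>"
    then have "N = Irr_inv A (wreath n) \<alpha>"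
      unfolding N Irr_inv_wreath using vanishing_imp_balanced by blast
    then show "card N = card {S. stable S}" using cI by simp
  next
    assume c: "card N = card {S. stable S}"
    show "\<not> balanced A n \<phi>"
    proof
      assume "balanced A n \<phi>"
      then obtain S f where "stable S" "f \<in> inv_funs" "chi n (0\<^sub>v n) S (f, 0\<^sub>v n) = 0"
        by (rule balanced_imp_vanishing)
      then have "chi n (0\<^sub>v n) S \<in> Irr_inv A (wreath n) \<alpha> - N" unfolding N Irr_inv_wreath by blast
      moreover have "N \<subseteq> Irr_inv A (wreath n) \<alpha>" unfolding N by blast
      ultimately have "N \<subset> Irr_inv A (wreath n) \<alpha>" by blast
      then have "card N < card (Irr_inv A (wreath n) \<alpha>)" by (rule psubset_card_mono[OF finI])
      then show False using c cI by simp
    qed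
  qed
  then show ?thesis
    unfolding counts_differ_def order_abelianization_fixed_subgroup N_def by blast
qed

end

section \<open>A balanced action in dimension seven\<close>

definition cyclic_monoid :: "nat \<Rightarrow> nat monoid" where
  "cyclic_monoid m = \<lparr>carrier = {..<m}, monoid.mult = (\<lambda>i j. (i + j) mod m), one = 0\<rparr>"

lemma group_cyclic_monoid:
  assumes "m > 0"
  shows "group (cyclic_monoid m)"
proof (rule groupI)
  fix x assume "x \<in> carrier (cyclic_monoid m)"
  then have "((m - x) mod m + x) mod m = 0" "(m - x) mod m < m"
    using assms by (simp_all add: cyclic_monoid_def mod_add_left_eq)
  then show "\<exists>y\<in>carrier (cyclic_monoid m). y \<otimes>\<^bsub>cyclic_monoid m\<^esub> x = \<one>\<^bsub>cyclic_monoid m\<^esub>"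
    unfolding cyclic_monoid_def by (intro bexI[of _ "(m - x) mod m"]) simp_all
qed (use assms in \<open>auto simp: cyclic_monoid_def mod_simps add.assoc\<close>)

text \<open>The periodicity makes the (m - k)-th iterate of F the inverse of the k-th. The maps are
  restricted to E because the elements of \<open>Bij E\<close> are extensional.\<close>

lemma cyclic_group_action:
  assumes m: "m > 0" and F: "\<And>x. x \<in> E \<Longrightarrow> F x \<in> E" and period: "\<And>x. x \<in> E \<Longrightarrow> (F ^^ m) x = x"
  shows "group_action (cyclic_monoid m) E (\<lambda>k. \<lambda>x \<in> E. (F ^^ k) x)"
proof -
  have closed: "(F ^^ k) x \<in> E" if "x \<in> E" for k x by (induction k) (use that F in auto)
  have add: "(F ^^ j) ((F ^^ k) x) = (F ^^ (j + k)) x" for j k x by (simp add: funpow_add)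
  have inv: "(F ^^ (m - k)) ((F ^^ k) x) = x" "(F ^^ k) ((F ^^ (m - k)) x) = x" if "k < m" "x \<in> E" for k x
    unfolding add using that period by simp_all
  have bij: "(\<lambda>x \<in> E. (F ^^ k) x) \<in> Bij E" if "k < m" for k
  proof -
    have "bij_betw (F ^^ k) E E"
      by (rule bij_betw_byWitness[where f' = "F ^^ (m - k)"]) (use inv that closed in auto)
    then show ?thesis unfolding Bij_def by simp
  qed
  have wrap: "(F ^^ ((j + k) mod m)) x = (F ^^ (j + k)) x" if "j < m" "k < m" "x \<in> E" for j k x
  proof (cases "j + k < m")
    case False
    then have "(j + k) mod m = j + k - m" using that by (simp add: mod_if)
    moreover have "(F ^^ (j + k)) x = (F ^^ (j + k - m)) ((F ^^ m) x)" unfolding add using False by simp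
    ultimately show ?thesis using period[OF that(3)] by simp
  qed simp
  show ?thesis
    unfolding group_action_def group_hom_def group_hom_axioms_def
  proof (intro conjI homI group_cyclic_monoid[OF m] group_BijGroup)
    fix j assume "j \<in> carrier (cyclic_monoid m)"
    then have j: "j < m" by (simp add: cyclic_monoid_def)
    then show "(\<lambda>x\<in>E. (F ^^ j) x) \<in> carrier (BijGroup E)" using bij by (simp add: BijGroup_def)
    fix k assume "k \<in> carrier (cyclic_monoid m)"
    then have k: "k < m" by (simp add: cyclic_monoid_def)
    show "(\<lambda>x\<in>E. (F ^^ (j \<otimes>\<^bsub>cyclic_monoid m\<^esub> k)) x) =
        (\<lambda>x\<in>E. (F ^^ j) x) \<otimes>\<^bsub>BijGroup E\<^esub> (\<lambda>x\<in>E. (F ^^ k) x)"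
    proof
      fix x
      show "(\<lambda>x\<in>E. (F ^^ (j \<otimes>\<^bsub>cyclic_monoid m\<^esub> k)) x) x =
        ((\<lambda>x\<in>E. (F ^^ j) x) \<otimes>\<^bsub>BijGroup E\<^esub> (\<lambda>x\<in>E. (F ^^ k) x)) x"
        using bij[OF j] bij[OF k] closed wrap[OF j k]
        by (auto simp: BijGroup_def cyclic_monoid_def compose_def add)
    qed
  qed
qed

text \<open>Multiplication by generators of \<open>F_4\<close>, \<open>F_4\<close> and \<open>F_8\<close> on \<open>F_4 \<oplus> F_4 \<oplus> F_8\<close>, with
  minimal polynomials \<open>X^2 + X + 1\<close> and \<open>X^3 + X + 1\<close>.\<close>

definition vec7 :: "bit \<Rightarrow> bit \<Rightarrow> bit \<Rightarrow> bit \<Rightarrow> bit \<Rightarrow> bit \<Rightarrow> bit \<Rightarrow> bit vec" where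
  "vec7 a b c d p q r = vec_of_list [a, b, c, d, p, q, r]"

text \<open>Each block advances a window on a linear recurring sequence: s(k+2) = s(k) + s(k+1)
  twice, then s(k+3) = s(k) + s(k+1). The periods 3 and 7 give order 21.\<close>

definition step7 :: "bit vec \<Rightarrow> bit vec" where
  "step7 x = vec7 (x $ 1) (x $ 0 + x $ 1) (x $ 3) (x $ 2 + x $ 3) (x $ 5) (x $ 6) (x $ 4 + x $ 5)"

lemma vec7_carrier [simp]: "vec7 a b c d p q r \<in> carrier_vec 7"
  unfolding vec7_def by (rule carrier_vecI) simp

lemma dim_vec7 [simp]: "dim_vec (vec7 a b c d p q r) = 7"
  unfolding vec7_def by simp

lemma vec7_index [simp]:
  "vec7 a b c d p q r $ 0 = a" "vec7 a b c d p q r $ Suc 0 = b" "vec7 a b c d p q r $ 2 = c"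
  "vec7 a b c d p q r $ 3 = d" "vec7 a b c d p q r $ 4 = p" "vec7 a b c d p q r $ 5 = q"
  "vec7 a b c d p q r $ 6 = r"
  unfolding vec7_def vec_of_list_index by (simp_all add: eval_nat_numeral)

lemma less_7_cases: "(i::nat) < 7 \<Longrightarrow> i = 0 \<or> i = Suc 0 \<or> i = 2 \<or> i = 3 \<or> i = 4 \<or> i = 5 \<or> i = 6"
  by auto

lemma vec7_eqI:
  assumes "x \<in> carrier_vec 7" "y \<in> carrier_vec 7"
    "x $ 0 = y $ 0" "x $ Suc 0 = y $ Suc 0" "x $ 2 = y $ 2" "x $ 3 = y $ 3" "x $ 4 = y $ 4"
    "x $ 5 = y $ 5" "x $ 6 = y $ 6"
  shows "x = (y :: bit vec)"
proof (rule eq_vecI)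
  fix i assume "i < dim_vec y"
  then have "i < 7" using assms(2) by simp
  then show "x $ i = y $ i" using less_7_cases[of i] assms(3-) by auto
qed (use assms(1,2) in simp)

lemma vec7_exhaust:
  assumes "x \<in> carrier_vec 7"
  obtains a b c d p q r where "x = vec7 a b c d p q r"
proof -
  have "x = vec7 (x $ 0) (x $ 1) (x $ 2) (x $ 3) (x $ 4) (x $ 5) (x $ 6)"
    by (rule vec7_eqI[OF assms]) simp_all
  then show ?thesis by (rule that)
qed

lemma step7_vec7: "step7 (vec7 a b c d p q r) = vec7 b (a + b) d (c + d) q r (p + q)"
  by (simp add: step7_def)

lemma bit_add_left_cancel [simp]: "(a::bit) + (a + b) = b"
  by (simp flip: add.assoc)

lemma step7_pow_3: "(step7 ^^ 3) (vec7 a b c d p q r) = vec7 a b c d (p + q) (q + r) (p + q + r)"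
  by (simp add: step7_vec7 eval_nat_numeral ac_simps)

text \<open>The cube is trivial on the two F_4 blocks, so its seventh power has to be checked only
  on the eight values of the F_8 block.\<close>

lemma step7_pow_21:
  assumes "x \<in> carrier_vec 7"
  shows "(step7 ^^ 21) x = x"
proof -
  obtain a b c d p q r where x: "x = vec7 a b c d p q r" by (rule vec7_exhaust[OF assms])
  have e: "(step7 ^^ 21) x = ((step7 ^^ 3) ^^ 7) x" by (simp add: funpow_mult)
  have "((step7 ^^ 3) ^^ Suc (Suc (Suc (Suc (Suc (Suc (Suc 0))))))) x = x"
    unfolding x by (cases p; cases q; cases r) (simp_all add: step7_pow_3)
  then show ?thesis unfolding e by (simp add: eval_nat_numeral)
qed

lemma step7_carrier [simp]: "step7 x \<in> carrier_vec 7"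
  unfolding step7_def by simp

definition act7 :: "nat \<Rightarrow> bit vec \<Rightarrow> bit vec" where
  "act7 = (\<lambda>k. \<lambda>x \<in> carrier_vec 7. (step7 ^^ k) x)"

lemma step7_pow_carrier [simp]: "x \<in> carrier_vec 7 \<Longrightarrow> (step7 ^^ k) x \<in> carrier_vec 7"
  by (induction k) simp_all

lemma step7_add:
  assumes "x \<in> carrier_vec 7" "y \<in> carrier_vec 7"
  shows "step7 (x + y) = step7 x + step7 y"
  by (rule vec7_eqI) (use assms in \<open>simp_all add: step7_def ac_simps\<close>)

lemma step7_smult:
  assumes "x \<in> carrier_vec 7"
  shows "step7 (c \<cdot>\<^sub>v x) = c \<cdot>\<^sub>v step7 x"
  by (rule vec7_eqI) (use assms in \<open>simp_all add: step7_def distrib_left\<close>)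

lemma step7_pow_linear:
  assumes "x \<in> carrier_vec 7" "y \<in> carrier_vec 7"
  shows "(step7 ^^ k) (x + y) = (step7 ^^ k) x + (step7 ^^ k) y" "(step7 ^^ k) (c \<cdot>\<^sub>v x) = c \<cdot>\<^sub>v (step7 ^^ k) x"
  by (induction k) (use assms in \<open>simp_all add: step7_add step7_smult\<close>)

lemma odd_action_7: "odd_action (cyclic_monoid 21) 7 act7"
  unfolding odd_action_def linear_action_def
proof (intro conjI ballI allI)
  show "group_action (cyclic_monoid 21) (carrier_vec 7) act7"
    unfolding act7_def by (rule cyclic_group_action) (simp_all add: step7_pow_21)
  show "finite (carrier (cyclic_monoid 21))" "odd (Coset.order (cyclic_monoid 21))"
    by (simp_all add: cyclic_monoid_def Coset.order_def)
  show "act7 k (x + y) = act7 k x + act7 k y" if "x \<in> carrier_vec 7" "y \<in> carrier_vec 7" for k x y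
    unfolding act7_def using that by (simp add: step7_pow_linear)
  show "act7 k (c \<cdot>\<^sub>v x) = c \<cdot>\<^sub>v act7 k x" if "x \<in> carrier_vec 7" for k c x
    unfolding act7_def using that by (simp add: step7_pow_linear)
  have z: "vec7 0 0 0 0 0 0 0 = 0\<^sub>v 7" by (rule vec7_eqI) simp_all
  show "fixed_points (cyclic_monoid 21) (carrier_vec 7) act7 = {0\<^sub>v 7}"
  proof
    show "fixed_points (cyclic_monoid 21) (carrier_vec 7) act7 \<subseteq> {0\<^sub>v 7}"
    proof
      fix x assume "x \<in> fixed_points (cyclic_monoid 21) (carrier_vec 7) act7"
      then have x: "x \<in> carrier_vec 7" "\<And>k. k < 21 \<Longrightarrow> act7 k x = x"
        by (auto simp: fixed_points_def cyclic_monoid_def)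
      have s: "step7 x = x" using x(2)[of 1] x(1) by (simp add: act7_def)
      obtain a b c d p q r where v: "x = vec7 a b c d p q r" by (rule vec7_exhaust[OF x(1)])
      have "a = b \<and> a + b = b \<and> c = d \<and> c + d = d \<and> p = q \<and> q = r \<and> p + q = r"
        using s unfolding v step7_vec7 by (metis vec7_index)
      then have "x = vec7 0 0 0 0 0 0 0" unfolding v by auto
      then show "x \<in> {0\<^sub>v 7}" using z by simp
    qed
    have s0: "step7 (0\<^sub>v 7) = 0\<^sub>v 7" unfolding z[symmetric] step7_vec7 by simp
    have "(step7 ^^ k) (0\<^sub>v 7) = 0\<^sub>v 7" for k by (induction k) (simp_all add: s0)
    then show "{0\<^sub>v 7} \<subseteq> fixed_points (cyclic_monoid 21) (carrier_vec 7) act7"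
      by (simp add: fixed_points_def act7_def)
  qed
qed

text \<open>Over 0 in F_8 stand the 15 nonzero vectors of F_4 + F_4; over each of the 7 other
  elements stand the 7 vectors on the two axes. This gives 15 + 49 = 64. Bit lists let the count be
  evaluated.\<close>

definition half7 :: "bit list \<Rightarrow> bool" where
  "half7 xs \<longleftrightarrow> (if xs ! 4 = 0 \<and> xs ! 5 = 0 \<and> xs ! 6 = 0
     then \<not> (xs ! 0 = 0 \<and> xs ! 1 = 0 \<and> xs ! 2 = 0 \<and> xs ! 3 = 0)
     else xs ! 0 = 0 \<and> xs ! 1 = 0 \<or> xs ! 2 = 0 \<and> xs ! 3 = 0)"

lemma length_half7: "length (filter half7 (List.n_lists 7 [0, 1])) = 64"
  by code_simp

text \<open>Orbit sizes \<open>64 = 1 \<cdot> 7 + 5 \<cdot> 3 + 2 \<cdot> 21\<close>: the nonzero vectors of \<open>F_8\<close> and of \<open>F_4 \<oplus> F_4\<close>, and the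
  pairs of a nonzero vector of \<open>F_8\<close> with one on either of the two axes of \<open>F_4 \<oplus> F_4\<close>.\<close>

lemma balanced_7: "balanced (cyclic_monoid 21) 7 act7"
proof -
  define X where "X = {xs. length xs = 7 \<and> half7 xs}"
  define S where "S = vec_of_list ` X"
  have X: "X = set (filter half7 (List.n_lists 7 [0, 1]))"
    unfolding X_def using UNIV_bit by (auto simp: set_n_lists)
  have "card X = 64"
    unfolding X using distinct_card[OF distinct_filter[OF distinct_n_lists], of "[0, 1]" half7 7] length_half7 by simp
  moreover have "inj_on vec_of_list X" by (rule inj_on_inverseI[where g = list_of_vec]) (simp add: list_vec)
  ultimately have "card S = 64" unfolding S_def by (simp add: card_image)
  then have half: "2 * card S = card (carrier_vec 7 :: bit vec set)" by (simp add: card_bit_vec)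
  have sub: "S \<subseteq> carrier_vec 7" unfolding S_def X_def by (auto intro: carrier_vecI)
  have memb: "vec7 a b c d p q r \<in> S \<longleftrightarrow> half7 [a, b, c, d, p, q, r]" for a b c d p q r
  proof
    assume "vec7 a b c d p q r \<in> S"
    then obtain xs where "xs \<in> X" "vec_of_list [a, b, c, d, p, q, r] = vec_of_list xs"
      unfolding S_def vec7_def by blast
    moreover from this(2) have "[a, b, c, d, p, q, r] = xs" by (metis list_vec)
    ultimately show "half7 [a, b, c, d, p, q, r]" unfolding X_def by simp
  next
    assume "half7 [a, b, c, d, p, q, r]"
    then have "[a, b, c, d, p, q, r] \<in> X" unfolding X_def by simp
    then show "vec7 a b c d p q r \<in> S" unfolding S_def vec7_def by (rule imageI)
  qed
  have stp: "step7 x \<in> S" if "x \<in> S" for x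
  proof -
    have "x \<in> carrier_vec 7" using sub that by blast
    then obtain a b c d p q r where v: "x = vec7 a b c d p q r" by (rule vec7_exhaust)
    \<comment> \<open>Invariance under the generator is verified on all 128 vectors.\<close>
    have "half7 [a, b, c, d, p, q, r] \<Longrightarrow> half7 [b, a + b, d, c + d, q, r, p + q]"
      unfolding half7_def
      by (cases a; cases b; cases c; cases d; cases p; cases q; cases r) (simp_all add: eval_nat_numeral)
    then show ?thesis using that unfolding v step7_vec7 memb by blast
  qed
  have "(step7 ^^ k) x \<in> S" if "x \<in> S" for k x by (induction k) (use that stp in auto)
  then have "act7 k ` S \<subseteq> S" for k using sub unfolding act7_def by auto
  then show ?thesis unfolding balanced_def using sub half by blast
qed

text \<open>The two lower-bound clauses hold for groups over any type \<open>'a\<close>, while the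
  example is given on \<open>nat\<close>: an arbitrary \<open>'a\<close> might be too small to carry
  a group of order 21.\<close>

theorem theorem3p5:
  shows "(\<forall>(A :: ('a, 'm) monoid_scheme) n \<phi>. odd_action A n \<phi> \<and> n \<le> 6 \<longrightarrow> \<not> balanced A n \<phi>) \<and>
    (\<exists>(A :: nat monoid) \<phi>. odd_action A 7 \<phi> \<and> counts_differ A 7 \<phi>) \<and>
    (\<forall>(A :: ('a, 'm) monoid_scheme) n \<phi>. odd_action A n \<phi> \<and> counts_differ A n \<phi> \<longrightarrow> 7 \<le> n)"
proof (intro conjI allI impI)
  fix A :: "('a, 'm) monoid_scheme" and n \<phi>
  assume A: "odd_action A n \<phi> \<and> n \<le> 6"
  then interpret odd_linear_action A n \<phi> by unfold_locales blast
  show "\<not> balanced A n \<phi>" using not_balanced A by blast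
next
  interpret odd_linear_action "cyclic_monoid 21" 7 act7 by unfold_locales (rule odd_action_7)
  show "\<exists>(A :: nat monoid) \<phi>. odd_action A 7 \<phi> \<and> counts_differ A 7 \<phi>"
    using odd_action_7 balanced_7 counts_differ_iff_balanced by blast
next
  fix A :: "('a, 'm) monoid_scheme" and n \<phi>
  assume A: "odd_action A n \<phi> \<and> counts_differ A n \<phi>"
  then interpret odd_linear_action A n \<phi> by unfold_locales blast
  show "7 \<le> n" using counts_differ_iff_balanced not_balanced A by fastforce
qed

end
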